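(* Let $k\geq 2$ be an integer. Then \[ \mathrm{ex}(n,C_{2k},\textnormal{rainbow-}C_{2k})= \begin{cases} \Theta(n^{k-1}) & \text{if } k\geq 3,\\ \Theta(n^{2}) & \text{if } k=2. \end{cases} \]
   Context: A proper edge-colouring of a graph assigns colours to edges so that any two edges sharing a vertex receive different colours. A subgraph of an edge-coloured graph is rainbow if all its edges have distinct colours. $\mathrm{ex}(n,H,\textnormal{rainbow-}F)$ denotes the maximum number of copies of $H$ in a properly edge-coloured graph on $n$ vertices containing no rainbow subgraph isomorphic to $F$. $C_m$ denotes the cycle of length $m$. Implied constants may depend on $k$. *)

theory Defs
  imports Complex_Main "HOL-Library.Landau_Symbols"
begin

type_synonym 'a sgraph = "'a set \<times> 'a set set"

abbreviation verts :: "'a sgraph \<Rightarrow> 'a set" where "verts \<equiv> fst"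
abbreviation edges :: "'a sgraph \<Rightarrow> 'a set set" where "edges \<equiv> snd"

definition finite_simple_graph :: "'a sgraph \<Rightarrow> bool" where
  "finite_simple_graph G \<longleftrightarrow>
     finite (verts G) \<and> (\<forall>e\<in>edges G. e \<subseteq> verts G \<and> card e = 2)"

definition is_subgraph :: "'a sgraph \<Rightarrow> 'a sgraph \<Rightarrow> bool" where
  "is_subgraph S G \<longleftrightarrow>
     finite_simple_graph S \<and> verts S \<subseteq> verts G \<and> edges S \<subseteq> edges G"

definition graph_isomorphic :: "'a sgraph \<Rightarrow> 'b sgraph \<Rightarrow> bool" where
  "graph_isomorphic H S \<longleftrightarrow>
     (\<exists>f. bij_betw f (verts H) (verts S) \<and> edges S = (\<lambda>e. f ` e) ` edges H)"

text \<open>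
  Copies are unlabelled: they are subgraphs isomorphic to H (not necessarily induced),
  and not embeddings of H.
\<close>
definition copies :: "'b sgraph \<Rightarrow> 'a sgraph \<Rightarrow> 'a sgraph set" where
  "copies H G = {S. is_subgraph S G \<and> graph_isomorphic H S}"

definition proper_edge_colouring :: "'a sgraph \<Rightarrow> ('a set \<Rightarrow> 'c) \<Rightarrow> bool" where
  "proper_edge_colouring G c \<longleftrightarrow>
     (\<forall>e\<in>edges G. \<forall>e'\<in>edges G. e \<noteq> e' \<and> e \<inter> e' \<noteq> {} \<longrightarrow> c e \<noteq> c e')"

definition rainbow :: "('a set \<Rightarrow> 'c) \<Rightarrow> 'a sgraph \<Rightarrow> bool" where
  "rainbow c S \<longleftrightarrow> inj_on c (edges S)"

definition rainbow_free :: "'b sgraph \<Rightarrow> 'a sgraph \<Rightarrow> ('a set \<Rightarrow> 'c) \<Rightarrow> bool" where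
  "rainbow_free F G c \<longleftrightarrow> \<not> (\<exists>S\<in>copies F G. rainbow c S)"

text \<open>
  Natural numbers suffice as vertices and as colours, since the graphs are finite;
  the number of colours is not restricted.
\<close>
definition copy_counts :: "nat \<Rightarrow> 'a sgraph \<Rightarrow> 'b sgraph \<Rightarrow> nat set" where
  "copy_counts n H F =
     {card (copies H G) | (G :: nat sgraph) (c :: nat set \<Rightarrow> nat).
        finite_simple_graph G \<and> card (verts G) = n \<and>
        proper_edge_colouring G c \<and> rainbow_free F G c}"

definition ex_rainbow :: "nat \<Rightarrow> 'a sgraph \<Rightarrow> 'b sgraph \<Rightarrow> nat" where
  "ex_rainbow n H F = Max (copy_counts n H F)"

text \<open>
  The cycle of length m, meaningful for \<open>m \<ge> 3\<close>.
\<close>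
definition cycle_graph :: "nat \<Rightarrow> nat sgraph" where
  "cycle_graph m = ({..<m}, {{i, (i + 1) mod m} | i. i < m})"

text \<open>
  The next three lemmas show that the maximum and the cycle graph are well defined.
\<close>

lemma finite_copy_counts: "finite (copy_counts n H F)"
proof -
  have "card (copies H G) \<le> 2 ^ n * 2 ^ (2 ^ n)"
    if G: "finite_simple_graph G" "card (verts G) = n" for G :: "nat sgraph"
  proof -
    have fin: "finite (verts G)"
      using G by (simp add: finite_simple_graph_def)
    have "copies H G \<subseteq> Pow (verts G) \<times> Pow (Pow (verts G))"
      by (fastforce simp: copies_def is_subgraph_def finite_simple_graph_def)
    then have "card (copies H G) \<le> card (Pow (verts G) \<times> Pow (Pow (verts G)))"
      using fin by (intro card_mono) auto
    then show ?thesis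
      using G fin by (simp add: card_cartesian_product card_Pow)
  qed
  then have "copy_counts n H F \<subseteq> {..2 ^ n * 2 ^ (2 ^ n)}"
    unfolding copy_counts_def by blast
  then show ?thesis
    using finite_subset by blast
qed

lemma copy_counts_nonempty:
  assumes "edges F \<noteq> {}"
  shows "copy_counts n H F \<noteq> {}"
proof -
  let ?G = "({..<n}, {}) :: nat sgraph"
  have "finite_simple_graph ?G" "card (verts ?G) = n"
    "proper_edge_colouring ?G (\<lambda>_. 0 :: nat)" "rainbow_free F ?G (\<lambda>_. 0 :: nat)"
    using assms
    by (auto simp: finite_simple_graph_def proper_edge_colouring_def rainbow_free_def
        copies_def is_subgraph_def graph_isomorphic_def)
  then show ?thesis
    unfolding copy_counts_def by blast
qed

lemma cycle_graph_simple:
  assumes "m \<ge> 3"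
  shows "finite_simple_graph (cycle_graph m)" and "edges (cycle_graph m) \<noteq> {}"
proof -
  have "i \<noteq> (i + 1) mod m" if "i < m" for i
    using that assms by (cases "i + 1 = m") auto
  then show "finite_simple_graph (cycle_graph m)"
    using assms by (auto simp: finite_simple_graph_def cycle_graph_def card_2_iff)
  show "edges (cycle_graph m) \<noteq> {}"
    using assms by (auto simp: cycle_graph_def intro!: exI[of _ 0])
qed

end

(* Call a pair of vertices fat if it has many common neighbours.  A closed chain of k fat pairs
   would extend greedily to a rainbow C_2k; hence the fat pairs inside any neighbourhood N(u) form
   a graph without a path on k vertices, so they can be oriented with bounded out-degree: for fat
   a, b in N(u), one of a, b has only boundedly many candidates given u and the other one.  In the
   same way a dense bipartite graph attached to N(u) yields a rainbow C_2k, so there are only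
   O(n) walks of two edges from each vertex.

   For k >= 3 the walks with three edges number Q = O(n^2).  Pairs (x, y) joined by 3-walks
   x u v y that can avoid any bounded set of vertices and colours ("flexible" pairs) are handled
   like neighbourhoods.  For the other pairs almost all 3-walks have one of boundedly many colours
   on the middle edge; two such walks with the same middle colour are determined up to O(1)
   choices by the 3-walk v u x u', so Q <= C n^2 + Q / 2.

   Now count 2k-cycles.  If some position is fat, some position of the same parity is not, and the
   cycle can be cut open there into a walk in which one vertex is determined up to O(1) choices by
   the orientation and the vertex at the cut by its two neighbours; this leaves O(n^(k-1)) choices.
   If no position is fat, the repeated colour plays the role of the orientation.

   Lower bounds: for k >= 3, two complete bipartite graphs with 2 and k - 1 hubs, joined by two
   disjoint edges of the same colour; for k = 2, a Cayley graph of F x F with F = GF(2^e) and the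
   Sidon set {(a, a^3)}. *)

theory Submission
  imports Defs "HOL-Library.FuncSet" "HOL-Library.Nat_Bijection" "HOL-Library.Countable_Set"
    "HOL-Library.Z2" "HOL-Algebra.Algebraic_Closure_Type"
begin

section \<open>Rainbow paths and fat pairs\<close>

text \<open>The exponent is a matter of bookkeeping. Two further vertices of a walk cost a factor
  O(n) together, while one further vertex alone may have linearly many candidates, so vertices are
  appended in pairs. Cutting a cycle at a thin pair determines one vertex; starting from a single
  vertex, the others would then cost n * n^(k-1), a factor n too much. With a second determined
  vertex an even number of free vertices remains, and a single vertex no longer fits as the start. A
  3-walk does: 4 + 2(k-3) free vertices cost n^2 * n^(k-3). This is why Q = O(n^2) is the central
  estimate.

  The gain of 1/2 in the bound for Q comes from counting pairs. If t walks from x to y share the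
  middle colour, about t^2 pairs of them do, so for any constant a the quantity a * t is at most the
  number of such pairs plus a constant. A 3-walk is charged by at most \<open>K\<close> such pairs,
  so a = 2 * \<open>K\<close> is enough.\<close>

lemma low_degree_orientation:
  fixes R :: "'a \<Rightarrow> 'a \<Rightarrow> bool"
  assumes "finite S"
    and "\<And>S'. S' \<subseteq> S \<Longrightarrow> S' \<noteq> {} \<Longrightarrow> \<exists>v\<in>S'. card {w\<in>S'. R v w} \<le> d"
    and sym: "\<And>a b. R a b \<Longrightarrow> R b a"
  shows "\<exists>f. (\<forall>a. finite (f a) \<and> card (f a) \<le> d) \<and> (\<forall>a\<in>S. \<forall>b\<in>S. R a b \<longrightarrow> b \<in> f a \<or> a \<in> f b)"
  using assms(1,2)
proof (induction "card S" arbitrary: S)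
  case 0
  then show ?case by (intro exI[of _ "\<lambda>_. {}"]) auto
next
  case (Suc m)
  from Suc.hyps(2) have "S \<noteq> {}" by auto
  then obtain v where v: "v \<in> S" "card {w\<in>S. R v w} \<le> d" using Suc.prems(2)[of S] by auto
  have "\<exists>f. (\<forall>a. finite (f a) \<and> card (f a) \<le> d) \<and>
      (\<forall>a\<in>S - {v}. \<forall>b\<in>S - {v}. R a b \<longrightarrow> b \<in> f a \<or> a \<in> f b)"
  proof (rule Suc.hyps(1))
    show "m = card (S - {v})" using Suc.hyps(2) v(1) Suc.prems(1) by simp
    show "finite (S - {v})" using Suc.prems by simp
    show "\<exists>v\<in>S'. card {w\<in>S'. R v w} \<le> d" if "S' \<subseteq> S - {v}" "S' \<noteq> {}" for S'
      using Suc.prems(2)[of S'] that by auto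
  qed
  then obtain f where f: "\<And>a. finite (f a) \<and> card (f a) \<le> d"
      "\<And>a b. a \<in> S - {v} \<Longrightarrow> b \<in> S - {v} \<Longrightarrow> R a b \<Longrightarrow> b \<in> f a \<or> a \<in> f b" by blast
  \<comment> \<open>Degeneracy order: all edges from the removed vertex \<open>v\<close> are
    directed out of \<open>v\<close>. Overwriting \<open>f v\<close> is harmless, since
    \<open>f\<close> is used only on \<open>S - {v}\<close>.\<close>
  show ?case
  proof (intro exI[of _ "f(v := {w\<in>S. R v w})"] conjI allI ballI impI)
    fix a show "finite ((f(v := {w\<in>S. R v w})) a)" "card ((f(v := {w\<in>S. R v w})) a) \<le> d"
      using f(1) v(2) Suc.prems(1) by auto
  next
    fix a b assume "a \<in> S" "b \<in> S" "R a b"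
    then show "b \<in> (f(v := {w\<in>S. R v w})) a \<or> a \<in> (f(v := {w\<in>S. R v w})) b"
      using f(2)[of a b] sym[of a b] by auto
  qed
qed

text \<open>Deleting a vertex of degree at most \<open>D\<close> removes at most \<open>D\<close>
  pairs and lowers \<open>card Z + card U\<close> by one, so the density hypothesis survives. It
  fails for the empty relation, so the deletion stops at a nonempty core.\<close>

lemma dense_relation_core:
  fixes Ed :: "('a \<times> 'b) set"
  assumes "finite Z" "finite U" "Ed \<subseteq> Z \<times> U" "card Ed > D * (card Z + card U)"
  shows "\<exists>Ed'\<subseteq>Ed. Ed' \<noteq> {} \<and> (\<forall>z\<in>Domain Ed'. card (Ed' `` {z}) > D) \<and>
           (\<forall>u\<in>Range Ed'. card (Ed'\<inverse> `` {u}) > D)"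
  using assms
proof (induction "card Z + card U" arbitrary: Z U Ed rule: less_induct)
  case less
  have finE: "finite Ed" using less.prems finite_subset by (metis finite_cartesian_product)
  show ?case
  proof (cases "\<exists>z\<in>Z. card (Ed `` {z}) \<le> D")
    case True
    then obtain z where z: "z \<in> Z" "card (Ed `` {z}) \<le> D" by auto
    define E1 where "E1 = Ed - {z} \<times> (Ed `` {z})"
    have "card Z = Suc (card (Z - {z}))" using card_Suc_Diff1[OF less.prems(1) z(1)] by simp
    moreover have "card E1 \<ge> card Ed - D"
    proof -
      have "card E1 = card Ed - card ({z} \<times> (Ed `` {z}))"
        unfolding E1_def by (rule card_Diff_subset) (use finE finite_subset[of "{z} \<times> (Ed `` {z})" Ed] in auto)
      then show ?thesis using z(2) by (simp add: card_cartesian_product)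
    qed
    ultimately have "card E1 > D * (card (Z - {z}) + card U)"
      using less.prems(4) by (simp add: algebra_simps)
    moreover have "E1 \<subseteq> (Z - {z}) \<times> U" using less.prems(3) by (auto simp: E1_def)
    ultimately have "\<exists>Ed'\<subseteq>E1. Ed' \<noteq> {} \<and> (\<forall>z\<in>Domain Ed'. card (Ed' `` {z}) > D) \<and>
           (\<forall>u\<in>Range Ed'. card (Ed'\<inverse> `` {u}) > D)"
      using less.hyps[of "Z - {z}" U E1] less.prems(1,2) \<open>card Z = Suc (card (Z - {z}))\<close> by simp
    moreover have "E1 \<subseteq> Ed" by (auto simp: E1_def)
    ultimately show ?thesis by (meson order_trans)
  next
    case F1: False
    show ?thesis
    proof (cases "\<exists>u\<in>U. card (Ed\<inverse> `` {u}) \<le> D")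
      case True
      then obtain u where u: "u \<in> U" "card (Ed\<inverse> `` {u}) \<le> D" by auto
      define E1 where "E1 = Ed - (Ed\<inverse> `` {u}) \<times> {u}"
      have "card U = Suc (card (U - {u}))" using card_Suc_Diff1[OF less.prems(2) u(1)] by simp
      moreover have "card E1 \<ge> card Ed - D"
      proof -
        have "card E1 = card Ed - card ((Ed\<inverse> `` {u}) \<times> {u})"
          unfolding E1_def by (rule card_Diff_subset) (use finE finite_subset[of "(Ed\<inverse> `` {u}) \<times> {u}" Ed] in auto)
        then show ?thesis using u(2) by (simp add: card_cartesian_product)
      qed
      ultimately have "card E1 > D * (card Z + card (U - {u}))"
        using less.prems(4) by (simp add: algebra_simps)
      moreover have "E1 \<subseteq> Z \<times> (U - {u})" using less.prems(3) by (auto simp: E1_def)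
      ultimately have "\<exists>Ed'\<subseteq>E1. Ed' \<noteq> {} \<and> (\<forall>z\<in>Domain Ed'. card (Ed' `` {z}) > D) \<and>
             (\<forall>u\<in>Range Ed'. card (Ed'\<inverse> `` {u}) > D)"
        using less.hyps[of Z "U - {u}" E1] less.prems(1,2) \<open>card U = Suc (card (U - {u}))\<close> by simp
      moreover have "E1 \<subseteq> Ed" by (auto simp: E1_def)
      ultimately show ?thesis by (meson order_trans)
    next
      case False
      show ?thesis
      proof (intro exI[of _ Ed] conjI ballI)
        show "Ed \<noteq> {}" using less.prems(4) by auto
      qed (use F1 False less.prems(3) in \<open>auto simp: not_le\<close>)
    qed
  qed
qed

lemma exists_outside:
  assumes "card A > card B" "finite B"
  shows "\<exists>a\<in>A. a \<notin> B"
proof (rule ccontr)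
  assume "\<not> ?thesis"
  then have "A \<subseteq> B" by auto
  then show False using card_mono[OF assms(2), of A] assms(1) by simp
qed

lemma card_Un3_le: "card (A \<union> B \<union> C) \<le> card A + card B + card C"
  by (meson add_le_mono card_Un_le le_refl order_trans)

section \<open>Properly edge-coloured graphs, rainbow paths, chains of fat pairs\<close>

locale coloured_graph =
  fixes V :: "'a set" and adj :: "'a \<Rightarrow> 'a \<Rightarrow> bool" and col :: "'a \<Rightarrow> 'a \<Rightarrow> 'c"
  assumes finite_V: "finite V"
    and adj_in_V: "adj a b \<Longrightarrow> a \<in> V"
    and adj_sym: "adj a b \<Longrightarrow> adj b a"
    and adj_irrefl: "\<not> adj a a"
    and col_sym: "col a b = col b a"
    and col_proper: "adj a b \<Longrightarrow> adj a b' \<Longrightarrow> col a b = col a b' \<Longrightarrow> b = b'"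
begin

definition nbrs :: "'a \<Rightarrow> 'a set" where "nbrs a = {b. adj a b}"

lemma nbrs_subset: "nbrs a \<subseteq> V"
  using adj_in_V adj_sym by (auto simp: nbrs_def)

lemma finite_nbrs [simp]: "finite (nbrs a)"
  using nbrs_subset finite_V finite_subset by blast

lemma card_nbrs_le: "card (nbrs a) \<le> card V"
  using nbrs_subset finite_V card_mono by blast

lemma adj_in_V2: "adj a b \<Longrightarrow> b \<in> V"
  using adj_in_V adj_sym by blast

lemma inj_on_col: "inj_on (col a) (nbrs a)"
  using col_proper by (auto simp: inj_on_def nbrs_def)

lemma card_col_in_le:
  assumes "finite \<Gamma>"
  shows "finite {b. adj a b \<and> col a b \<in> \<Gamma>}" "card {b. adj a b \<and> col a b \<in> \<Gamma>} \<le> card \<Gamma>"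
proof -
  have s: "{b. adj a b \<and> col a b \<in> \<Gamma>} \<subseteq> nbrs a" by (auto simp: nbrs_def)
  then show "finite {b. adj a b \<and> col a b \<in> \<Gamma>}" using finite_nbrs finite_subset by blast
  show "card {b. adj a b \<and> col a b \<in> \<Gamma>} \<le> card \<Gamma>"
    by (rule card_inj_on_le[of "col a"]) (use inj_on_subset[OF inj_on_col s] assms in auto)
qed

fun cols :: "'a list \<Rightarrow> 'c list" where
  "cols (a # b # r) = col a b # cols (b # r)"
| "cols _ = []"

lemma length_cols: "length (cols xs) = length xs - 1"
  by (induction xs rule: cols.induct) auto

lemma cols_append: "xs \<noteq> [] \<Longrightarrow> cols (xs @ y # ys) = cols xs @ col (last xs) y # cols (y # ys)"
  by (induction xs rule: cols.induct) auto

lemma cols_nth: "Suc i < length xs \<Longrightarrow> cols xs ! i = col (xs ! i) (xs ! Suc i)"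
  by (induction xs arbitrary: i rule: cols.induct) (auto simp: nth_Cons split: nat.splits)

definition rpath :: "'a list \<Rightarrow> bool" where
  "rpath xs \<longleftrightarrow> distinct xs \<and> successively adj xs \<and> distinct (cols xs)"

definition rcycle :: "'a list \<Rightarrow> bool" where
  "rcycle xs \<longleftrightarrow> rpath xs \<and> xs \<noteq> [] \<and> adj (last xs) (hd xs) \<and> col (last xs) (hd xs) \<notin> set (cols xs)"

lemma rpath_single: "rpath [a]" by (simp add: rpath_def)

lemma rpath_append:
  assumes "xs \<noteq> []" "zs \<noteq> []"
  shows "rpath (xs @ zs) \<longleftrightarrow> rpath xs \<and> rpath zs \<and> set xs \<inter> set zs = {} \<and>
     adj (last xs) (hd zs) \<and> col (last xs) (hd zs) \<notin> set (cols xs) \<and>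
     col (last xs) (hd zs) \<notin> set (cols zs) \<and> set (cols xs) \<inter> set (cols zs) = {}"
proof -
  have "cols (xs @ zs) = cols xs @ col (last xs) (hd zs) # cols zs"
    using assms cols_append[of xs "hd zs" "tl zs"] by simp
  then show ?thesis
    using assms by (simp add: rpath_def successively_append_iff) blast
qed

lemma rpath_snoc:
  "xs \<noteq> [] \<Longrightarrow> rpath (xs @ [y]) \<longleftrightarrow> rpath xs \<and> y \<notin> set xs \<and> adj (last xs) y \<and> col (last xs) y \<notin> set (cols xs)"
  by (subst rpath_append) (auto simp: rpath_single)

lemma rpath_Cons: "xs \<noteq> [] \<Longrightarrow>
    rpath (y # xs) \<longleftrightarrow> rpath xs \<and> y \<notin> set xs \<and> adj y (hd xs) \<and> col y (hd xs) \<notin> set (cols xs)"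
  by (cases xs) (auto simp: rpath_def)

definition fat :: "nat \<Rightarrow> 'a \<Rightarrow> 'a \<Rightarrow> bool" where
  "fat K a b \<longleftrightarrow> a \<noteq> b \<and> K \<le> card (nbrs a \<inter> nbrs b)"

lemma fat_sym: "fat K a b \<Longrightarrow> fat K b a"
  by (auto simp: fat_def Int_commute)

text \<open>By properness each colour of \<open>\<Gamma>\<close> spoils at most one common neighbour
  on the side of \<open>a\<close> and one on the side of \<open>b\<close>; this is the summand
  \<open>2 * card \<Gamma>\<close>.\<close>

lemma fat_middle:
  assumes "fat K a b" "finite W" "finite \<Gamma>" "card W + 2 * card \<Gamma> < K"
  shows "\<exists>m. adj a m \<and> adj m b \<and> m \<notin> W \<and> col a m \<notin> \<Gamma> \<and> col m b \<notin> \<Gamma>"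
proof -
  let ?B = "W \<union> {m. adj a m \<and> col a m \<in> \<Gamma>} \<union> {m. adj b m \<and> col b m \<in> \<Gamma>}"
  have "card ?B \<le> card W + card \<Gamma> + card \<Gamma>"
    using card_Un3_le[of W] card_col_in_le(2)[OF assms(3), of a] card_col_in_le(2)[OF assms(3), of b]
    by (meson add_mono le_refl order_trans)
  then have "card ?B < card (nbrs a \<inter> nbrs b)" using assms(1,4) by (simp add: fat_def)
  moreover have "finite ?B" using assms card_col_in_le by auto
  ultimately obtain m where "m \<in> nbrs a \<inter> nbrs b" "m \<notin> ?B"
    using exists_outside[of ?B] by blast
  then show ?thesis using adj_sym[of b m] col_sym[of b m] by (intro exI[of _ m]) (auto simp: nbrs_def)
qed

text \<open>A middle vertex is inserted between consecutive vertices of \<open>hs\<close>, from the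
  last pair to the first. The chain itself may meet \<open>W\<close>, so avoidance is claimed only
  off \<open>set hs\<close>. Beyond \<open>W\<close> and \<open>\<Gamma>\<close> a step forbids
  fewer than \<open>7 * length hs\<close> vertices and colours, colours counted twice; the factor 10
  also covers the growth of \<open>W\<close>.\<close>

lemma fat_chain_path:
  assumes "hs \<noteq> []" "distinct hs" "successively (fat K) hs" "finite W" "finite \<Gamma>"
    "card W + 2 * card \<Gamma> + 10 * length hs \<le> K"
  shows "\<exists>p. rpath p \<and> p \<noteq> [] \<and> hd p = hd hs \<and> last p = last hs \<and> length p = 2 * length hs - 1 \<and>
     set p \<inter> W \<subseteq> set hs \<and> set (cols p) \<inter> \<Gamma> = {}"
  using assms
proof (induction hs arbitrary: W)
  case Nil
  then show ?case by simp
next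
  case (Cons h hs)
  show ?case
  proof (cases "hs = []")
    case True
    then show ?thesis by (intro exI[of _ "[h]"]) (auto simp: rpath_single)
  next
    case False
    \<comment> \<open>The path for the tail has to avoid \<open>h\<close>, which therefore joins the
      forbidden vertices; for this \<open>W\<close> varies in the induction.\<close>
    have "card (insert h W) \<le> Suc (card W)" by (simp add: card_insert_le_m1)
    then have "\<exists>p. rpath p \<and> p \<noteq> [] \<and> hd p = hd hs \<and> last p = last hs \<and> length p = 2 * length hs - 1 \<and>
       set p \<inter> insert h W \<subseteq> set hs \<and> set (cols p) \<inter> \<Gamma> = {}"
      using Cons.prems False by (intro Cons.IH) (auto simp: successively_Cons)
    then obtain p where p: "rpath p" "p \<noteq> []" "hd p = hd hs" "last p = last hs" "length p = 2 * length hs - 1"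
       "set p \<inter> insert h W \<subseteq> set hs" "set (cols p) \<inter> \<Gamma> = {}" by blast
    have hfat: "fat K h (hd hs)" using Cons.prems False by (auto simp: successively_Cons)
    have c1: "card (insert h (W \<union> set p \<union> set hs)) \<le> 1 + (card W + card (set p) + card (set hs))"
      using card_Un3_le[of W "set p" "set hs"] by (simp add: card_insert_if Cons.prems)
    have c2: "card (set p) \<le> 2 * length hs - 1" "card (set hs) \<le> length hs"
      using p(5) card_length by metis+
    have c3: "card (\<Gamma> \<union> set (cols p)) \<le> card \<Gamma> + (2 * length hs - 2)"
      using card_Un_le[of \<Gamma> "set (cols p)"] card_length[of "cols p"] p(5) by (simp add: length_cols)
    have "\<exists>m. adj h m \<and> adj m (hd hs) \<and> m \<notin> insert h (W \<union> set p \<union> set hs) \<and>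
        col h m \<notin> \<Gamma> \<union> set (cols p) \<and> col m (hd hs) \<notin> \<Gamma> \<union> set (cols p)"
      using c1 c2 c3 Cons.prems(4,5,6) by (intro fat_middle[OF hfat]) auto
    then obtain m where m: "adj h m" "adj m (hd hs)" "m \<notin> insert h (W \<union> set p \<union> set hs)"
        "col h m \<notin> \<Gamma> \<union> set (cols p)" "col m (hd hs) \<notin> \<Gamma> \<union> set (cols p)" by blast
    have nq: "col h m \<noteq> col m (hd hs)"
      using col_proper[of m h "hd hs"] m adj_sym[of h m] col_sym[of h m] hfat by (auto simp: fat_def)
    have hp: "h \<notin> set p" using p(6) Cons.prems(2) by auto
    have mp: "rpath (m # p)" using p(1-3) m by (simp add: rpath_Cons)
    have cm: "cols (m # p) = col m (hd hs) # cols p" using p(2,3) by (cases p) auto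
    have rp: "rpath (h # m # p)"
      using mp cm hp m nq by (subst rpath_Cons) auto
    have cc: "set (cols (h # m # p)) \<inter> \<Gamma> = {}" using cm m p(7) by auto
    show ?thesis
      using rp cc m(3) p(2,4,5,6) False
      by (intro exI[of _ "h # m # p"]) (cases hs, auto)
  qed
qed

end

context coloured_graph
begin

lemma fat_greedy_path:
  assumes "S \<noteq> {}" "finite S" "\<And>v. v \<in> S \<Longrightarrow> card {w\<in>S. fat K v w} > d"
  shows "j \<le> d \<Longrightarrow> \<exists>hs. length hs = Suc j \<and> distinct hs \<and> set hs \<subseteq> S \<and> successively (fat K) hs"
proof (induction j)
  case 0
  obtain v where "v \<in> S" using assms(1) by auto
  then show ?case by (intro exI[of _ "[v]"]) auto
next
  case (Suc j)
  then obtain hs where hs: "length hs = Suc j" "distinct hs" "set hs \<subseteq> S" "successively (fat K) hs" by auto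
  then have ne: "hs \<noteq> []" by auto
  have hd: "hd hs \<in> S" using hs(3) ne by auto
  have "card {w\<in>S. fat K (hd hs) w} > card (set hs)"
    using assms(3)[OF hd] Suc.prems hs(1,2) by (simp add: distinct_card)
  then obtain w where "w \<in> {w\<in>S. fat K (hd hs) w}" "w \<notin> set hs"
    using exists_outside[of "set hs"] by blast
  then show ?case
    using hs ne by (intro exI[of _ "w # hs"]) (auto simp: successively_Cons fat_sym)
qed

text \<open>Choosing a point of \<open>F z \<inter> B\<close> for each \<open>z\<close> is injective
  by disjointness. This bounds the endpoints that are lost because their closing colour has already
  been used.\<close>

lemma card_meet_disjoint_family_le:
  assumes "finite B" "\<And>z z'. z \<in> A \<Longrightarrow> z' \<in> A \<Longrightarrow> z \<noteq> z' \<Longrightarrow> F z \<inter> F z' = {}"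
  shows "finite {z\<in>A. F z \<inter> B \<noteq> {}}" "card {z\<in>A. F z \<inter> B \<noteq> {}} \<le> card B"
proof -
  define g where "g z = (SOME b. b \<in> F z \<inter> B)" for z
  have g: "g z \<in> F z \<inter> B" if "F z \<inter> B \<noteq> {}" for z
    unfolding g_def using that some_in_eq by blast
  have inj: "inj_on g {z\<in>A. F z \<inter> B \<noteq> {}}"
  proof (rule inj_onI)
    fix z z' assume *: "z \<in> {z\<in>A. F z \<inter> B \<noteq> {}}" "z' \<in> {z\<in>A. F z \<inter> B \<noteq> {}}" "g z = g z'"
    then have "g z \<in> F z \<inter> F z'" using g[of z] g[of z'] by auto
    then show "z = z'" using assms(2)[of z z'] * by auto
  qed
  have sub: "g ` {z\<in>A. F z \<inter> B \<noteq> {}} \<subseteq> B" using g by auto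
  show "finite {z\<in>A. F z \<inter> B \<noteq> {}}" using inj sub assms(1) by (meson inj_on_finite)
  show "card {z\<in>A. F z \<inter> B \<noteq> {}} \<le> card B" using inj sub assms(1) by (meson card_inj_on_le)
qed

text \<open>
  In the applications \<open>F z\<close> contains the colour of the edge that later joins the endpoint \<open>z\<close> to
  a fixed vertex, or is empty when the endpoints are joined by flexible pairs.
\<close>
lemma alternating_rpath:
  fixes F :: "'a \<Rightarrow> 'c set"
  assumes Ed: "Ed \<noteq> {}" "finite Ed" "\<And>z u. (z, u) \<in> Ed \<Longrightarrow> adj z u"
    and dZ: "\<And>z. z \<in> Domain Ed \<Longrightarrow> card (Ed `` {z}) > D"
    and dU: "\<And>u. u \<in> Range Ed \<Longrightarrow> card (Ed\<inverse> `` {u}) > D"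
    and W: "finite W" "Domain Ed \<inter> W = {}"
    and F: "\<And>z. finite (F z)" "\<And>z. card (F z) \<le> 1"
      "\<And>z z'. z \<in> Domain Ed \<Longrightarrow> z' \<in> Domain Ed \<Longrightarrow> z \<noteq> z' \<Longrightarrow> F z \<inter> F z' = {}"
      "\<And>z u. (z, u) \<in> Ed \<Longrightarrow> u \<notin> W \<Longrightarrow> col z u \<notin> F z"
  shows "card W + 6 * l \<le> D \<Longrightarrow> \<exists>p. rpath p \<and> length p = 2 * l + 1 \<and> hd p \<in> Domain Ed \<and> last p \<in> Domain Ed \<and>
     set p \<inter> W = {} \<and> set (cols p) \<inter> (F (hd p) \<union> F (last p)) = {}"
proof (induction l)
  case 0
  obtain z where "z \<in> Domain Ed" using Ed(1) by auto
  then show ?case using W(2) by (intro exI[of _ "[z]"]) (auto simp: rpath_single)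
next
  case (Suc l)
  then obtain p where p: "rpath p" "length p = 2 * l + 1" "hd p \<in> Domain Ed" "last p \<in> Domain Ed"
     "set p \<inter> W = {}" "set (cols p) \<inter> (F (hd p) \<union> F (last p)) = {}" by auto
  have ne: "p \<noteq> []" using p(2) by auto
  have sp: "card (set p) \<le> 2 * l + 1" using card_length[of p] p(2) by simp
  have sc: "card (set (cols p)) \<le> 2 * l" using card_length[of "cols p"] p(2) by (simp add: length_cols)
  define z where "z = last p"
  define \<Gamma> where "\<Gamma> = set (cols p) \<union> F (hd p)"
  have c\<Gamma>: "finite \<Gamma>" "card \<Gamma> \<le> 2 * l + 1"
    using card_Un_le[of "set (cols p)" "F (hd p)"] sc F(1)[of "hd p"] F(2)[of "hd p"] by (auto simp: \<Gamma>_def)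
  \<comment> \<open>The next vertex keeps off the path, off \<open>W\<close>, off the used colours
    and off the closing colour at the head, which excludes at most \<open>card W + 4 * l + 2\<close>
    candidates.\<close>
  let ?B = "set p \<union> W \<union> {b. adj z b \<and> col z b \<in> \<Gamma>}"
  have "card ?B \<le> (2 * l + 1) + card W + (2 * l + 1)"
    using card_Un3_le[of "set p" W "{b. adj z b \<and> col z b \<in> \<Gamma>}"] sp c\<Gamma>(2) card_col_in_le(2)[OF c\<Gamma>(1), of z] by linarith
  then have "card ?B < card (Ed `` {z})" using dZ[of z] p(4) Suc.prems by (simp add: z_def)
  moreover have "finite ?B" using W card_col_in_le(1)[OF c\<Gamma>(1)] by auto
  ultimately obtain u where u: "u \<in> Ed `` {z}" "u \<notin> ?B" using exists_outside[of ?B] by blast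
  then have zu: "(z, u) \<in> Ed" "adj z u" "u \<notin> set p" "u \<notin> W" "col z u \<notin> \<Gamma>" using Ed(3) by auto
  \<comment> \<open>The closing colour of the new endpoint must differ from all colours used so far,
    including that of the edge just added. As the sets \<open>F z\<close> are disjoint, each of
    these colours excludes at most one endpoint. In total at most \<open>6 * l + 5\<close>
    candidates are lost, whence the term \<open>6 * l\<close> of the premise.\<close>
  define \<Gamma>' where "\<Gamma>' = insert (col z u) (set (cols p))"
  have c\<Gamma>': "finite \<Gamma>'" "card \<Gamma>' \<le> 2 * l + 1"
    using sc by (auto simp: \<Gamma>'_def card_insert_if)
  let ?Xs = "{b. adj u b \<and> col u b \<in> insert (col z u) \<Gamma>}"
  let ?Y = "{z' \<in> Domain Ed. F z' \<inter> \<Gamma>' \<noteq> {}}"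
  let ?B' = "insert u (set p) \<union> ?Xs \<union> ?Y"
  have ci: "card (insert (col z u) \<Gamma>) \<le> 2 * l + 2" using c\<Gamma> by (simp add: card_insert_if)
  have cX: "finite ?Xs" "card ?Xs \<le> 2 * l + 2"
    using card_col_in_le[of "insert (col z u) \<Gamma>" u] ci c\<Gamma>(1) by auto
  have cY: "finite ?Y" "card ?Y \<le> 2 * l + 1"
    using card_meet_disjoint_family_le[OF c\<Gamma>'(1), of "Domain Ed" F] F(3) c\<Gamma>'(2) by auto
  have "card (insert u (set p)) \<le> 2 * l + 2" using sp by (simp add: card_insert_if)
  then have "card ?B' \<le> (2 * l + 2) + (2 * l + 2) + (2 * l + 1)"
    using card_Un3_le[of "insert u (set p)" ?Xs ?Y] cX(2) cY(2) by linarith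
  then have "card ?B' < card (Ed\<inverse> `` {u})" using dU[of u] zu(1) Suc.prems by fastforce
  moreover have "finite ?B'" using cX cY by auto
  ultimately obtain w where w: "w \<in> Ed\<inverse> `` {u}" "w \<notin> ?B'" using exists_outside[of ?B'] by blast
  have wu: "(w, u) \<in> Ed" using w(1) by auto
  have uw: "adj u w" using Ed(3)[OF wu] adj_sym by blast
  have wD: "w \<in> Domain Ed" using wu by auto
  have w2: "w \<notin> set p" "w \<noteq> u" "col u w \<notin> insert (col z u) \<Gamma>" "F w \<inter> \<Gamma>' = {}"
    using w(2) uw wD by auto
  have "col u w \<notin> F w" using F(4)[OF wu zu(4)] col_sym by metis
  have r1: "rpath (p @ [u])" using p(1) zu ne by (subst rpath_snoc) (auto simp: z_def \<Gamma>_def)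
  have c1: "cols (p @ [u]) = cols p @ [col z u]" using cols_append[OF ne, of u "[]"] by (simp add: z_def)
  have r2: "rpath ((p @ [u]) @ [w])"
    using r1 c1 w2 uw by (subst rpath_snoc) (auto simp: \<Gamma>_def)
  have c2: "cols ((p @ [u]) @ [w]) = cols p @ [col z u, col u w]"
    using cols_append[of "p @ [u]" w "[]"] c1 by simp
  have "set (cols ((p @ [u]) @ [w])) \<inter> (F (hd p) \<union> F w) = {}"
    unfolding c2 using w2 \<open>col u w \<notin> F w\<close> p(6) zu(5) by (auto simp: \<Gamma>_def \<Gamma>'_def)
  then show ?case
    using r2 p(2,3,5) ne wD zu(4) W(2)
    by (intro exI[of _ "(p @ [u]) @ [w]"]) auto
qed

end

section \<open>Graphs without a rainbow 2k-cycle\<close>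

locale rainbow_cycle_free = coloured_graph V adj col
  for V :: "'a set" and adj :: "'a \<Rightarrow> 'a \<Rightarrow> bool" and col :: "'a \<Rightarrow> 'a \<Rightarrow> 'c" +
  fixes k :: nat
  assumes k_ge_2: "k \<ge> 2"
    and no_rcycle: "length xs = 2 * k \<Longrightarrow> \<not> rcycle xs"
begin

text \<open>Both sizes are dictated by the greedy constructions: \<open>fat_chain_path\<close> with
  one forbidden vertex, two forbidden colours and \<open>k\<close> chain vertices asks for
  \<open>5 + 10 * k\<close>, and \<open>alternating_rpath\<close> with a single vertex in
  \<open>W\<close> asks for \<open>1 + 6 * (k - 1)\<close>. The rest is slack.\<close>

definition K :: nat where "K = 20 * k + 20"
definition D :: nat where "D = 8 * k + 8"

text \<open>The \<open>k\<close> chain vertices and \<open>k - 1\<close> middle vertices, chosen to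
  avoid \<open>z\<close> and the colours of its two edges, close up through \<open>z\<close> to a
  rainbow cycle of length \<open>2 * k\<close>.\<close>

lemma no_fat_chain:
  assumes "length hs = k" "distinct hs" "successively (fat K) hs"
    "adj z (hd hs)" "adj z (last hs)" "z \<notin> set hs"
  shows False
proof -
  have ne: "hs \<noteq> []" using assms(1) k_ge_2 by auto
  have hl: "hd hs \<noteq> last hs"
    using assms(1,2) k_ge_2 by (cases hs) (auto split: if_splits)
  let ?\<Gamma> = "{col z (hd hs), col z (last hs)}"
  have "card ?\<Gamma> \<le> 2" by (simp add: card_insert_if)
  then obtain p where p: "rpath p" "p \<noteq> []" "hd p = hd hs" "last p = last hs" "length p = 2 * length hs - 1"
     "set p \<inter> {z} \<subseteq> set hs" "set (cols p) \<inter> ?\<Gamma> = {}"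
    using fat_chain_path[OF ne assms(2,3), of "{z}" ?\<Gamma>] assms(1) by (auto simp: K_def)
  have zp: "z \<notin> set p" using p(6) assms(6) by auto
  have neq: "col z (hd hs) \<noteq> col z (last hs)" using col_proper[OF assms(4,5)] hl by blast
  have "rcycle (p @ [z])"
    unfolding rcycle_def using p zp neq assms(4,5) adj_sym
    by (auto simp: rpath_snoc cols_append col_sym[of _ z])
  moreover have "length (p @ [z]) = 2 * k" using p(5) assms(1) k_ge_2 by simp
  ultimately show False using no_rcycle by blast
qed

text \<open>Otherwise a dense core contains an alternating rainbow path on \<open>2 * k - 1\<close>
  vertices with both ends in \<open>nbrs y\<close>, avoiding \<open>y\<close> and the two colours
  that join its ends to \<open>y\<close>; then \<open>y\<close> closes a rainbow cycle.\<close>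

lemma neighbourhood_edges_le:
  assumes "Z \<subseteq> nbrs y" "finite U"
  shows "card {(z, u). z \<in> Z \<and> u \<in> U \<and> adj z u} \<le> D * (card Z + card U)"
proof (rule ccontr)
  let ?Ed = "{(z, u). z \<in> Z \<and> u \<in> U \<and> adj z u}"
  assume "\<not> ?thesis"
  then have large: "card ?Ed > D * (card Z + card U)" by (simp only: not_le)
  have fZ: "finite Z" using finite_subset[OF assms(1)] by simp
  have "?Ed \<subseteq> Z \<times> U" by auto
  from dense_relation_core[OF fZ assms(2) this large] obtain Ed where Ed: "Ed \<subseteq> ?Ed" "Ed \<noteq> {}" "\<forall>z\<in>Domain Ed. card (Ed `` {z}) > D"
      "\<forall>u\<in>Range Ed. card (Ed\<inverse> `` {u}) > D"
    by blast
  have DZ: "Domain Ed \<subseteq> nbrs y" using Ed(1) assms(1) by auto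
  have finEd: "finite Ed" using Ed(1) fZ assms(2) finite_subset[of Ed "Z \<times> U"] by auto
  have "\<exists>p. rpath p \<and> length p = 2 * (k - 1) + 1 \<and> hd p \<in> Domain Ed \<and> last p \<in> Domain Ed \<and>
     set p \<inter> {y} = {} \<and> set (cols p) \<inter> ({col y (hd p)} \<union> {col y (last p)}) = {}"
  proof (rule alternating_rpath[where F = "\<lambda>z. {col y z}" and D = D])
    show "Domain Ed \<inter> {y} = {}" using DZ adj_irrefl by (auto simp: nbrs_def)
    show "col z u \<notin> {col y z}" if "(z, u) \<in> Ed" "u \<notin> {y}" for z u
    proof -
      have "adj z u" "adj z y" using that Ed(1) DZ adj_sym by (auto simp: nbrs_def)
      then show ?thesis using col_proper[of z u y] that col_sym[of z y] by auto
    qed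
    show "{col y z} \<inter> {col y z'} = {}" if "z \<in> Domain Ed" "z' \<in> Domain Ed" "z \<noteq> z'" for z z'
      using that DZ inj_on_col[of y] by (auto simp: inj_on_def)
    show "card {y} + 6 * (k - 1) \<le> D" by (simp add: D_def)
  qed (use Ed finEd in auto)
  then obtain p where p: "rpath p" "length p = 2 * (k - 1) + 1" "hd p \<in> Domain Ed" "last p \<in> Domain Ed"
     "set p \<inter> {y} = {}" "set (cols p) \<inter> ({col y (hd p)} \<union> {col y (last p)}) = {}"
    by blast
  have ne: "p \<noteq> []" using p(2) by auto
  have hl: "hd p \<noteq> last p" using p(1,2) k_ge_2 ne by (cases p) (auto simp: rpath_def split: if_splits)
  have "adj y (hd p)" "adj y (last p)" using p(3,4) DZ by (auto simp: nbrs_def)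
  moreover from this have "col y (hd p) \<noteq> col y (last p)" using col_proper hl by blast
  ultimately have "rcycle (p @ [y])"
    unfolding rcycle_def using p ne adj_sym
    by (auto simp: rpath_snoc cols_append col_sym[of _ y])
  moreover have "length (p @ [y]) = 2 * k" using p(2) k_ge_2 by simp
  ultimately show False using no_rcycle by blast
qed

text \<open>If all fat degrees inside some part of \<open>nbrs u\<close> exceeded \<open>k\<close>,
  a greedy path of fat pairs on \<open>k\<close> vertices would contradict
  \<open>no_fat_chain\<close> at \<open>u\<close>.\<close>

lemma fat_orientation_exists:
  "\<exists>f. (\<forall>a. finite (f a) \<and> card (f a) \<le> k) \<and>
     (\<forall>a\<in>nbrs u. \<forall>b\<in>nbrs u. fat K a b \<longrightarrow> b \<in> f a \<or> a \<in> f b)"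
proof (rule low_degree_orientation)
  show "finite (nbrs u)" by simp
  show "fat K b a" if "fat K a b" for a b using fat_sym that .
  fix S assume S: "S \<subseteq> nbrs u" "S \<noteq> {}"
  show "\<exists>v\<in>S. card {w\<in>S. fat K v w} \<le> k"
  proof (rule ccontr)
    assume "\<not> ?thesis"
    then have "\<And>v. v \<in> S \<Longrightarrow> card {w\<in>S. fat K v w} > k" by auto
    then obtain hs where hs: "length hs = Suc (k - 1)" "distinct hs" "set hs \<subseteq> S" "successively (fat K) hs"
      using fat_greedy_path[OF S(2), of k K "k - 1"] finite_subset[OF S(1)] by auto
    then have ne: "hs \<noteq> []" by auto
    show False
    proof (rule no_fat_chain)
      show "length hs = k" using hs(1) k_ge_2 by simp
      have "hd hs \<in> nbrs u" "last hs \<in> nbrs u"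
        using hs(3) S(1) hd_in_set[OF ne] last_in_set[OF ne] by blast+
      then show "adj u (hd hs)" "adj u (last hs)" by (auto simp: nbrs_def)
      show "u \<notin> set hs" using hs(3) S(1) adj_irrefl by (auto simp: nbrs_def)
    qed (use hs in auto)
  qed
qed

definition succs :: "'a \<Rightarrow> 'a \<Rightarrow> 'a set" where
  "succs u = (SOME f. (\<forall>a. finite (f a) \<and> card (f a) \<le> k) \<and>
     (\<forall>a\<in>nbrs u. \<forall>b\<in>nbrs u. fat K a b \<longrightarrow> b \<in> f a \<or> a \<in> f b))"

lemma succs: "finite (succs u a)" "card (succs u a) \<le> k"
    "adj u a \<Longrightarrow> adj u b \<Longrightarrow> fat K a b \<Longrightarrow> b \<in> succs u a \<or> a \<in> succs u b"
  using someI_ex[OF fat_orientation_exists[of u]] unfolding succs_def[of u, symmetric]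
  by (auto simp: nbrs_def)

text \<open>The budgets \<open>2 * k\<close> cover all vertices and colours of a partial cycle. Only
  the inner vertices have to avoid \<open>W\<close>, which may contain \<open>x\<close> and
  \<open>y\<close>.\<close>

definition flex :: "'a \<Rightarrow> 'a \<Rightarrow> bool" where
  "flex x y \<longleftrightarrow> (\<forall>W \<Gamma>. finite W \<and> finite \<Gamma> \<and> card W \<le> 2 * k \<and> card \<Gamma> \<le> 2 * k \<longrightarrow>
     (\<exists>u v. rpath [x, u, v, y] \<and> u \<notin> W \<and> v \<notin> W \<and> set (cols [x, u, v, y]) \<inter> \<Gamma> = {}))"

lemma flexD:
  assumes "flex x y" "finite W" "finite \<Gamma>" "card W \<le> 2 * k" "card \<Gamma> \<le> 2 * k"
  shows "\<exists>u v. rpath [x, u, v, y] \<and> u \<notin> W \<and> v \<notin> W \<and> set (cols [x, u, v, y]) \<inter> \<Gamma> = {}"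
  using assms unfolding flex_def by blast

text \<open>A flexible pair takes the place of the edge to \<open>y\<close>. Joining both ends of an
  alternating path on \<open>2 * (k - 3) + 1\<close> vertices to \<open>y\<close> adds
  \<open>y\<close> and four inner vertices, which makes \<open>2 * k\<close>. The two connecting
  paths are chosen last and avoid the colours already used, so no closing colours are reserved and
  \<open>F\<close> is empty. For \<open>k = 3\<close> the alternating path is a single vertex that
  serves as both ends.\<close>

lemma flex_edges_le:
  assumes "k \<ge> 3" "\<And>z. z \<in> Z \<Longrightarrow> flex z y" "finite Z" "finite U"
  shows "card {(z, u). z \<in> Z \<and> u \<in> U \<and> adj z u} \<le> D * (card Z + card U)"
proof (rule ccontr)
  let ?Ed = "{(z, u). z \<in> Z \<and> u \<in> U \<and> adj z u}"
  assume "\<not> ?thesis"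
  then have large: "card ?Ed > D * (card Z + card U)" by (simp only: not_le)
  have "?Ed \<subseteq> Z \<times> U" by auto
  from dense_relation_core[OF assms(3,4) this large] obtain Ed where Ed: "Ed \<subseteq> ?Ed" "Ed \<noteq> {}" "\<forall>z\<in>Domain Ed. card (Ed `` {z}) > D"
      "\<forall>u\<in>Range Ed. card (Ed\<inverse> `` {u}) > D"
    by blast
  have DZ: "Domain Ed \<subseteq> Z" using Ed(1) by auto
  have flexy: "z \<noteq> y" if "flex z y" for z
    using that[unfolded flex_def, rule_format, of "{}" "{}"] by (auto simp: rpath_def)
  have finEd: "finite Ed" using Ed(1) assms(3,4) finite_subset[of Ed "Z \<times> U"] by auto
  have "\<exists>p. rpath p \<and> length p = 2 * (k - 3) + 1 \<and> hd p \<in> Domain Ed \<and> last p \<in> Domain Ed \<and>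
     set p \<inter> {y} = {} \<and> set (cols p) \<inter> ({} \<union> {}) = {}"
  proof (rule alternating_rpath[where F = "\<lambda>z. {}" and D = D])
    show "Domain Ed \<inter> {y} = {}" using DZ flexy assms(2) by auto
    show "card {y} + 6 * (k - 3) \<le> D" by (simp add: D_def)
  qed (use Ed finEd in auto)
  then obtain p where p: "rpath p" "length p = 2 * (k - 3) + 1" "hd p \<in> Domain Ed" "last p \<in> Domain Ed"
     "set p \<inter> {y} = {}"
    by blast
  have ne: "p \<noteq> []" using p(2) by auto
  have "card (set p) \<le> 2 * k" "card (set (cols p)) \<le> 2 * k"
    using card_length[of p] card_length[of "cols p"] p(2) assms(1) unfolding length_cols by linarith+
  then obtain u v where uv: "rpath [last p, u, v, y]" "u \<notin> set p" "v \<notin> set p"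
      "set (cols [last p, u, v, y]) \<inter> set (cols p) = {}"
    using flexD[of "last p" y "set p" "set (cols p)"] assms(2)[of "last p"] p(4) DZ by blast
  define q where "q = p @ [u, v, y]"
  have cq: "cols q = cols p @ cols [last p, u, v, y]"
    unfolding q_def by (subst cols_append[OF ne]) simp
  have rq: "rpath q"
    unfolding q_def using uv p(1,5) ne by (subst rpath_append) (auto simp: rpath_def)
  have lq: "length q = 2 * k - 2" using p(2) assms(1) by (simp add: q_def)
  have "card (set q) \<le> 2 * k" "card (set (cols q)) \<le> 2 * k"
    using card_length[of q] card_length[of "cols q"] lq unfolding length_cols by linarith+
  then obtain a b where ab: "rpath [hd p, a, b, y]" "a \<notin> set q" "b \<notin> set q"
      "set (cols [hd p, a, b, y]) \<inter> set (cols q) = {}"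
    using flexD[of "hd p" y "set q" "set (cols q)"] assms(2)[of "hd p"] p(3) DZ by blast
  have neq: "q \<noteq> []" "last q = y" "hd q = hd p" using ne by (auto simp: q_def)
  have "adj a (hd p)" "adj b a" "adj y b" using ab(1) adj_sym by (auto simp: rpath_def)
  then have "rcycle (q @ [b, a])"
    unfolding rcycle_def using rq ab neq col_sym[of b y] col_sym[of a b] col_sym[of a "hd p"]
    by (auto simp: cols_append rpath_def successively_append_iff)
  moreover have "length (q @ [b, a]) = 2 * k" using lq assms(1) by simp
  ultimately show False using no_rcycle by blast
qed

end

section \<open>Walks with three edges\<close>

lemma card_le_fibres:
  assumes "finite A" "f ` B \<subseteq> A" "\<And>a. a \<in> A \<Longrightarrow> finite {b\<in>B. f b = a} \<and> card {b\<in>B. f b = a} \<le> d"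
  shows "finite B" "card B \<le> d * card A"
proof -
  have B: "B = (\<Union>a\<in>A. {b\<in>B. f b = a})" using assms(2) by auto
  show "finite B" by (subst B) (use assms in auto)
  have "card B \<le> (\<Sum>a\<in>A. card {b\<in>B. f b = a})"
    by (subst B) (rule card_UN_le[OF assms(1)])
  also have "\<dots> \<le> (\<Sum>a\<in>A. d)" using assms(3) by (intro sum_mono) auto
  finally show "card B \<le> d * card A" by (simp add: mult.commute)
qed

text \<open>The counting device of the whole proof: \<open>f\<close> forgets some coordinates, and
  \<open>S a\<close> lists the candidates for the forgotten ones when the remaining ones are
  \<open>a\<close>.\<close>

lemma card_le_fibres_image:
  assumes "finite A" "f ` B \<subseteq> A"
    and "\<And>a. a \<in> A \<Longrightarrow> {b\<in>B. f b = a} \<subseteq> g a ` S a"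
    and "\<And>a. a \<in> A \<Longrightarrow> finite (S a) \<and> card (S a) \<le> d"
  shows "finite B" "card B \<le> d * card A"
proof -
  have "finite {b\<in>B. f b = a} \<and> card {b\<in>B. f b = a} \<le> d" if "a \<in> A" for a
  proof
    have fin: "finite (g a ` S a)" using assms(4)[OF that] by simp
    show "finite {b\<in>B. f b = a}" using finite_subset[OF assms(3)[OF that] fin] .
    have "card {b\<in>B. f b = a} \<le> card (g a ` S a)" using card_mono[OF fin assms(3)[OF that]] .
    also have "\<dots> \<le> card (S a)" using assms(4)[OF that] card_image_le by blast
    finally show "card {b\<in>B. f b = a} \<le> d" using assms(4)[OF that] by linarith
  qed
  then show "finite B" "card B \<le> d * card A" using card_le_fibres[OF assms(1,2)] by blast+
qed

context rainbow_cycle_free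
begin

abbreviation n where "n \<equiv> card V"
abbreviation two_walk_bound where "two_walk_bound \<equiv> 2 * D * card V"

lemma mem_nbrs: "b \<in> nbrs a \<longleftrightarrow> adj a b"
  by (simp add: nbrs_def)

lemma card_common_nbrs_thin:
  assumes "\<not> fat K x y" "x \<noteq> y"
  shows "card (nbrs x \<inter> nbrs y) \<le> K"
  using assms by (auto simp: fat_def)

section \<open>Walks of two edges, and the classes of 3-walks that are bounded directly\<close>

definition walks2 where "walks2 = {(u, v, y). adj u v \<and> adj v y}"
definition walks3 where "walks3 = {(x, u, v, y). adj x u \<and> adj u v \<and> adj v y}"

text \<open>This is \<open>neighbourhood_edges_le\<close> with all of \<open>V\<close> opposite to
  \<open>nbrs y\<close>. The factor \<open>n\<close> that two new vertices of a cycle cost comes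
  from here.\<close>

lemma walks2_from:
  "finite {(v, u). adj y v \<and> adj v u}" "card {(v, u). adj y v \<and> adj v u} \<le> two_walk_bound"
proof -
  have eq: "{(v, u). adj y v \<and> adj v u} = {(v, u). v \<in> nbrs y \<and> u \<in> V \<and> adj v u}"
    using adj_in_V2 by (auto simp: nbrs_def)
  have "card {(v, u). adj y v \<and> adj v u} \<le> D * (card (nbrs y) + n)"
    unfolding eq by (rule neighbourhood_edges_le[OF subset_refl finite_V])
  also have "\<dots> \<le> D * (n + n)" using card_nbrs_le by (intro mult_le_mono) auto
  finally show "card {(v, u). adj y v \<and> adj v u} \<le> two_walk_bound" by (simp add: algebra_simps mult_2)
  show "finite {(v, u). adj y v \<and> adj v u}"
    by (rule finite_subset[of _ "V \<times> V"]) (use adj_in_V adj_in_V2 finite_V in auto)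
qed

lemma finite_walks2: "finite walks2"
  by (rule finite_subset[of _ "V \<times> V \<times> V"]) (use adj_in_V adj_in_V2 finite_V in \<open>auto simp: walks2_def\<close>)

lemma card_walks2: "card walks2 \<le> n * two_walk_bound"
proof -
  have "card walks2 \<le> two_walk_bound * card V"
  proof (rule card_le_fibres_image(2)[of V "\<lambda>(u, v, y). y" walks2 "\<lambda>y (v, u). (u, v, y)" "\<lambda>y. {(v, u). adj y v \<and> adj v u}"])
    show "(\<lambda>(u, v, y). y) ` walks2 \<subseteq> V" using adj_in_V2 by (auto simp: walks2_def)
    show "{w \<in> walks2. (\<lambda>(u, v, y). y) w = a} \<subseteq> (\<lambda>(v, u). (u, v, a)) ` {(v, u). adj a v \<and> adj v u}" for a
    proof
      fix w assume "w \<in> {w \<in> walks2. (\<lambda>(u, v, y). y) w = a}"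
      then obtain u v where "w = (u, v, a)" "adj u v" "adj v a" by (auto simp: walks2_def)
      then show "w \<in> (\<lambda>(v, u). (u, v, a)) ` {(v, u). adj a v \<and> adj v u}"
        using adj_sym by (intro image_eqI[of _ _ "(v, u)"]) auto
    qed
  qed (use finite_V walks2_from in blast)+
  then show ?thesis by (simp add: mult.commute)
qed

lemma finite_walks3: "finite walks3"
  by (rule finite_subset[of _ "V \<times> V \<times> V \<times> V"]) (use adj_in_V adj_in_V2 finite_V in \<open>auto simp: walks3_def\<close>)

lemma card_walks3_swap:
  "card {(x, u, v, y). (x, u, v, y) \<in> walks3 \<and> P y v u x} = card {(x, u, v, y). (x, u, v, y) \<in> walks3 \<and> P x u v y}"
  by (rule bij_betw_same_card[of "\<lambda>(x, u, v, y). (y, v, u, x)"],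
      rule bij_betw_byWitness[where f' = "\<lambda>(x, u, v, y). (y, v, u, x)"])
    (auto simp: walks3_def adj_sym)

text \<open>Given \<open>(u, v, y)\<close>, boundedly many \<open>x\<close> remain: one for each
  equation, by properness one for the repeated colour, and \<open>k\<close> for the orientation on
  \<open>nbrs u\<close>.\<close>

lemma card_walks3_determined:
  "card {(x, u, v, y). (x, u, v, y) \<in> walks3 \<and> (x = v \<or> x = y \<or> col x u = col v y \<or> x \<in> succs u v)} \<le> (k + 3) * (n * two_walk_bound)"
proof -
  let ?B = "{(x, u, v, y). (x, u, v, y) \<in> walks3 \<and> (x = v \<or> x = y \<or> col x u = col v y \<or> x \<in> succs u v)}"
  let ?S = "\<lambda>(u, v, y). {v, y} \<union> {x. adj u x \<and> col u x \<in> {col v y}} \<union> succs u v"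
  have "card ?B \<le> (k + 3) * card walks2"
  proof (rule card_le_fibres_image(2)[of walks2 "\<lambda>(x, u, v, y). (u, v, y)" ?B "\<lambda>(u, v, y) x. (x, u, v, y)" ?S])
    show "finite walks2" by (rule finite_walks2)
    show "(\<lambda>(x, u, v, y). (u, v, y)) ` ?B \<subseteq> walks2" by (auto simp: walks3_def walks2_def)
  next
    fix a :: "'a \<times> 'a \<times> 'a"
    obtain u v y where a: "a = (u, v, y)" by (cases a)
    show "{b \<in> ?B. (\<lambda>(x, u, v, y). (u, v, y)) b = a} \<subseteq> (\<lambda>(u, v, y) x. (x, u, v, y)) a ` ?S a"
      unfolding a by (auto simp: walks3_def adj_sym col_sym[of u])
    have "card {x. adj u x \<and> col u x \<in> {col v y}} \<le> 1"
      using card_col_in_le(2)[of "{col v y}" u] by simp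
    moreover have "card {v, y} \<le> 2" by (simp add: card_insert_if)
    ultimately have "card (?S a) \<le> k + 3"
      unfolding a using card_Un3_le[of "{v, y}" "{x. adj u x \<and> col u x \<in> {col v y}}" "succs u v"] succs(2)[of u v]
      by simp
    moreover have "finite (?S a)" unfolding a using card_col_in_le(1)[of "{col v y}" u] succs(1)[of u v] by simp
    ultimately show "finite (?S a) \<and> card (?S a) \<le> k + 3" by blast
  qed
  also have "\<dots> \<le> (k + 3) * (n * two_walk_bound)" using card_walks2 by (rule mult_le_mono2)
  finally show ?thesis .
qed

text \<open>At most \<open>4 * k\<close> of these \<open>v\<close> are spoiled by \<open>W\<close>
  or by the colour of the edge to \<open>y\<close>. For any other \<open>v\<close> the fat pair
  \<open>x\<close>, \<open>v\<close> still offers a suitable \<open>u\<close>.\<close>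

lemma many_fat_flex:
  assumes "x \<noteq> y" "card {v \<in> nbrs y. fat K x v} > 4 * k + 3"
  shows "flex x y"
  unfolding flex_def
proof (intro allI impI, elim conjE)
  fix W :: "'a set" and \<Gamma> :: "'c set"
  assume W: "finite W" "finite \<Gamma>" "card W \<le> 2 * k" "card \<Gamma> \<le> 2 * k"
  let ?B = "W \<union> {v. adj y v \<and> col y v \<in> \<Gamma>}"
  have "card ?B \<le> 4 * k"
    using card_Un_le[of W "{v. adj y v \<and> col y v \<in> \<Gamma>}"] card_col_in_le(2)[OF W(2), of y] W by linarith
  then have "card ?B < card {v \<in> nbrs y. fat K x v}" using assms(2) by linarith
  moreover have "finite ?B" using W card_col_in_le(1)[OF W(2)] by auto
  ultimately obtain v where v: "v \<in> {v \<in> nbrs y. fat K x v}" "v \<notin> ?B" using exists_outside[of ?B] by blast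
  have "card (insert y W) + 2 * card (insert (col v y) \<Gamma>) < K"
    using W by (simp add: card_insert_if K_def)
  then obtain u where u: "adj x u" "adj u v" "u \<notin> insert y W" "col x u \<notin> insert (col v y) \<Gamma>" "col u v \<notin> insert (col v y) \<Gamma>"
    using fat_middle[of K x v "insert y W" "insert (col v y) \<Gamma>"] v(1) W by auto
  have xv: "x \<noteq> v" "adj v y" "col y v = col v y" using v adj_sym col_sym by (auto simp: fat_def nbrs_def)
  have "col x u \<noteq> col u v" using col_proper[of u x v] u xv adj_sym[of x u] col_sym[of x u] by auto
  moreover have "x \<noteq> u" "u \<noteq> v" "v \<noteq> y" using u(1,2) xv adj_irrefl by auto
  ultimately have "rpath [x, u, v, y] \<and> u \<notin> W \<and> v \<notin> W \<and> set (cols [x, u, v, y]) \<inter> \<Gamma> = {}"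
    using u v xv assms(1) by (auto simp: rpath_def nbrs_def)
  then show "\<exists>u v. rpath [x, u, v, y] \<and> u \<notin> W \<and> v \<notin> W \<and> set (cols [x, u, v, y]) \<inter> \<Gamma> = {}" by blast
qed

lemma flex_pairs:
  assumes "k \<ge> 3"
  shows "finite {(z, u). flex z y \<and> adj z u}" "card {(z, u). flex z y \<and> adj z u} \<le> two_walk_bound"
proof -
  let ?Z = "{z \<in> V. flex z y}"
  have eq: "{(z, u). flex z y \<and> adj z u} = {(z, u). z \<in> ?Z \<and> u \<in> V \<and> adj z u}"
    using adj_in_V2 adj_in_V by auto
  show "finite {(z, u). flex z y \<and> adj z u}"
    by (rule finite_subset[of _ "V \<times> V"]) (use adj_in_V adj_in_V2 finite_V in auto)
  have "card {(z, u). flex z y \<and> adj z u} \<le> D * (card ?Z + n)"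
    unfolding eq by (rule flex_edges_le) (use assms finite_V in auto)
  also have "\<dots> \<le> D * (n + n)" using card_mono[of V ?Z] finite_V by (intro mult_le_mono) auto
  finally show "card {(z, u). flex z y \<and> adj z u} \<le> two_walk_bound" by (simp add: algebra_simps mult_2)
qed

text \<open>The vertex \<open>y\<close> costs \<open>n\<close>, the pair \<open>(x, u)\<close> costs
  \<open>two_walk_bound\<close> by flexibility, and the orientation on \<open>nbrs u\<close> leaves
  \<open>k\<close> candidates for \<open>v\<close>.\<close>

lemma card_walks3_flex_fat:
  assumes "k \<ge> 3"
  shows "card {(x, u, v, y). (x, u, v, y) \<in> walks3 \<and> flex x y \<and> v \<in> succs u x} \<le> n * (k * two_walk_bound)"
proof -
  let ?B = "{(x, u, v, y). (x, u, v, y) \<in> walks3 \<and> flex x y \<and> v \<in> succs u x}"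
  let ?A = "SIGMA y:V. {(z, u). flex z y \<and> adj z u}"
  have finA: "finite ?A" using finite_V flex_pairs(1)[OF assms] by auto
  have "card ?B \<le> k * card ?A"
  proof (rule card_le_fibres_image(2)[of ?A "\<lambda>(x, u, v, y). (y, x, u)" ?B "\<lambda>(y, x, u) v. (x, u, v, y)" "\<lambda>(y, x, u). succs u x"])
    show "(\<lambda>(x, u, v, y). (y, x, u)) ` ?B \<subseteq> ?A" using adj_in_V2 by (auto simp: walks3_def)
  qed (use finA succs in auto)
  also have "card ?A = (\<Sum>y\<in>V. card {(z, u). flex z y \<and> adj z u})"
    using finite_V flex_pairs(1)[OF assms] by (intro card_SigmaI) auto
  also have "k * \<dots> \<le> k * (\<Sum>y\<in>V. two_walk_bound)"
    using flex_pairs(2)[OF assms] by (intro mult_le_mono2 sum_mono)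
  finally show ?thesis by (simp add: mult_ac)
qed

text \<open>Again \<open>y\<close> and \<open>(x, u)\<close> are chosen first; now \<open>v\<close>
  is one of at most \<open>K\<close> common neighbours of the thin pair \<open>u\<close>,
  \<open>y\<close>.\<close>

lemma card_walks3_flex_thin:
  assumes "k \<ge> 3"
  shows "card {(x, u, v, y). (x, u, v, y) \<in> walks3 \<and> flex x y \<and> u \<noteq> y \<and> \<not> fat K u y} \<le> n * (K * two_walk_bound)"
proof -
  let ?B = "{(x, u, v, y). (x, u, v, y) \<in> walks3 \<and> flex x y \<and> u \<noteq> y \<and> \<not> fat K u y}"
  let ?A = "SIGMA y:V. {(z, u). flex z y \<and> adj z u \<and> u \<noteq> y \<and> \<not> fat K u y}"
  have sub: "{(z, u). flex z y \<and> adj z u \<and> u \<noteq> y \<and> \<not> fat K u y} \<subseteq> {(z, u). flex z y \<and> adj z u}" for y by auto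
  have finA: "finite ?A" using finite_V finite_subset[OF sub flex_pairs(1)[OF assms]] by auto
  have "card ?B \<le> K * card ?A"
  proof (rule card_le_fibres_image(2)[of ?A "\<lambda>(x, u, v, y). (y, x, u)" ?B "\<lambda>(y, x, u) v. (x, u, v, y)" "\<lambda>(y, x, u). nbrs u \<inter> nbrs y"])
    show "(\<lambda>(x, u, v, y). (y, x, u)) ` ?B \<subseteq> ?A" using adj_in_V2 by (auto simp: walks3_def)
  qed (use finA card_common_nbrs_thin finite_nbrs in \<open>auto simp: walks3_def adj_sym nbrs_def[symmetric] mem_nbrs\<close>)
  also have "card ?A = (\<Sum>y\<in>V. card {(z, u). flex z y \<and> adj z u \<and> u \<noteq> y \<and> \<not> fat K u y})"
    using finite_V finite_subset[OF sub flex_pairs(1)[OF assms]] by (intro card_SigmaI) auto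
  also have "K * \<dots> \<le> K * (\<Sum>y\<in>V. two_walk_bound)"
    using order_trans[OF card_mono[OF flex_pairs(1)[OF assms] sub] flex_pairs(2)[OF assms]]
    by (intro mult_le_mono2 sum_mono)
  finally show ?thesis by (simp add: mult_ac)
qed

text \<open>For fixed \<open>y\<close> and \<open>v\<close>, the edges between \<open>nbrs v\<close>
  and the candidates for \<open>x\<close> are sparse by \<open>neighbourhood_edges_le\<close>.
  Summed over \<open>v\<close>, the candidates number only O(n): by \<open>many_fat_flex\<close> a
  vertex that is not flexible with \<open>y\<close> is fat with at most \<open>4 * k + 3\<close>
  neighbours of \<open>y\<close>.\<close>

lemma card_walks3_nonflex_fat:
  "card {(x, u, v, y). (x, u, v, y) \<in> walks3 \<and> \<not> flex x y \<and> x \<noteq> y \<and> fat K x v} \<le> n * (D * (two_walk_bound + n * (4 * k + 3)))"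
proof -
  define Xs where "Xs y v = {x \<in> V. \<not> flex x y \<and> x \<noteq> y \<and> fat K x v}" for y v
  let ?B = "{(x, u, v, y). (x, u, v, y) \<in> walks3 \<and> \<not> flex x y \<and> x \<noteq> y \<and> fat K x v}"
  define G where "G y v = {(u, x). u \<in> nbrs v \<and> x \<in> Xs y v \<and> adj u x}" for y v
  have finX: "finite (Xs y v)" for y v using finite_V by (simp add: Xs_def)
  have finG: "finite (G y v)" for y v
    by (rule finite_subset[of _ "nbrs v \<times> Xs y v"]) (auto simp: G_def finX)
  have cG: "card (G y v) \<le> D * (card (nbrs v) + card (Xs y v))" for y v
    unfolding G_def by (rule neighbourhood_edges_le[OF subset_refl finX])
  have per: "(\<Sum>v\<in>nbrs y. card (G y v)) \<le> D * (two_walk_bound + n * (4 * k + 3))" for y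
  proof -
    have "(\<Sum>v\<in>nbrs y. card (nbrs v)) = card (SIGMA v:nbrs y. nbrs v)" by (simp add: card_SigmaI)
    also have "(SIGMA v:nbrs y. nbrs v) = {(v, u). adj y v \<and> adj v u}" by (auto simp: nbrs_def)
    finally have 1: "(\<Sum>v\<in>nbrs y. card (nbrs v)) \<le> two_walk_bound" using walks2_from(2) by simp
    have "(\<Sum>v\<in>nbrs y. card (Xs y v)) = card (SIGMA v:nbrs y. Xs y v)" by (simp add: card_SigmaI finX)
    also have "\<dots> \<le> (4 * k + 3) * card V"
    proof (rule card_le_fibres_image(2)[of V snd _ "\<lambda>x v. (v, x)" "\<lambda>x. if flex x y \<or> x = y then {} else {v \<in> nbrs y. fat K x v}"])
      show "snd ` Sigma (nbrs y) (Xs y) \<subseteq> V" by (auto simp: Xs_def)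
    qed (use finite_V many_fat_flex[of _ y] in \<open>auto simp: Xs_def not_less[symmetric]\<close>)
    finally have 2: "(\<Sum>v\<in>nbrs y. card (Xs y v)) \<le> n * (4 * k + 3)" by (simp add: mult.commute)
    have "(\<Sum>v\<in>nbrs y. card (G y v)) \<le> (\<Sum>v\<in>nbrs y. D * (card (nbrs v) + card (Xs y v)))"
      using cG by (intro sum_mono)
    also have "\<dots> = D * ((\<Sum>v\<in>nbrs y. card (nbrs v)) + (\<Sum>v\<in>nbrs y. card (Xs y v)))"
      by (simp add: sum_distrib_left sum.distrib distrib_left)
    also have "\<dots> \<le> D * (two_walk_bound + n * (4 * k + 3))" using 1 2 by (intro mult_le_mono2 add_mono)
    finally show ?thesis .
  qed
  have "?B \<subseteq> (\<lambda>(y, v, u, x). (x, u, v, y)) ` (SIGMA y:V. SIGMA v:nbrs y. G y v)"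
    using adj_sym adj_in_V adj_in_V2 by (force simp: walks3_def G_def Xs_def nbrs_def image_iff)
  then have "card ?B \<le> card (SIGMA y:V. SIGMA v:nbrs y. G y v)"
    using finite_V finG by (meson card_image_le card_mono finite_SigmaI finite_imageI finite_nbrs order_trans)
  also have "\<dots> = (\<Sum>y\<in>V. \<Sum>v\<in>nbrs y. card (G y v))" using finite_V finG by (simp add: card_SigmaI)
  also have "\<dots> \<le> (\<Sum>y\<in>V. D * (two_walk_bound + n * (4 * k + 3)))" using per by (intro sum_mono)
  finally show ?thesis by simp
qed

end

text \<open>Either \<open>a * t\<close> is bounded by a constant, or \<open>t * t\<close> is at
  least \<open>(a + c) * t\<close>. A square thus pays for any prescribed multiple of
  \<open>t\<close>.\<close>

lemma square_gain:
  fixes t \<theta> a c :: nat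
  assumes "t * t \<le> \<theta> + c * t"
  shows "a * t \<le> \<theta> + a * (a + c)"
proof (cases "t \<le> a + c")
  case True
  then show ?thesis by (simp add: mult_le_mono2 trans_le_add2)
next
  case False
  then have "(a + c) * t \<le> t * t" by (intro mult_le_mono1) auto
  then have "a * t + c * t \<le> \<theta> + c * t" using assms by (simp add: distrib_right)
  then show ?thesis by simp
qed

context rainbow_cycle_free
begin

section \<open>3-walks with thin pairs, between vertices that are not flexible\<close>

definition thin_walks3 where
  "thin_walks3 = {(x, u, v, y). (x, u, v, y) \<in> walks3 \<and> x \<noteq> v \<and> u \<noteq> y \<and> x \<noteq> y \<and>
     col x u \<noteq> col v y \<and> \<not> fat K x v \<and> \<not> fat K u y \<and> \<not> flex x y}"

definition mids where "mids x y = {(u, v). (x, u, v, y) \<in> thin_walks3}"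

text \<open>
  These are counted by 3-walks \<open>v u x u'\<close>: the common colour determines \<open>v'\<close> from \<open>u'\<close>, and then
  \<open>y\<close> is a common neighbour of the thin pair \<open>v, v'\<close>.
\<close>
definition mono_pairs where
  "mono_pairs x y = {((u, v), (u', v')). (u, v) \<in> mids x y \<and> (u', v') \<in> mids x y \<and>
     col u v = col u' v' \<and> v \<noteq> v' \<and> \<not> fat K v v'}"

lemma finite_mids: "finite (mids x y)"
  by (rule finite_subset[of _ "V \<times> V"])
    (use adj_in_V adj_in_V2 finite_V in \<open>auto simp: mids_def thin_walks3_def walks3_def\<close>)

lemma mids_adj:
  "(u, v) \<in> mids x y \<Longrightarrow> adj x u \<and> adj u v \<and> adj v y \<and> x \<noteq> v \<and> u \<noteq> y \<and> \<not> fat K x v \<and> \<not> fat K u y"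
  by (simp add: mids_def thin_walks3_def walks3_def)

lemma finite_mono_pairs: "finite (mono_pairs x y)"
  by (rule finite_subset[of _ "mids x y \<times> mids x y"]) (auto simp: mono_pairs_def finite_mids)

lemma card_mids_fst_in:
  assumes "finite A"
  shows "card {(u, v) \<in> mids x y. u \<in> A} \<le> K * card A"
proof (rule card_le_fibres_image(2)[of A fst _ "\<lambda>u v. (u, v)" "\<lambda>u. if u \<noteq> y \<and> \<not> fat K u y then nbrs u \<inter> nbrs y else {}"])
  show "finite (if a \<noteq> y \<and> \<not> fat K a y then nbrs a \<inter> nbrs y else {}) \<and>
        card (if a \<noteq> y \<and> \<not> fat K a y then nbrs a \<inter> nbrs y else {}) \<le> K" for a
    using card_common_nbrs_thin[of a y] by auto
  show "{b \<in> {(u, v). (u, v) \<in> mids x y \<and> u \<in> A}. fst b = a} \<subseteq> Pair a ` (if a \<noteq> y \<and> \<not> fat K a y then nbrs a \<inter> nbrs y else {})" for a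
    using mids_adj[of a _ x y] adj_sym by (fastforce simp: mem_nbrs)
qed (use assms in auto)

lemma card_mids_snd_in:
  assumes "finite A"
  shows "card {(u, v) \<in> mids x y. v \<in> A} \<le> K * card A"
proof (rule card_le_fibres_image(2)[of A snd _ "\<lambda>v u. (u, v)" "\<lambda>v. if x \<noteq> v \<and> \<not> fat K x v then nbrs x \<inter> nbrs v else {}"])
  show "finite (if x \<noteq> a \<and> \<not> fat K x a then nbrs x \<inter> nbrs a else {}) \<and>
        card (if x \<noteq> a \<and> \<not> fat K x a then nbrs x \<inter> nbrs a else {}) \<le> K" for a
    using card_common_nbrs_thin[of x a] by auto
  show "{b \<in> {(u, v). (u, v) \<in> mids x y \<and> v \<in> A}. snd b = a} \<subseteq> (\<lambda>u. (u, a)) ` (if x \<noteq> a \<and> \<not> fat K x a then nbrs x \<inter> nbrs a else {})" for a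
    using mids_adj[of _ a x y] adj_sym by (fastforce simp: mem_nbrs)
qed (use assms in auto)

definition mids_col where "mids_col x y \<gamma> = {(u, v) \<in> mids x y. col u v = \<gamma>}"

definition mono_pairs_col where
  "mono_pairs_col x y \<gamma> = {((u, v), (u', v')). (u, v) \<in> mids_col x y \<gamma> \<and> (u', v') \<in> mids_col x y \<gamma> \<and>
     v \<noteq> v' \<and> \<not> fat K v v'}"

lemma finite_mids_col: "finite (mids_col x y \<gamma>)"
  by (rule finite_subset[of _ "mids x y"]) (auto simp: mids_col_def finite_mids)

text \<open>By properness the edges of one colour form a matching. This justifies the terms
  \<open>THE u\<close> below, which recover \<open>u\<close> from \<open>v\<close>.\<close>

lemma mids_col_inj:
  assumes "(u, v) \<in> mids_col x y \<gamma>" "(u', v) \<in> mids_col x y \<gamma>"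
  shows "u = u'"
proof -
  have "adj u v" "adj u' v" "col u v = col u' v" using assms mids_adj by (auto simp: mids_col_def)
  then show ?thesis using col_proper[of v u u'] adj_sym col_sym by metis
qed

text \<open>Of all pairs only those with \<open>v = v'\<close> or with \<open>v\<close>,
  \<open>v'\<close> fat are lost. Both vertices are neighbours of \<open>y\<close>, so the
  orientation on \<open>nbrs y\<close> allows at most \<open>k\<close> partners in either direction;
  together with the diagonal this makes \<open>2 * k + 1\<close>.\<close>

lemma card_mono_pairs_col:
  "card (mids_col x y \<gamma>) * card (mids_col x y \<gamma>) \<le> card (mono_pairs_col x y \<gamma>) + (2 * k + 1) * card (mids_col x y \<gamma>)"
proof -
  let ?F = "mids_col x y \<gamma>"
  let ?S = "{(p, q). p \<in> ?F \<and> q \<in> ?F \<and> snd q \<in> insert (snd p) (succs y (snd p))}"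
  let ?T = "{(p, q). p \<in> ?F \<and> q \<in> ?F \<and> snd p \<in> succs y (snd q)}"
  have fins: "finite (?F \<times> ?F)" using finite_mids_col by simp
  have sub: "?F \<times> ?F \<subseteq> mono_pairs_col x y \<gamma> \<union> ?S \<union> ?T"
  proof
    fix z assume "z \<in> ?F \<times> ?F"
    then obtain u v u' v' where z: "z = ((u, v), (u', v'))" "(u, v) \<in> ?F" "(u', v') \<in> ?F" by auto
    then have "adj y v" "adj y v'" using mids_adj adj_sym by (auto simp: mids_col_def)
    then show "z \<in> mono_pairs_col x y \<gamma> \<union> ?S \<union> ?T"
      using z succs(3)[of y v v'] by (auto simp: mono_pairs_col_def)
  qed
  have S: "card ?S \<le> (k + 1) * card ?F"
  proof (rule card_le_fibres_image(2)[of ?F fst _ "\<lambda>p w. (p, (THE u. (u, w) \<in> ?F), w)" "\<lambda>p. insert (snd p) (succs y (snd p))"])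
    show "{b \<in> ?S. fst b = p} \<subseteq> (\<lambda>w. (p, (THE u. (u, w) \<in> ?F), w)) ` insert (snd p) (succs y (snd p))" for p
    proof
      fix b assume b: "b \<in> {b \<in> ?S. fst b = p}"
      then obtain u v where uv: "b = (p, (u, v))" "(u, v) \<in> ?F" "v \<in> insert (snd p) (succs y (snd p))" by auto
      have "(THE u. (u, v) \<in> ?F) = u" using uv(2) mids_col_inj by blast
      then show "b \<in> (\<lambda>w. (p, (THE u. (u, w) \<in> ?F), w)) ` insert (snd p) (succs y (snd p))"
        using uv by auto
    qed
    show "finite (insert (snd a) (succs y (snd a))) \<and> card (insert (snd a) (succs y (snd a))) \<le> k + 1" for a
      using succs(1,2)[of y "snd a"] by (simp add: card_insert_if)
  qed (use finite_mids_col in auto)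
  have T: "card ?T \<le> k * card ?F"
  proof (rule card_le_fibres_image(2)[of ?F snd _ "\<lambda>p w. (((THE u. (u, w) \<in> ?F), w), p)" "\<lambda>p. succs y (snd p)"])
    show "{b \<in> ?T. snd b = p} \<subseteq> (\<lambda>w. (((THE u. (u, w) \<in> ?F), w), p)) ` succs y (snd p)" for p
    proof
      fix b assume b: "b \<in> {b \<in> ?T. snd b = p}"
      then obtain u v where uv: "b = ((u, v), p)" "(u, v) \<in> ?F" "v \<in> succs y (snd p)" by auto
      have "(THE u. (u, v) \<in> ?F) = u" using uv(2) mids_col_inj by blast
      then show "b \<in> (\<lambda>w. (((THE u. (u, w) \<in> ?F), w), p)) ` succs y (snd p)"
        using uv by auto
    qed
  qed (use finite_mids_col succs(1,2) in auto)
  have "mono_pairs_col x y \<gamma> \<subseteq> ?F \<times> ?F" "?S \<subseteq> ?F \<times> ?F" "?T \<subseteq> ?F \<times> ?F" by (auto simp: mono_pairs_col_def)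
  then have "finite (mono_pairs_col x y \<gamma> \<union> ?S \<union> ?T)" using fins finite_subset by (meson finite_UnI)
  then have "card (?F \<times> ?F) \<le> card (mono_pairs_col x y \<gamma> \<union> ?S \<union> ?T)" using sub by (rule card_mono)
  also have "\<dots> \<le> card (mono_pairs_col x y \<gamma>) + card ?S + card ?T" by (rule card_Un3_le)
  also have "\<dots> \<le> card (mono_pairs_col x y \<gamma>) + (k + 1) * card ?F + k * card ?F" using S T by linarith
  finally show ?thesis by (simp add: card_cartesian_product algebra_simps)
qed

text \<open>The first summand accounts for walks through a forbidden vertex or outer colour, the
  second for the error term of \<open>square_gain\<close> with \<open>a = 2 * K\<close> and
  \<open>c = 2 * k + 1\<close>, once for each of at most \<open>2 * k\<close> middle
  colours.\<close>

definition C1 :: nat where "C1 = 2 * K * (8 * k * K) + 2 * k * (2 * K * (2 * K + (2 * k + 1)))"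

text \<open>As \<open>x\<close>, \<open>y\<close> is not flexible, there are bounded
  \<open>W\<close> and \<open>\<Gamma>\<close> that every thin walk from \<open>x\<close> to
  \<open>y\<close> meets. Few walks meet them in a vertex or in an outer colour, because thin pairs
  have at most \<open>K\<close> common neighbours; the others have a middle colour in
  \<open>\<Gamma>\<close>, and there the quadratic count applies.\<close>

lemma card_mids_le: "2 * K * card (mids x y) \<le> card (mono_pairs x y) + C1"
proof (cases "mids x y = {}")
  case False
  then have "\<not> flex x y" "x \<noteq> y" by (auto simp: mids_def thin_walks3_def)
  then obtain W \<Gamma> where W: "finite W" "finite \<Gamma>" "card W \<le> 2 * k" "card \<Gamma> \<le> 2 * k"
    and hit: "\<And>u v. rpath [x, u, v, y] \<Longrightarrow> u \<in> W \<or> v \<in> W \<or> set (cols [x, u, v, y]) \<inter> \<Gamma> \<noteq> {}"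
    unfolding flex_def by blast
  define A1 where "A1 = W \<union> {u. adj x u \<and> col x u \<in> \<Gamma>}"
  define A2 where "A2 = W \<union> {v. adj y v \<and> col y v \<in> \<Gamma>}"
  have A1: "finite A1" "card A1 \<le> 4 * k"
    using W card_col_in_le[OF W(2), of x] card_Un_le[of W "{u. adj x u \<and> col x u \<in> \<Gamma>}"] by (auto simp: A1_def)
  have A2: "finite A2" "card A2 \<le> 4 * k"
    using W card_col_in_le[OF W(2), of y] card_Un_le[of W "{u. adj y u \<and> col y u \<in> \<Gamma>}"] by (auto simp: A2_def)
  let ?M1 = "{(u, v) \<in> mids x y. u \<in> A1}" let ?M2 = "{(u, v) \<in> mids x y. v \<in> A2}"
  have "mids x y \<subseteq> ?M1 \<union> ?M2 \<union> (\<Union>\<gamma>\<in>\<Gamma>. mids_col x y \<gamma>)"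
  proof
    fix p assume "p \<in> mids x y"
    then obtain u v where p: "p = (u, v)" "(u, v) \<in> mids x y" by (cases p) auto
    then have a: "adj x u" "adj u v" "adj v y" "x \<noteq> v" "u \<noteq> y" "col x u \<noteq> col v y" "x \<noteq> y"
      by (auto simp: mids_def thin_walks3_def walks3_def)
    have "col x u \<noteq> col u v" using col_proper[of u x v] a adj_sym[of x u] col_sym[of x u] by auto
    moreover have "col u v \<noteq> col v y" using col_proper[of v u y] a adj_sym[of u v] col_sym[of u v] by auto
    moreover have "x \<noteq> u" "u \<noteq> v" "v \<noteq> y" using a adj_irrefl by auto
    ultimately have "rpath [x, u, v, y]" using a by (auto simp: rpath_def)
    from hit[OF this] show "p \<in> ?M1 \<union> ?M2 \<union> (\<Union>\<gamma>\<in>\<Gamma>. mids_col x y \<gamma>)"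
      using p a adj_sym[OF a(3)] col_sym[of v y] by (auto simp: A1_def A2_def mids_col_def)
  qed
  moreover have "finite ?M1" "finite ?M2"
    by (auto intro: finite_subset[OF _ finite_mids[of x y]])
  ultimately have "card (mids x y) \<le> card (?M1 \<union> ?M2 \<union> (\<Union>\<gamma>\<in>\<Gamma>. mids_col x y \<gamma>))"
    using W(2) finite_mids_col by (intro card_mono) auto
  also have "\<dots> \<le> card ?M1 + card ?M2 + card (\<Union>\<gamma>\<in>\<Gamma>. mids_col x y \<gamma>)" by (rule card_Un3_le)
  also have "\<dots> \<le> K * (4 * k) + K * (4 * k) + (\<Sum>\<gamma>\<in>\<Gamma>. card (mids_col x y \<gamma>))"
    using order_trans[OF card_mids_fst_in[OF A1(1)] mult_le_mono2[OF A1(2)]]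
      order_trans[OF card_mids_snd_in[OF A2(1)] mult_le_mono2[OF A2(2)]] card_UN_le[OF W(2), of "mids_col x y"]
    by (intro add_mono)
  finally have "card (mids x y) \<le> 8 * k * K + (\<Sum>\<gamma>\<in>\<Gamma>. card (mids_col x y \<gamma>))" by (simp add: mult_ac)
  then have "2 * K * card (mids x y) \<le> 2 * K * (8 * k * K + (\<Sum>\<gamma>\<in>\<Gamma>. card (mids_col x y \<gamma>)))"
    by (rule mult_le_mono2)
  also have "\<dots> = 2 * K * (8 * k * K) + (\<Sum>\<gamma>\<in>\<Gamma>. 2 * K * card (mids_col x y \<gamma>))"
    by (simp add: distrib_left sum_distrib_left)
  also have "\<dots> \<le> 2 * K * (8 * k * K) + (\<Sum>\<gamma>\<in>\<Gamma>. card (mono_pairs_col x y \<gamma>) + 2 * K * (2 * K + (2 * k + 1)))"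
    using square_gain[OF card_mono_pairs_col] by (intro add_mono sum_mono order_refl)
  also have "\<dots> = 2 * K * (8 * k * K) + (\<Sum>\<gamma>\<in>\<Gamma>. card (mono_pairs_col x y \<gamma>)) + card \<Gamma> * (2 * K * (2 * K + (2 * k + 1)))"
    by (simp add: sum.distrib)
  also have "(\<Sum>\<gamma>\<in>\<Gamma>. card (mono_pairs_col x y \<gamma>)) = card (\<Union>\<gamma>\<in>\<Gamma>. mono_pairs_col x y \<gamma>)"
  proof (rule card_UN_disjoint[symmetric])
    show "\<forall>i\<in>\<Gamma>. finite (mono_pairs_col x y i)"
      using finite_subset[of "mono_pairs_col x y _" "mids_col x y _ \<times> mids_col x y _"] finite_mids_col
      by (auto simp: mono_pairs_col_def)
    show "\<forall>i\<in>\<Gamma>. \<forall>j\<in>\<Gamma>. i \<noteq> j \<longrightarrow> mono_pairs_col x y i \<inter> mono_pairs_col x y j = {}"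
      by (auto simp: mono_pairs_col_def mids_col_def)
  qed (rule W)
  also have "\<dots> \<le> card (mono_pairs x y)"
  proof (rule card_mono[OF finite_mono_pairs])
    show "(\<Union>\<gamma>\<in>\<Gamma>. mono_pairs_col x y \<gamma>) \<subseteq> mono_pairs x y"
      by (auto simp: mono_pairs_col_def mono_pairs_def mids_col_def)
  qed
  finally show ?thesis
    using mult_le_mono1[OF W(4), of "2 * K * (2 * K + (2 * k + 1))"] unfolding C1_def by linarith
qed simp

lemma card_mono_pairs_total:
  "(\<Sum>(x, y)\<in>V \<times> V. card (mono_pairs x y)) \<le> K * card walks3"
proof -
  let ?B = "SIGMA p:V \<times> V. mono_pairs (fst p) (snd p)"
  have "(\<Sum>(x, y)\<in>V \<times> V. card (mono_pairs x y)) = card ?B"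
    using finite_V finite_mono_pairs by (simp add: card_SigmaI case_prod_unfold)
  also have "\<dots> \<le> K * card walks3"
  proof (rule card_le_fibres_image(2)[of walks3 "\<lambda>((x, y), (u, v), (u', v')). (v, u, x, u')" ?B
      "\<lambda>(v, u, x, u') (v', y). ((x, y), (u, v), (u', v'))"
      "\<lambda>(v, u, x, u'). SIGMA v':{v'. adj u' v' \<and> col u' v' \<in> {col u v} \<and> v \<noteq> v' \<and> \<not> fat K v v'}. nbrs v \<inter> nbrs v'"])
    show "finite walks3" by (rule finite_walks3)
    show "(\<lambda>((x, y), (u, v), (u', v')). (v, u, x, u')) ` ?B \<subseteq> walks3"
      using mids_adj adj_sym by (fastforce simp: mono_pairs_def walks3_def)
  next
    fix a :: "'a \<times> 'a \<times> 'a \<times> 'a"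
    obtain v u x u' where a: "a = (v, u, x, u')" by (cases a)
    let ?I = "{v'. adj u' v' \<and> col u' v' \<in> {col u v} \<and> v \<noteq> v' \<and> \<not> fat K v v'}"
    let ?S = "SIGMA v':?I. nbrs v \<inter> nbrs v'"
    have sub: "?I \<subseteq> {v'. adj u' v' \<and> col u' v' \<in> {col u v}}" by auto
    have finI: "finite ?I" using finite_subset[OF sub] card_col_in_le(1)[of "{col u v}"] by simp
    have cI: "card ?I \<le> 1"
      using card_mono[OF _ sub] card_col_in_le[of "{col u v}" u'] by fastforce
    have "card ?S = (\<Sum>v'\<in>?I. card (nbrs v \<inter> nbrs v'))" using finI by (simp add: card_SigmaI)
    also have "\<dots> \<le> (\<Sum>v'\<in>?I. K)" using card_common_nbrs_thin by (intro sum_mono) auto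
    also have "\<dots> \<le> K" using cI by simp
    finally show "finite ((\<lambda>(v, u, x, u'). SIGMA v':{v'. adj u' v' \<and> col u' v' \<in> {col u v} \<and> v \<noteq> v' \<and> \<not> fat K v v'}. nbrs v \<inter> nbrs v') a)
       \<and> card ((\<lambda>(v, u, x, u'). SIGMA v':{v'. adj u' v' \<and> col u' v' \<in> {col u v} \<and> v \<noteq> v' \<and> \<not> fat K v v'}. nbrs v \<inter> nbrs v') a) \<le> K"
      unfolding a using finI by auto
    show "{b \<in> ?B. (\<lambda>((x, y), (u, v), (u', v')). (v, u, x, u')) b = a} \<subseteq>
       (\<lambda>(v, u, x, u') (v', y). ((x, y), (u, v), (u', v'))) a `
       (\<lambda>(v, u, x, u'). SIGMA v':{v'. adj u' v' \<and> col u' v' \<in> {col u v} \<and> v \<noteq> v' \<and> \<not> fat K v v'}. nbrs v \<inter> nbrs v') a"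
      unfolding a using mids_adj by (force simp: mono_pairs_def mem_nbrs image_iff)
  qed
  finally show ?thesis .
qed

text \<open>The factor \<open>2 * K\<close> against \<open>K\<close> says that, up to a term of
  order \<open>n ^ 2\<close>, thin walks make up at most half of all 3-walks, so they can be
  absorbed.\<close>

lemma card_thin_walks3: "2 * K * card thin_walks3 \<le> K * card walks3 + n * n * C1"
proof -
  have eq: "thin_walks3 = (\<lambda>(p, u, v). (fst p, u, v, snd p)) ` (SIGMA p:V \<times> V. mids (fst p) (snd p))"
    using adj_in_V adj_in_V2 by (force simp: mids_def thin_walks3_def walks3_def image_iff)
  have "card thin_walks3 \<le> card (SIGMA p:V \<times> V. mids (fst p) (snd p))"
    unfolding eq using finite_V finite_mids by (intro card_image_le finite_SigmaI) auto
  also have "\<dots> = (\<Sum>(x, y)\<in>V \<times> V. card (mids x y))"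
    using finite_V finite_mids by (simp add: card_SigmaI case_prod_unfold)
  finally have "2 * K * card thin_walks3 \<le> 2 * K * (\<Sum>(x, y)\<in>V \<times> V. card (mids x y))" by (rule mult_le_mono2)
  also have "\<dots> = (\<Sum>(x, y)\<in>V \<times> V. 2 * K * card (mids x y))"
    by (simp add: sum_distrib_left case_prod_unfold)
  also have "\<dots> \<le> (\<Sum>(x, y)\<in>V \<times> V. card (mono_pairs x y) + C1)"
    using card_mids_le by (intro sum_mono) auto
  also have "\<dots> = (\<Sum>(x, y)\<in>V \<times> V. card (mono_pairs x y)) + n * n * C1"
    by (simp add: sum.distrib case_prod_unfold card_cartesian_product)
  finally show ?thesis using card_mono_pairs_total by linarith
qed

definition C2 :: nat where
  "C2 = 2 * ((k + 3) * (2 * D)) + 2 * (k * (2 * D)) + 2 * (D * (2 * D + (4 * k + 3))) + K * (2 * D)"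

text \<open>If \<open>x\<close>, \<open>v\<close> is fat, the orientation on \<open>nbrs u\<close>
  puts the walk into \<open>A\<close>, or else it lies in \<open>B\<close> or \<open>C\<close>
  according to \<open>flex x y\<close>; the other end is treated alike. If both pairs are thin,
  flexibility separates \<open>E\<close> from the thin walks. The primed sets are the images under
  reversal, with \<open>flex y x\<close> in place of \<open>flex x y\<close>.\<close>

lemma card_walks3_split:
  assumes "k \<ge> 3"
  shows "card walks3 \<le> C2 * n ^ 2 + card thin_walks3"
proof -
  define A where "A = {(x, u, v, y). (x, u, v, y) \<in> walks3 \<and> (x = v \<or> x = y \<or> col x u = col v y \<or> x \<in> succs u v)}"
  define A' where "A' = {(x, u, v, y). (x, u, v, y) \<in> walks3 \<and> (y = u \<or> y = x \<or> col y v = col u x \<or> y \<in> succs v u)}"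
  define B where "B = {(x, u, v, y). (x, u, v, y) \<in> walks3 \<and> flex x y \<and> v \<in> succs u x}"
  define B' where "B' = {(x, u, v, y). (x, u, v, y) \<in> walks3 \<and> flex y x \<and> u \<in> succs v y}"
  define C where "C = {(x, u, v, y). (x, u, v, y) \<in> walks3 \<and> \<not> flex x y \<and> x \<noteq> y \<and> fat K x v}"
  define C' where "C' = {(x, u, v, y). (x, u, v, y) \<in> walks3 \<and> \<not> flex y x \<and> y \<noteq> x \<and> fat K y u}"
  define E where "E = {(x, u, v, y). (x, u, v, y) \<in> walks3 \<and> flex x y \<and> u \<noteq> y \<and> \<not> fat K u y}"
  have "walks3 \<subseteq> A \<union> A' \<union> B \<union> B' \<union> C \<union> C' \<union> E \<union> thin_walks3"
  proof
    fix w assume w: "w \<in> walks3"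
    obtain x u v y where q: "w = (x, u, v, y)" by (cases w)
    have adjs: "adj x u" "adj u v" "adj v y" "adj u x" "adj v u"
      using w q adj_sym by (auto simp: walks3_def)
    show "w \<in> A \<union> A' \<union> B \<union> B' \<union> C \<union> C' \<union> E \<union> thin_walks3"
    proof (rule ccontr)
      assume neg: "\<not> ?thesis"
      have ne: "x \<noteq> v" "x \<noteq> y" "y \<noteq> u" "col x u \<noteq> col v y" "x \<notin> succs u v" "y \<notin> succs v u"
        using neg w unfolding q A_def A'_def by auto
      have "\<not> fat K x v"
        using succs(3)[of u x v] adjs ne neg w unfolding q B_def C_def by auto
      moreover have "\<not> fat K y u"
        using succs(3)[of v y u] adjs ne neg w unfolding q B'_def C'_def by auto
      then have "\<not> fat K u y" using fat_sym by blast
      ultimately show False using neg w ne unfolding q E_def thin_walks3_def by auto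
    qed
  qed
  then have "card walks3 \<le> card (A \<union> A' \<union> B \<union> B' \<union> C \<union> C' \<union> E \<union> thin_walks3)"
    by (rule card_mono[rotated], intro finite_UnI)
      (auto intro!: finite_subset[OF _ finite_walks3] simp: A_def A'_def B_def B'_def C_def C'_def E_def thin_walks3_def)
  also have "\<dots> \<le> card A + card A' + card B + card B' + card C + card C' + card E + card thin_walks3"
    using card_Un_le[of A A'] card_Un_le[of "A \<union> A'" B] card_Un_le[of "A \<union> A' \<union> B" B']
      card_Un_le[of "A \<union> A' \<union> B \<union> B'" C] card_Un_le[of "A \<union> A' \<union> B \<union> B' \<union> C" C']
      card_Un_le[of "A \<union> A' \<union> B \<union> B' \<union> C \<union> C'" E]
      card_Un_le[of "A \<union> A' \<union> B \<union> B' \<union> C \<union> C' \<union> E" thin_walks3] by linarith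
  finally have *: "card walks3 \<le> card A + card A' + card B + card B' + card C + card C' + card E + card thin_walks3" .
  have "card A' = card A"
    unfolding A_def A'_def
    by (rule card_walks3_swap[of "\<lambda>x u v y. x = v \<or> x = y \<or> col x u = col v y \<or> x \<in> succs u v"])
  moreover have "card B' = card B"
    unfolding B_def B'_def by (rule card_walks3_swap[of "\<lambda>x u v y. flex x y \<and> v \<in> succs u x"])
  moreover have "card C' = card C"
    unfolding C_def C'_def by (rule card_walks3_swap[of "\<lambda>x u v y. \<not> flex x y \<and> x \<noteq> y \<and> fat K x v"])
  moreover have "card A \<le> (k + 3) * (n * two_walk_bound)" unfolding A_def by (rule card_walks3_determined)
  moreover have "card B \<le> n * (k * two_walk_bound)" unfolding B_def by (rule card_walks3_flex_fat[OF assms])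
  moreover have "card C \<le> n * (D * (two_walk_bound + n * (4 * k + 3)))" unfolding C_def by (rule card_walks3_nonflex_fat)
  moreover have "card E \<le> n * (K * two_walk_bound)" unfolding E_def by (rule card_walks3_flex_thin[OF assms])
  ultimately have "card walks3 \<le> 2 * ((k + 3) * (n * two_walk_bound)) + 2 * (n * (k * two_walk_bound)) + 2 * (n * (D * (two_walk_bound + n * (4 * k + 3))))
      + n * (K * two_walk_bound) + card thin_walks3"
    using * by linarith
  also have "\<dots> = C2 * n ^ 2 + card thin_walks3"
    by (simp add: C2_def power2_eq_square algebra_simps)
  finally show ?thesis .
qed

definition C3 :: nat where "C3 = 2 * K * C2 + C1"

lemma card_walks3:
  assumes "k \<ge> 3"
  shows "card walks3 \<le> C3 * n ^ 2"
proof -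
  have "2 * K * card walks3 \<le> 2 * K * (C2 * n ^ 2) + 2 * K * card thin_walks3"
    using mult_le_mono2[OF card_walks3_split[OF assms], of "2 * K"] by (simp add: distrib_left)
  also have "\<dots> \<le> 2 * K * (C2 * n ^ 2) + K * card walks3 + n * n * C1"
    using card_thin_walks3 by linarith
  finally have "K * card walks3 \<le> C3 * n ^ 2"
    by (simp add: C3_def algebra_simps power2_eq_square)
  moreover have "card walks3 \<le> K * card walks3" by (simp add: K_def)
  ultimately show ?thesis by linarith
qed

end

section \<open>Counting cycles\<close>

text \<open>Lists are enumerated by prefixes. Only prefixes of members of \<open>B\<close> are
  counted, so the constraints on the whole list are available when a prefix is continued.\<close>

lemma card_take_step:
  assumes "finite (take l ` B)" "\<And>ys. ys \<in> B \<Longrightarrow> take j (drop l ys) \<in> S (take l ys)"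
    and "\<And>a. a \<in> take l ` B \<Longrightarrow> finite (S a) \<and> card (S a) \<le> d"
  shows "finite (take (l + j) ` B)" "card (take (l + j) ` B) \<le> d * card (take l ` B)"
proof -
  have 1: "take l ` take (l + j) ` B \<subseteq> take l ` B" by (auto simp: min_def)
  have 2: "{b \<in> take (l + j) ` B. take l b = a} \<subseteq> (@) a ` S a" for a
  proof
    fix b assume "b \<in> {b \<in> take (l + j) ` B. take l b = a}"
    then obtain ys where ys: "ys \<in> B" "b = take (l + j) ys" "take l ys = a" by (auto simp: min_def)
    then have "b = a @ take j (drop l ys)" by (simp add: take_add)
    then show "b \<in> (@) a ` S a" using assms(2)[OF ys(1)] ys(3) by auto
  qed
  show "finite (take (l + j) ` B)" "card (take (l + j) ` B) \<le> d * card (take l ` B)"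
    using card_le_fibres_image[OF assms(1) 1 2 assms(3)] by blast+
qed

lemma take_2_drop: "l + 2 \<le> length ys \<Longrightarrow> take 2 (drop l ys) = [ys ! l, ys ! Suc l]"
  by (simp add: numeral_2_eq_2 Cons_nth_drop_Suc[symmetric])

lemma card_singleton_lists: "card ((\<lambda>z. [z]) ` A) = card A"
  by (rule card_image) (simp add: inj_on_def)

lemma take_1_drop: "l < length ys \<Longrightarrow> take 1 (drop l ys) = [ys ! l]"
  by (simp add: Cons_nth_drop_Suc[symmetric])

lemma rotate_inverse: "\<exists>a\<le>length xs. rotate a (rotate r xs) = xs"
proof (cases "xs = []")
  case False
  let ?r = "r mod length xs"
  have "?r < length xs" using False by simp
  moreover have "rotate (length xs - ?r) (rotate r xs) = xs"
    using \<open>?r < length xs\<close> by (subst rotate_conv_mod[of r]) (simp add: rotate_rotate)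
  ultimately show ?thesis by (intro exI[of _ "length xs - ?r"]) auto
qed simp

context rainbow_cycle_free
begin

section \<open>Labelled 2k-cycles and the number of those in normal form\<close>

definition cyc :: "'a list \<Rightarrow> bool" where
  "cyc xs \<longleftrightarrow> length xs = 2 * k \<and> distinct xs \<and> (\<forall>i<2 * k. adj (xs ! i) (xs ! (Suc i mod (2 * k))))"

lemma cyc_length: "cyc xs \<Longrightarrow> length xs = 2 * k"
  by (simp add: cyc_def)

lemma cyc_adj: "cyc xs \<Longrightarrow> Suc i < 2 * k \<Longrightarrow> adj (xs ! i) (xs ! Suc i)"
  unfolding cyc_def by (metis Suc_lessD mod_less)

lemma cyc_adj_last:
  assumes "cyc xs" shows "adj (xs ! (2 * k - 1)) (xs ! 0)"
proof -
  have "2 * k - 1 < 2 * k" "Suc (2 * k - 1) mod (2 * k) = 0" using k_ge_2 by auto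
  then show ?thesis using assms unfolding cyc_def by metis
qed

lemma cyc_neq: "cyc xs \<Longrightarrow> i < 2 * k \<Longrightarrow> j < 2 * k \<Longrightarrow> i \<noteq> j \<Longrightarrow> xs ! i \<noteq> xs ! j"
  by (simp add: cyc_def nth_eq_iff_index_eq)

lemma nth_in_V: "cyc xs \<Longrightarrow> i < 2 * k \<Longrightarrow> xs ! i \<in> V"
  using adj_in_V by (auto simp: cyc_def)

lemma cyc_rotate:
  assumes "cyc xs" shows "cyc (rotate r xs)"
proof -
  have len: "length xs = 2 * k" using assms by (simp add: cyc_def)
  have "adj (rotate r xs ! i) (rotate r xs ! (Suc i mod (2 * k)))" if "i < 2 * k" for i
  proof -
    have "(r + Suc i mod (2 * k)) mod (2 * k) = Suc ((r + i) mod (2 * k)) mod (2 * k)"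
      by (simp add: mod_simps)
    moreover have "(r + i) mod (2 * k) < 2 * k" "Suc i mod (2 * k) < 2 * k" using k_ge_2 by auto
    ultimately show ?thesis using assms that len by (simp add: nth_rotate cyc_def)
  qed
  then show ?thesis using assms by (simp add: cyc_def)
qed

lemma cyc_rev:
  assumes "cyc xs" shows "cyc (rev xs)"
proof -
  have len: "length xs = 2 * k" using assms by (simp add: cyc_def)
  have "adj (rev xs ! i) (rev xs ! (Suc i mod (2 * k)))" if "i < 2 * k" for i
  proof (cases "Suc i < 2 * k")
    case True
    have "adj (xs ! (2 * k - Suc (Suc i))) (xs ! Suc (2 * k - Suc (Suc i)))"
      using True by (intro cyc_adj[OF assms]) auto
    moreover have "Suc (2 * k - Suc (Suc i)) = 2 * k - Suc i" using True by simp
    ultimately show ?thesis using True len that by (simp add: rev_nth adj_sym)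
  next
    case False
    then have "i = 2 * k - 1" using that by simp
    then show ?thesis using cyc_adj_last[OF assms] len k_ge_2 adj_sym by (simp add: rev_nth)
  qed
  then show ?thesis using assms by (simp add: cyc_def)
qed

lemma finite_cyc: "finite {xs. cyc xs}"
proof (rule finite_subset)
  show "{xs. cyc xs} \<subseteq> {xs. set xs \<subseteq> V \<and> length xs = 2 * k}"
    using nth_in_V by (auto simp: cyc_def in_set_conv_nth)
  show "finite {xs. set xs \<subseteq> V \<and> length xs = 2 * k}" using finite_lists_length_eq[OF finite_V] .
qed

definition ecol where "ecol xs i = col (xs ! i) (xs ! (Suc i mod (2 * k)))"

lemma cyc_repeated_colour:
  assumes "cyc xs"
  shows "\<exists>i<2 * k. \<exists>j<2 * k. i \<noteq> j \<and> ecol xs i = ecol xs j"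
proof (rule ccontr)
  assume "\<not> ?thesis"
  then have inj: "i = j" if "i < 2 * k" "j < 2 * k" "ecol xs i = ecol xs j" for i j
    using that by blast
  have len: "length xs = 2 * k" using assms by (simp add: cyc_def)
  have ne: "xs \<noteq> []" using len k_ge_2 by auto
  have lh: "last xs = xs ! (2 * k - 1)" "hd xs = xs ! 0"
    using ne len by (auto simp: last_conv_nth hd_conv_nth)
  have ec: "cols xs ! i = ecol xs i" if "i < 2 * k - 1" for i
    using that len by (simp add: cols_nth ecol_def)
  have ecl: "col (last xs) (hd xs) = ecol xs (2 * k - 1)"
    using k_ge_2 by (simp add: lh ecol_def)
  have lc: "length (cols xs) = 2 * k - 1" by (simp add: length_cols len)
  have "successively adj xs"
    unfolding successively_conv_nth using cyc_adj[OF assms] len by simp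
  moreover have "distinct (cols xs)"
    unfolding distinct_conv_nth lc using ec inj by (metis diff_le_self order_less_le_trans)
  moreover have "col (last xs) (hd xs) \<notin> set (cols xs)"
  proof
    assume "col (last xs) (hd xs) \<in> set (cols xs)"
    then obtain i where "i < 2 * k - 1" "ecol xs i = ecol xs (2 * k - 1)"
      using ec ecl lc by (auto simp: in_set_conv_nth)
    moreover from this have "i < 2 * k" "2 * k - 1 < 2 * k" "i \<noteq> 2 * k - 1" by linarith+
    ultimately show False using inj[of i "2 * k - 1"] by blast
  qed
  ultimately have "rcycle xs"
    using assms cyc_adj_last[OF assms] ne lh by (auto simp: rcycle_def rpath_def cyc_def)
  then show False using no_rcycle len by blast
qed

lemma prefix4:
  assumes "B \<subseteq> {xs. cyc xs}" "k \<ge> 3"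
  shows "finite (take 4 ` B)" "card (take 4 ` B) \<le> C3 * n ^ 2"
proof -
  have sub: "take 4 ` B \<subseteq> (\<lambda>(x, u, v, y). [x, u, v, y]) ` walks3"
  proof
    fix p assume "p \<in> take 4 ` B"
    then obtain xs where xs: "cyc xs" "p = take 4 xs" using assms(1) by auto
    have "p = [xs ! 0, xs ! 1, xs ! 2, xs ! 3]"
      using xs assms(2) by (auto simp: cyc_def numeral_eq_Suc take_Suc_conv_app_nth)
    moreover have "(xs ! 0, xs ! 1, xs ! 2, xs ! 3) \<in> walks3"
      using cyc_adj[OF xs(1)] assms(2) by (auto simp: walks3_def numeral_eq_Suc)
    ultimately show "p \<in> (\<lambda>(x, u, v, y). [x, u, v, y]) ` walks3" by (auto intro: image_eqI[rotated])
  qed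
  then show "finite (take 4 ` B)" using finite_walks3 finite_subset by blast
  show "card (take 4 ` B) \<le> C3 * n ^ 2"
    using card_mono[OF _ sub] card_image_le[OF finite_walks3, of "\<lambda>(x, u, v, y). [x, u, v, y]"]
      card_walks3[OF assms(2)] finite_walks3 by (meson finite_imageI order_trans)
qed

text \<open>The last vertex of the prefix starts a walk of two edges, so the next two entries cost
  \<open>two_walk_bound\<close> together.\<close>

lemma prefix_two_steps:
  assumes "B \<subseteq> {xs. cyc xs}" "l \<ge> 1" "finite (take l ` B)"
  shows "l + 2 * i \<le> 2 * k \<Longrightarrow> finite (take (l + 2 * i) ` B) \<and>
    card (take (l + 2 * i) ` B) \<le> two_walk_bound ^ i * card (take l ` B)"
proof (induction i)
  case 0
  then show ?case using assms(3) by simp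
next
  case (Suc i)
  then have IH: "finite (take (l + 2 * i) ` B)" "card (take (l + 2 * i) ` B) \<le> two_walk_bound ^ i * card (take l ` B)" by auto
  let ?S = "\<lambda>a. (\<lambda>(v, u). [v, u]) ` {(v, u). adj (last a) v \<and> adj v u}"
  have 1: "take 2 (drop (l + 2 * i) ys) \<in> ?S (take (l + 2 * i) ys)" if "ys \<in> B" for ys
  proof -
    have c: "cyc ys" using that assms(1) by auto
    let ?m = "l + 2 * i"
    have len: "length ys = 2 * k" "?m + 2 \<le> length ys" using cyc_length[OF c] Suc.prems by auto
    have "take ?m ys \<noteq> []" using len assms(2) by (cases ys) auto
    then have "last (take ?m ys) = ys ! (?m - 1)" using len by (simp add: last_conv_nth)
    moreover have "adj (ys ! (?m - 1)) (ys ! ?m)" using cyc_adj[OF c, of "?m - 1"] assms(2) Suc.prems by simp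
    moreover have "adj (ys ! ?m) (ys ! Suc ?m)" using cyc_adj[OF c, of ?m] Suc.prems by simp
    ultimately show ?thesis using take_2_drop[OF len(2)] by auto
  qed
  have 2: "finite (?S a) \<and> card (?S a) \<le> two_walk_bound" for a
    using walks2_from[of "last a"] card_image_le[OF walks2_from(1)[of "last a"], of "\<lambda>(v, u). [v, u]"] by auto
  note step = card_take_step[OF IH(1) 1 2]
  have eq: "l + 2 * Suc i = l + 2 * i + 2" by simp
  have "card (take (l + 2 * i + 2) ` B) \<le> two_walk_bound * (two_walk_bound ^ i * card (take l ` B))"
    using step(2) mult_le_mono2[OF IH(2), of two_walk_bound] by (rule order_trans)
  then show ?case using step(1) unfolding eq by (simp add: mult_ac)
qed

lemma prefix_last:
  assumes "B \<subseteq> {xs. cyc xs}" "finite (take (2 * k - 1) ` B)"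
    and "\<And>ys. ys \<in> B \<Longrightarrow> \<not> fat K (ys ! (2 * k - 2)) (ys ! 0)"
  shows "finite B" "card B \<le> K * card (take (2 * k - 1) ` B)"
proof -
  let ?l = "2 * k - 1"
  let ?S = "\<lambda>a. (\<lambda>z. [z]) ` (if a ! (2 * k - 2) \<noteq> a ! 0 \<and> \<not> fat K (a ! (2 * k - 2)) (a ! 0)
      then nbrs (a ! (2 * k - 2)) \<inter> nbrs (a ! 0) else {})"
  have 1: "take 1 (drop ?l ys) \<in> ?S (take ?l ys)" if "ys \<in> B" for ys
  proof -
    have c: "cyc ys" using that assms(1) by auto
    have "length ys = 2 * k" "?l < length ys" using cyc_length[OF c] k_ge_2 by auto
    moreover have "adj (ys ! (2 * k - 2)) (ys ! ?l)"
    proof -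
      have "Suc (2 * k - 2) = ?l" "Suc (2 * k - 2) < 2 * k" using k_ge_2 by linarith+
      then show ?thesis using cyc_adj[OF c, of "2 * k - 2"] by simp
    qed
    moreover have "adj (ys ! 0) (ys ! ?l)" using cyc_adj_last[OF c] adj_sym by blast
    moreover have "ys ! (2 * k - 2) \<noteq> ys ! 0" using cyc_neq[OF c, of "2 * k - 2" 0] k_ge_2 by simp
    ultimately show ?thesis using assms(3)[OF that] take_1_drop[of ?l ys] k_ge_2 by (simp add: mem_nbrs)
  qed
  have 2: "finite (?S a) \<and> card (?S a) \<le> K" for a
    using card_common_nbrs_thin[of "a ! (2 * k - 2)" "a ! 0"] by (simp add: card_singleton_lists)
  have "?l + 1 = 2 * k" using k_ge_2 by simp
  then have "take (?l + 1) ys = ys" if "ys \<in> B" for ys using that assms(1) cyc_length[of ys] by auto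
  then have 3: "take (?l + 1) ` B = B" by simp
  show "finite B" "card B \<le> K * card (take (2 * k - 1) ` B)"
    using card_take_step[OF assms(2) 1 2] unfolding 3 by blast+
qed

text \<open>
  Normal forms of the cycles after rotation and reversal.  The last vertex, at index \<open>2 * k - 1\<close>,
  is always the middle of a thin pair.
\<close>
definition colour_cycles where
  "colour_cycles = {ys. cyc ys \<and> \<not> fat K (ys ! (2 * k - 2)) (ys ! 0) \<and>
     (\<exists>i<2 * k - 3. ecol ys i = ecol ys (2 * k - 3))}"

definition fat_cycles where
  "fat_cycles m = {ys. cyc ys \<and> \<not> fat K (ys ! (2 * k - 2)) (ys ! 0) \<and>
     ys ! m \<in> succs (ys ! (m - 1)) (ys ! (m - 2))}"

definition C4 :: nat where "C4 = K * (2 * k * ((2 * D) ^ (k - 3) * C3))"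

lemma bd_power:
  assumes "k \<ge> 3"
  shows "K * (2 * k * (two_walk_bound ^ (k - 3) * (C3 * n ^ 2))) = C4 * n ^ (k - 1)"
proof -
  have "k - 3 + 2 = k - 1" using assms by simp
  then have "n ^ (k - 3) * n ^ 2 = n ^ (k - 1)" by (simp only: power_add[symmetric])
  then show ?thesis by (simp add: C4_def power_mult_distrib mult_ac)
qed

text \<open>The indices up to \<open>2 * k - 3\<close> are enumerated by a 3-walk and
  \<open>k - 3\<close> double steps. The next edge repeats a colour seen among them, so its new end
  has at most \<open>2 * k\<close> candidates; the last vertex is the middle of a thin pair.\<close>

lemma card_colour_cycles:
  assumes "k \<ge> 3"
  shows "finite colour_cycles" "card colour_cycles \<le> C4 * n ^ (k - 1)"
proof -
  let ?B = colour_cycles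
  have B: "?B \<subseteq> {xs. cyc xs}" by (auto simp: colour_cycles_def)
  have e: "4 + 2 * (k - 3) = 2 * k - 2" using assms by simp
  have s1: "finite (take (2 * k - 2) ` ?B)" "card (take (2 * k - 2) ` ?B) \<le> two_walk_bound ^ (k - 3) * card (take 4 ` ?B)"
    using prefix_two_steps[OF B _ prefix4(1)[OF B assms], of "k - 3"] assms unfolding e by auto
  let ?S = "\<lambda>a. (\<lambda>z. [z]) ` {z. adj (last a) z \<and> col (last a) z \<in> set (cols a)}"
  have 1: "take 1 (drop (2 * k - 2) ys) \<in> ?S (take (2 * k - 2) ys)" if ysB: "ys \<in> ?B" for ys
  proof -
    have c: "cyc ys" using ysB B by auto
    let ?a = "take (2 * k - 2) ys"
    have len: "length ys = 2 * k" "2 * k - 2 < length ys" using cyc_length[OF c] k_ge_2 by auto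
    have "?a \<noteq> []" using len assms by (cases ys) auto
    moreover have "length ?a - 1 = 2 * k - 3" "2 * k - 3 < 2 * k - 2" using len assms by auto
    ultimately have la: "last ?a = ys ! (2 * k - 3)" by (metis last_conv_nth nth_take)
    have sk: "Suc (2 * k - 3) = 2 * k - 2" using assms by simp
    obtain i where i: "i < 2 * k - 3" "ecol ys i = ecol ys (2 * k - 3)" using ysB unfolding colour_cycles_def by blast
    have "cols ?a ! i = col (?a ! i) (?a ! Suc i)" using i len by (intro cols_nth) simp
    also have "\<dots> = ecol ys i" using i by (simp add: ecol_def)
    also have "\<dots> = col (last ?a) (ys ! (2 * k - 2))" using i(2) la sk assms by (simp add: ecol_def)
    finally have "col (last ?a) (ys ! (2 * k - 2)) \<in> set (cols ?a)"
      using i(1) len by (metis diff_Suc_1 length_cols length_take min.absorb4 nth_mem sk)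
    moreover have "adj (last ?a) (ys ! (2 * k - 2))" using cyc_adj[OF c, of "2 * k - 3"] la sk assms by simp
    ultimately show ?thesis using take_1_drop[OF len(2)] by simp
  qed
  have 2: "finite (?S a) \<and> card (?S a) \<le> 2 * k" if aB: "a \<in> take (2 * k - 2) ` ?B" for a
  proof -
    obtain ys where "cyc ys" "a = take (2 * k - 2) ys" using aB B by auto
    then have "card (set (cols a)) \<le> 2 * k"
      using card_length[of "cols a"] cyc_length[of ys] by (simp add: length_cols)
    then show ?thesis using card_col_in_le[of "set (cols a)" "last a"] by (simp add: card_singleton_lists)
  qed
  have e2: "2 * k - 2 + 1 = 2 * k - 1" using assms by simp
  have s2: "finite (take (2 * k - 1) ` ?B)" "card (take (2 * k - 1) ` ?B) \<le> 2 * k * card (take (2 * k - 2) ` ?B)"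
    using card_take_step[OF s1(1) 1 2] unfolding e2 by blast+
  have thin: "\<And>ys. ys \<in> ?B \<Longrightarrow> \<not> fat K (ys ! (2 * k - 2)) (ys ! 0)" by (auto simp: colour_cycles_def)
  show "finite ?B" using prefix_last(1)[OF B s2(1) thin] .
  have "card ?B \<le> K * card (take (2 * k - 1) ` ?B)" using prefix_last(2)[OF B s2(1) thin] .
  also have "\<dots> \<le> K * (2 * k * (two_walk_bound ^ (k - 3) * (C3 * n ^ 2)))"
    by (intro mult_le_mono2 order_trans[OF s2(2)] order_trans[OF s1(2)] prefix4(2)[OF B assms])
  finally show "card ?B \<le> C4 * n ^ (k - 1)" using bd_power[OF assms] by simp
qed

text \<open>The orientation supplies the vertex at index \<open>m\<close> from its two predecessors.
  As \<open>m\<close> is even and at least 4, double steps fill the gap between the 3-walk and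
  \<open>m\<close>, and after \<open>m\<close> they end exactly at index \<open>2 * k - 2\<close>;
  in total there are \<open>k - 3\<close> of them.\<close>

lemma card_fat_cycles:
  assumes "k \<ge> 3" "even m" "4 \<le> m" "m \<le> 2 * k - 2"
  shows "finite (fat_cycles m)" "card (fat_cycles m) \<le> C4 * n ^ (k - 1)"
proof -
  let ?B = "fat_cycles m"
  have B: "?B \<subseteq> {xs. cyc xs}" by (auto simp: fat_cycles_def)
  obtain h where h: "m = 2 * h" using assms(2) by (elim evenE)
  define i where "i = h - 2"
  define j where "j = k - 1 - h"
  have e: "4 + 2 * i = m" "m + 1 + 2 * j = 2 * k - 1" "i + j = k - 3"
    using assms unfolding h i_def j_def by linarith+
  have s1: "finite (take m ` ?B)" "card (take m ` ?B) \<le> two_walk_bound ^ i * card (take 4 ` ?B)"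
    using prefix_two_steps[OF B _ prefix4(1)[OF B assms(1)], of i] assms unfolding e by auto
  let ?S = "\<lambda>a. (\<lambda>z. [z]) ` succs (a ! (m - 1)) (a ! (m - 2))"
  have 1: "take 1 (drop m ys) \<in> ?S (take m ys)" if "ys \<in> ?B" for ys
  proof -
    have "length ys = 2 * k" "m < length ys" using that B cyc_length[of ys] assms by auto
    then show ?thesis using take_1_drop[of m ys] that assms(3) by (simp add: fat_cycles_def)
  qed
  have 2: "finite (?S a) \<and> card (?S a) \<le> k" for a
    using succs(1,2) by (simp add: card_singleton_lists)
  have s2: "finite (take (m + 1) ` ?B)" "card (take (m + 1) ` ?B) \<le> k * card (take m ` ?B)"
    using card_take_step[OF s1(1) 1 2] by blast+
  have s3: "finite (take (2 * k - 1) ` ?B)" "card (take (2 * k - 1) ` ?B) \<le> two_walk_bound ^ j * card (take (m + 1) ` ?B)"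
    using prefix_two_steps[OF B _ s2(1), of j] unfolding e by auto
  have thin: "\<And>ys. ys \<in> ?B \<Longrightarrow> \<not> fat K (ys ! (2 * k - 2)) (ys ! 0)" by (auto simp: fat_cycles_def)
  show "finite ?B" using prefix_last(1)[OF B s3(1) thin] .
  have "card ?B \<le> K * card (take (2 * k - 1) ` ?B)" using prefix_last(2)[OF B s3(1) thin] .
  also have "\<dots> \<le> K * (two_walk_bound ^ j * (k * (two_walk_bound ^ i * (C3 * n ^ 2))))"
    by (intro mult_le_mono2 order_trans[OF s3(2)] order_trans[OF s2(2)] order_trans[OF s1(2)] prefix4(2)[OF B assms(1)])
  also have "\<dots> = K * (k * (two_walk_bound ^ (k - 3) * (C3 * n ^ 2)))" unfolding e(3)[symmetric] power_add by (simp add: mult_ac)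
  also have "\<dots> \<le> K * (2 * k * (two_walk_bound ^ (k - 3) * (C3 * n ^ 2)))" by (intro mult_le_mono2 mult_le_mono1) simp
  finally show "card ?B \<le> C4 * n ^ (k - 1)" using bd_power[OF assms(1)] by simp
qed

definition scheme_cycles where
  "scheme_cycles = colour_cycles \<union> (\<Union>m\<in>{m. even m \<and> 4 \<le> m \<and> m \<le> 2 * k - 2}. fat_cycles m)"

lemma card_scheme_cycles:
  assumes "k \<ge> 3"
  shows "finite scheme_cycles" "card scheme_cycles \<le> (2 * k + 1) * (C4 * n ^ (k - 1))"
proof -
  let ?M = "{m. even m \<and> 4 \<le> m \<and> m \<le> 2 * k - 2}"
  have sub: "?M \<subseteq> {..<2 * k}" using assms by auto
  then have finM: "finite ?M" and cM: "card ?M \<le> 2 * k"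
    using finite_subset card_mono[OF _ sub] by auto
  show "finite scheme_cycles"
    unfolding scheme_cycles_def using finM card_colour_cycles(1)[OF assms] card_fat_cycles(1)[OF assms] by auto
  have "card (\<Union>m\<in>?M. fat_cycles m) \<le> (\<Sum>m\<in>?M. card (fat_cycles m))" by (rule card_UN_le[OF finM])
  also have "\<dots> \<le> (\<Sum>m\<in>?M. C4 * n ^ (k - 1))" using card_fat_cycles(2)[OF assms] by (intro sum_mono) auto
  also have "\<dots> \<le> 2 * k * (C4 * n ^ (k - 1))" using cM by simp
  finally have "card (\<Union>m\<in>?M. fat_cycles m) \<le> 2 * k * (C4 * n ^ (k - 1))" .
  then have "card colour_cycles + card (\<Union>m\<in>?M. fat_cycles m) \<le> (2 * k + 1) * (C4 * n ^ (k - 1))"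
    using card_colour_cycles(2)[OF assms] by simp
  then show "card scheme_cycles \<le> (2 * k + 1) * (C4 * n ^ (k - 1))"
    unfolding scheme_cycles_def using card_Un_le order_trans by blast
qed


section \<open>Bringing every cycle into a normal form\<close>

lemma nth_rotate_cyc:
  assumes "cyc xs" "i < 2 * k" shows "rotate r xs ! i = xs ! ((r + i) mod (2 * k))"
  using assms cyc_length[OF assms(1)] by (simp add: nth_rotate)

lemma ecol_rotate:
  assumes "cyc xs" "i < 2 * k" shows "ecol (rotate r xs) i = ecol xs ((r + i) mod (2 * k))"
proof -
  have "Suc i mod (2 * k) < 2 * k" using assms(2) by simp
  moreover have "(r + Suc i mod (2 * k)) mod (2 * k) = Suc ((r + i) mod (2 * k)) mod (2 * k)"
    by (simp add: mod_simps)
  ultimately show ?thesis using assms by (simp add: ecol_def nth_rotate_cyc)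
qed

text \<open>Without fat pairs every rotation satisfies the condition on the last vertex. It remains
  to rotate two edges of equal colour so that one gets index \<open>2 * k - 3\<close> and the other
  a smaller index. If they are at least three apart, a shift by 3 does this.\<close>

lemma all_thin_scheme:
  assumes "k \<ge> 3" "cyc xs" and thin: "\<And>r. \<not> fat K (rotate r xs ! 0) (rotate r xs ! 2)"
  shows "\<exists>r. rotate r xs \<in> scheme_cycles"
proof -
  obtain i j where ij: "i < 2 * k" "j < 2 * k" "i < j" "ecol xs i = ecol xs j"
    using cyc_repeated_colour[OF assms(2)] by (metis linorder_neq_iff)
  define y where "y = rotate i xs"
  define d where "d = j - i"
  have y: "cyc y" using cyc_rotate assms(2) by (simp add: y_def)
  have d: "0 < d" "d < 2 * k" using ij by (auto simp: d_def)
  have e0: "ecol y 0 = ecol y d"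
    using ij d ecol_rotate[OF assms(2), of 0 i] ecol_rotate[OF assms(2), of d i] by (simp add: y_def d_def)
  have d1: "d \<noteq> 1"
  proof
    assume "d = 1"
    then have "col (y ! 1) (y ! 0) = col (y ! 1) (y ! 2)" using e0 assms(1) by (simp add: ecol_def col_sym numeral_2_eq_2)
    then have "y ! 0 = y ! 2"
      using col_proper[of "y ! 1" "y ! 0" "y ! 2"] cyc_adj[OF y, of 0] cyc_adj[OF y, of 1] adj_sym assms(1)
      by (simp add: numeral_2_eq_2)
    then show False using cyc_neq[OF y, of 0 2] assms(1) by simp
  qed
  have thin': "\<not> fat K (rotate r y ! (2 * k - 2)) (rotate r y ! 0)" for r
  proof -
    have "rotate (2 * k - 2) (rotate r y) ! 0 = rotate r y ! (2 * k - 2)"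
      "rotate (2 * k - 2) (rotate r y) ! 2 = rotate r y ! 0"
      using nth_rotate_cyc[OF cyc_rotate[OF y, of r], of _ "2 * k - 2"] assms(1) by auto
    then show ?thesis using thin[of "2 * k - 2 + (r + i)"] by (simp add: y_def rotate_rotate)
  qed
  have "\<exists>s. rotate s y \<in> colour_cycles"
  proof (cases "d = 2")
    case True
    \<comment> \<open>At distance two a shift by 3 would send edge \<open>d\<close> to index
      \<open>2 * k - 1\<close>; a shift by 5 sends it to \<open>2 * k - 3\<close> and the other edge
      to \<open>2 * k - 5\<close>.\<close>
    have *: "5 + (2 * k - 5) = 2 * k" "5 + (2 * k - 3) = 2 * k + 2" using assms(1) by simp_all
    have "(2 * k + 2) mod (2 * k) = 2" using assms(1) by (simp only: mod_add_self1) simp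
    note ** = * this
    have "ecol (rotate 5 y) (2 * k - 5) = ecol y 0" "ecol (rotate 5 y) (2 * k - 3) = ecol y 2"
      using assms(1) ecol_rotate[OF y, of "2 * k - 5" 5] ecol_rotate[OF y, of "2 * k - 3" 5] unfolding ** by simp_all
    then have "\<exists>i<2 * k - 3. ecol (rotate 5 y) i = ecol (rotate 5 y) (2 * k - 3)"
      using e0 True assms(1) by (intro exI[of _ "2 * k - 5"]) auto
    then show ?thesis using cyc_rotate[OF y] thin' unfolding colour_cycles_def by blast
  next
    case False
    have *: "3 + (d - 3) = d" "3 + (2 * k - 3) = 2 * k" using assms(1) d d1 False by simp_all
    have "ecol (rotate 3 y) (d - 3) = ecol y d" "ecol (rotate 3 y) (2 * k - 3) = ecol y 0"
      using assms(1) d d1 False ecol_rotate[OF y, of "d - 3" 3] ecol_rotate[OF y, of "2 * k - 3" 3] unfolding * by simp_all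
    then have "\<exists>i<2 * k - 3. ecol (rotate 3 y) i = ecol (rotate 3 y) (2 * k - 3)"
      using e0 d d1 False by (intro exI[of _ "d - 3"]) auto
    then show ?thesis using cyc_rotate[OF y] thin' unfolding colour_cycles_def by blast
  qed
  then obtain s where "rotate s y \<in> scheme_cycles" by (auto simp: scheme_cycles_def)
  then have "rotate (s + i) xs \<in> scheme_cycles" by (simp add: y_def rotate_rotate)
  then show ?thesis by blast
qed

text \<open>If no odd position from 3 to \<open>2 * k - 3\<close> were thin, the even positions
  would form a fat chain on \<open>k\<close> vertices whose ends are adjacent to the last vertex.
  Rotating a thin position \<open>f\<close> to the end moves \<open>z ! 2\<close> to index
  \<open>2 * k + 1 - f\<close>, an even number between 4 and \<open>2 * k - 2\<close>.\<close>

lemma fat_scheme: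
  assumes "k \<ge> 3" "cyc z" "fat K (z ! 0) (z ! 2)" "z ! 2 \<in> succs (z ! 1) (z ! 0)"
  shows "\<exists>r. rotate r z \<in> scheme_cycles"
proof -
  have "\<exists>f. odd f \<and> 3 \<le> f \<and> f \<le> 2 * k - 3 \<and> \<not> fat K (z ! (f - 1)) (z ! (f + 1))"
  proof (rule ccontr)
    assume *: "\<not> ?thesis"
    have chain: "fat K (z ! (2 * i)) (z ! (2 * i + 2))" if "i < k - 1" for i
    proof (cases "i = 0")
      case True
      then show ?thesis using assms(3) by (simp add: numeral_2_eq_2)
    next
      case False
      then have "odd (2 * i + 1) \<and> 3 \<le> 2 * i + 1 \<and> 2 * i + 1 \<le> 2 * k - 3" using that by auto
      then have "fat K (z ! (2 * i + 1 - 1)) (z ! (2 * i + 1 + 1))" using * by blast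
      then show ?thesis by simp
    qed
    let ?hs = "map (\<lambda>i. z ! (2 * i)) [0..<k]"
    have ne: "?hs \<noteq> []" using assms(1) by simp
    show False
    proof (rule no_fat_chain[of ?hs "z ! (2 * k - 1)"])
      show "distinct ?hs"
        using cyc_neq[OF assms(2), of "2 * _" "2 * _"] by (fastforce simp: distinct_map inj_on_def)
      show "successively (fat K) ?hs"
        unfolding successively_conv_nth using chain by (auto simp: nth_append)
      show "adj (z ! (2 * k - 1)) (hd ?hs)"
        using cyc_adj_last[OF assms(2)] assms(1) by (simp add: hd_map)
      have "last ?hs = z ! (2 * k - 2)" using assms(1) by (simp add: last_map right_diff_distrib')
      moreover have "Suc (2 * k - 2) = 2 * k - 1" using assms(1) by simp
      ultimately show "adj (z ! (2 * k - 1)) (last ?hs)"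
        using cyc_adj[OF assms(2), of "2 * k - 2"] assms(1) adj_sym by simp
      show "z ! (2 * k - 1) \<notin> set ?hs"
      proof
        assume "z ! (2 * k - 1) \<in> set ?hs"
        then obtain i where i: "i < k" "z ! (2 * k - 1) = z ! (2 * i)" by auto
        then have "2 * k - 1 = 2 * i" using cyc_neq[OF assms(2), of "2 * k - 1" "2 * i"] by fastforce
        then show False using i(1) by presburger
      qed
    qed simp
  qed
  then obtain f where f: "odd f" "3 \<le> f" "f \<le> 2 * k - 3" "\<not> fat K (z ! (f - 1)) (z ! (f + 1))" by blast
  define m where "m = 2 * k + 1 - f"
  have m: "even m" "4 \<le> m" "m \<le> 2 * k - 2" using f by (auto simp: m_def)
  let ?y = "rotate (f + 1) z"
  have nth: "?y ! j = z ! ((f + 1 + j) mod (2 * k))" if "j < 2 * k" for j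
    by (rule nth_rotate_cyc[OF assms(2) that])
  have "?y ! m = z ! 2" "?y ! (m - 1) = z ! 1" "?y ! (m - 2) = z ! 0" "?y ! (2 * k - 2) = z ! (f - 1)" "?y ! 0 = z ! (f + 1)"
  proof -
    have "f + 1 + m = 2 * k + 2" "f + 1 + (m - 1) = 2 * k + 1" "f + 1 + (m - 2) = 2 * k + 0"
      "f + 1 + (2 * k - 2) = 2 * k + (f - 1)"
      using f m assms(1) unfolding m_def by linarith+
    then show "?y ! m = z ! 2" "?y ! (m - 1) = z ! 1" "?y ! (m - 2) = z ! 0" "?y ! (2 * k - 2) = z ! (f - 1)"
      using nth m f assms(1) by (simp_all only: mod_add_self1) simp_all
    show "?y ! 0 = z ! (f + 1)" using nth[of 0] f by simp
  qed
  then have "?y \<in> fat_cycles m"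
    using cyc_rotate[OF assms(2), of "f + 1"] assms(4) f(4) unfolding fat_cycles_def by simp
  then have "?y \<in> scheme_cycles" using m unfolding scheme_cycles_def by blast
  then show ?thesis by blast
qed

lemma scheme_exists:
  assumes "k \<ge> 3" "cyc xs"
  shows "(\<exists>r. rotate r xs \<in> scheme_cycles) \<or> (\<exists>r s. rotate s (rev (rotate r xs)) \<in> scheme_cycles)"
proof (cases "\<exists>r. fat K (rotate r xs ! 0) (rotate r xs ! 2)")
  case False
  then show ?thesis using all_thin_scheme[OF assms] by blast
next
  case True
  then obtain r where r: "fat K (rotate r xs ! 0) (rotate r xs ! 2)" by blast
  define y where "y = rotate r xs"
  have y: "cyc y" using cyc_rotate assms(2) by (simp add: y_def)
  have "adj (y ! 1) (y ! 0)" "adj (y ! 1) (y ! 2)"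
    using cyc_adj[OF y, of 0] cyc_adj[OF y, of 1] adj_sym assms(1) by (auto simp: numeral_2_eq_2)
  then consider "y ! 2 \<in> succs (y ! 1) (y ! 0)" | "y ! 0 \<in> succs (y ! 1) (y ! 2)"
    using succs(3) r by (auto simp: y_def)
  then show ?thesis
  proof cases
    case 1
    then obtain s where "rotate s y \<in> scheme_cycles" using fat_scheme[OF assms(1) y] r by (auto simp: y_def)
    then show ?thesis by (auto simp: y_def rotate_rotate)
  next
    case 2
    \<comment> \<open>The orientation points the wrong way, so the cycle is read backwards. The
      first three vertices of \<open>y\<close> are then the last three, and the rotation brings them
      to the front.\<close>
    let ?z = "rotate (2 * k - 3) (rev y)"
    have rz: "cyc (rev y)" using cyc_rev[OF y] .
    have ly: "length y = 2 * k" using y by (rule cyc_length)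
    have "?z ! 0 = rev y ! (2 * k - 3)" "?z ! 1 = rev y ! (2 * k - 2)" "?z ! 2 = rev y ! (2 * k - 1)"
    proof -
      have "2 * k - 3 + 1 = 2 * k - 2" "2 * k - 3 + 2 = 2 * k - 1" using assms(1) by simp_all
      then show "?z ! 0 = rev y ! (2 * k - 3)" "?z ! 1 = rev y ! (2 * k - 2)" "?z ! 2 = rev y ! (2 * k - 1)"
        using nth_rotate_cyc[OF rz, of 0 "2 * k - 3"] nth_rotate_cyc[OF rz, of 1 "2 * k - 3"]
          nth_rotate_cyc[OF rz, of 2 "2 * k - 3"] assms(1) by simp_all
    qed
    moreover have "rev y ! (2 * k - 3) = y ! 2" "rev y ! (2 * k - 2) = y ! 1" "rev y ! (2 * k - 1) = y ! 0"
      using assms(1) ly by (auto simp: rev_nth Suc_diff_Suc numeral_eq_Suc intro!: arg_cong[of _ _ "nth y"])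
    ultimately have z: "?z ! 0 = y ! 2" "?z ! 1 = y ! 1" "?z ! 2 = y ! 0" by simp_all
    have "fat K (?z ! 0) (?z ! 2)" using r fat_sym unfolding z by (simp add: y_def)
    moreover have "?z ! 2 \<in> succs (?z ! 1) (?z ! 0)" using 2 unfolding z .
    ultimately obtain s where "rotate s ?z \<in> scheme_cycles"
      using fat_scheme[OF assms(1) cyc_rotate[OF rz]] by blast
    then have "rotate (s + (2 * k - 3)) (rev (rotate r xs)) \<in> scheme_cycles"
      by (simp add: y_def rotate_rotate)
    then show ?thesis by blast
  qed
qed

text \<open>A cycle is recovered from its normal form by a rotation, or by a rotation, a reversal
  and another rotation.\<close>

lemma card_cyc_le:
  assumes "k \<ge> 3"
  shows "card {xs. cyc xs} \<le> 2 * (2 * k + 1) ^ 3 * C4 * n ^ (k - 1)"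
proof -
  let ?S = scheme_cycles and ?R = "{..2 * k}"
  let ?A = "(\<lambda>(a, ys). rotate a ys) ` (?R \<times> ?S)"
  let ?B = "(\<lambda>(a, b, ys). rotate b (rev (rotate a ys))) ` (?R \<times> ?R \<times> ?S)"
  have "{xs. cyc xs} \<subseteq> ?A \<union> ?B"
  proof
    fix xs assume "xs \<in> {xs. cyc xs}"
    then have c: "cyc xs" by simp
    from scheme_exists[OF assms this] show "xs \<in> ?A \<union> ?B"
    proof (elim disjE exE)
      fix r assume r: "rotate r xs \<in> ?S"
      obtain a where "a \<le> length xs" "rotate a (rotate r xs) = xs" using rotate_inverse by blast
      then show ?thesis using r cyc_length[OF c] by (intro UnI1 image_eqI[of _ _ "(a, rotate r xs)"]) auto
    next
      fix r s assume rs: "rotate s (rev (rotate r xs)) \<in> ?S"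
      obtain a where a: "a \<le> length xs" "rotate a (rotate s (rev (rotate r xs))) = rev (rotate r xs)"
        using rotate_inverse[of "rev (rotate r xs)" s] by auto
      obtain b where b: "b \<le> length xs" "rotate b (rotate r xs) = xs" using rotate_inverse by blast
      have "rotate b (rev (rotate a (rotate s (rev (rotate r xs))))) = xs" unfolding a(2) using b(2) by simp
      then show ?thesis using rs a(1) b(1) cyc_length[OF c]
        by (intro UnI2 image_eqI[of _ _ "(a, b, rotate s (rev (rotate r xs)))"]) auto
    qed
  qed
  moreover have fin: "finite ?S" by (rule card_scheme_cycles(1)[OF assms])
  ultimately have "card {xs. cyc xs} \<le> card (?A \<union> ?B)" by (intro card_mono) auto
  also have "\<dots> \<le> card ?A + card ?B" by (rule card_Un_le)
  also have "\<dots> \<le> card (?R \<times> ?S) + card (?R \<times> ?R \<times> ?S)"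
    using fin by (intro add_mono card_image_le) auto
  also have "\<dots> = ((2 * k + 1) + (2 * k + 1) * (2 * k + 1)) * card ?S"
    by (simp add: card_cartesian_product algebra_simps)
  also have "\<dots> \<le> (2 * ((2 * k + 1) * (2 * k + 1))) * ((2 * k + 1) * (C4 * n ^ (k - 1)))"
    using card_scheme_cycles(2)[OF assms] by (intro mult_le_mono) auto
  also have "(2 * (s * s)) * (s * (C4 * m)) = 2 * s ^ 3 * C4 * m" for s m :: nat
    by (simp add: power3_eq_cube mult_ac)
  finally show ?thesis .
qed

text \<open>Two opposite vertices that were fat would already be a chain of \<open>k = 2\<close>
  vertices at a common neighbour. They are thus thin, and each of the other two vertices has at most
  \<open>K\<close> candidates.\<close>

lemma card_cyc_le_4:
  assumes "k = 2"
  shows "card {xs. cyc xs} \<le> K * K * n ^ 2"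
proof -
  have four: "xs = [xs ! 0, xs ! 1, xs ! 2, xs ! 3]" if "cyc xs" for xs
    using cyc_length[OF that] assms by (intro nth_equalityI) (auto simp: less_Suc_eq numeral_eq_Suc nth_Cons split: nat.splits)
  have adjs: "adj (xs ! 0) (xs ! 1)" "adj (xs ! 1) (xs ! 2)" "adj (xs ! 2) (xs ! 3)" "adj (xs ! 3) (xs ! 0)" "xs ! 0 \<noteq> xs ! 2"
    if "cyc xs" for xs
    using cyc_adj[OF that, of 0] cyc_adj[OF that, of 1] cyc_adj[OF that, of 2] cyc_adj_last[OF that] cyc_neq[OF that, of 0 2] assms
    by (auto simp: numeral_2_eq_2 numeral_3_eq_3)
  let ?S = "\<lambda>(a, c). if a \<noteq> c \<and> \<not> fat K a c then (nbrs a \<inter> nbrs c) \<times> (nbrs a \<inter> nbrs c) else {}"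
  have "card {xs. cyc xs} \<le> K * K * card (V \<times> V)"
  proof (rule card_le_fibres_image(2)[of "V \<times> V" "\<lambda>xs. (xs ! 0, xs ! 2)" _ "\<lambda>(a, c) (b, d). [a, b, c, d]" ?S])
    show "finite (V \<times> V)" using finite_V by simp
    show "(\<lambda>xs. (xs ! 0, xs ! 2)) ` {xs. cyc xs} \<subseteq> V \<times> V" using nth_in_V assms by auto
  next
    fix p :: "'a \<times> 'a"
    obtain a c where p: "p = (a, c)" by (cases p)
    show "finite (?S p) \<and> card (?S p) \<le> K * K"
      unfolding p using card_common_nbrs_thin[of a c] by (auto simp: card_cartesian_product intro!: mult_le_mono)
    show "{xs \<in> {xs. cyc xs}. (xs ! 0, xs ! 2) = p} \<subseteq> (\<lambda>(a, c) (b, d). [a, b, c, d]) p ` ?S p"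
    proof
      fix xs assume "xs \<in> {xs \<in> {xs. cyc xs}. (xs ! 0, xs ! 2) = p}"
      then have c: "cyc xs" "a = xs ! 0" "c = xs ! 2" by (auto simp: p)
      have "\<not> fat K a c"
      proof
        assume f: "fat K a c"
        show False
        proof (rule no_fat_chain[of "[a, c]" "xs ! 1"])
          show "xs ! 1 \<notin> set [a, c]" using adjs[OF c(1)] adj_irrefl c(2,3) by auto
        qed (use f adjs[OF c(1)] c assms adj_sym in auto)
      qed
      then show "xs \<in> (\<lambda>(a, c) (b, d). [a, b, c, d]) p ` ?S p"
        using adjs[OF c(1)] adj_sym c four[OF c(1)]
        by (auto simp: p mem_nbrs intro!: image_eqI[of _ _ "(xs ! 1, xs ! 3)"])
    qed
  qed
  then show ?thesis by (simp add: card_cartesian_product power2_eq_square)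
qed

end

section \<open>The upper bound\<close>

definition cycle_list :: "nat sgraph \<Rightarrow> nat list \<Rightarrow> bool" where
  "cycle_list G xs \<longleftrightarrow> distinct xs \<and> (\<forall>i<length xs. {xs ! i, xs ! (Suc i mod length xs)} \<in> edges G)"

definition cycle_of :: "nat list \<Rightarrow> nat sgraph" where
  "cycle_of xs = (set xs, {{xs ! i, xs ! (Suc i mod length xs)} | i. i < length xs})"

lemma cycle_list_verts:
  assumes "finite_simple_graph G" "cycle_list G xs"
  shows "set xs \<subseteq> verts G"
proof
  fix x assume "x \<in> set xs"
  then obtain i where "i < length xs" "x = xs ! i" by (auto simp: in_set_conv_nth)
  then have "{x, xs ! (Suc i mod length xs)} \<in> edges G" using assms(2) by (auto simp: cycle_list_def)
  then show "x \<in> verts G" using assms(1) by (auto simp: finite_simple_graph_def)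
qed

lemma copies_cycle_graph:
  assumes "finite_simple_graph G" "m \<ge> 3"
  shows "copies (cycle_graph m) G = cycle_of ` {xs. length xs = m \<and> cycle_list G xs}"
proof (intro equalityI subsetI)
  fix S assume "S \<in> copies (cycle_graph m) G"
  then have S: "verts S \<subseteq> verts G" "edges S \<subseteq> edges G" and "graph_isomorphic (cycle_graph m) S"
    by (auto simp: copies_def is_subgraph_def)
  then obtain f where f: "bij_betw f {..<m} (verts S)" "edges S = (\<lambda>e. f ` e) ` {{i, (i + 1) mod m} | i. i < m}"
    by (auto simp: graph_isomorphic_def cycle_graph_def)
  let ?xs = "map f [0..<m]"
  have nth: "?xs ! i = f i" if "i < m" for i using that by simp
  have "edges S = {f ` {i, (i + 1) mod m} | i. i < m}" unfolding f(2) by blast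
  then have e: "edges S = {{f i, f (Suc i mod m)} | i. i < m}" by simp
  have "cycle_of ?xs = S"
  proof (rule prod_eqI)
    show "fst (cycle_of ?xs) = verts S" using f(1) by (simp add: cycle_of_def bij_betw_def atLeast0LessThan)
    have "{?xs ! i, ?xs ! (Suc i mod m)} = {f i, f (Suc i mod m)}" if "i < m" for i
      using that assms(2) nth[of "Suc i mod m"] by simp
    then have "{{?xs ! i, ?xs ! (Suc i mod m)} | i. i < m} = {{f i, f (Suc i mod m)} | i. i < m}"
      by (intro Collect_cong) metis
    then show "snd (cycle_of ?xs) = edges S" unfolding e by (simp add: cycle_of_def)
  qed
  moreover have "cycle_list G ?xs"
    unfolding cycle_list_def
  proof (intro conjI allI impI)
    show "distinct ?xs" using f(1) by (simp add: distinct_map bij_betw_def atLeast0LessThan)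
    fix i assume "i < length ?xs"
    then have "{f i, f (Suc i mod m)} \<in> edges S" unfolding e by auto
    then show "{?xs ! i, ?xs ! (Suc i mod length ?xs)} \<in> edges G"
      using S(2) \<open>i < length ?xs\<close> assms(2) by auto
  qed
  ultimately show "S \<in> cycle_of ` {xs. length xs = m \<and> cycle_list G xs}" by force
next
  fix S assume "S \<in> cycle_of ` {xs. length xs = m \<and> cycle_list G xs}"
  then obtain xs where xs: "length xs = m" "distinct xs" "\<And>i. i < m \<Longrightarrow> {xs ! i, xs ! (Suc i mod m)} \<in> edges G"
      and cl: "cycle_list G xs" and S: "S = cycle_of xs" by (auto simp: cycle_list_def)
  have mod: "Suc i mod m < m" for i using assms(2) by simp
  have eS: "edges S = {{xs ! i, xs ! (Suc i mod m)} | i. i < m}" "verts S = set xs"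
    using S xs(1) by (auto simp: cycle_of_def)
  have V: "set xs \<subseteq> verts G"
    using cycle_list_verts[OF assms(1) cl] .
  have "is_subgraph S G"
    unfolding is_subgraph_def finite_simple_graph_def eS
  proof (intro conjI ballI V)
    show "finite (set xs)" by simp
    show "{{xs ! i, xs ! (Suc i mod m)} |i. i < m} \<subseteq> edges G" using xs(3) by auto
    fix e assume e: "e \<in> {{xs ! i, xs ! (Suc i mod m)} |i. i < m}"
    then show "e \<subseteq> set xs" using mod xs(1) by auto
    show "card e = 2" using e xs(3) assms(1) by (auto simp: finite_simple_graph_def)
  qed
  moreover have "graph_isomorphic (cycle_graph m) S"
    unfolding graph_isomorphic_def eS
  proof (intro exI[of _ "nth xs"] conjI)
    show "bij_betw ((!) xs) (verts (cycle_graph m)) (set xs)"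
      using bij_betw_nth[OF xs(2), of "{..<m}" "set xs"] xs(1) by (simp add: cycle_graph_def)
    have "(\<lambda>e. (!) xs ` e) ` edges (cycle_graph m) = {(!) xs ` {i, (i + 1) mod m} | i. i < m}"
      unfolding cycle_graph_def snd_conv by blast
    then show "{{xs ! i, xs ! (Suc i mod m)} |i. i < m} = (\<lambda>e. (!) xs ` e) ` edges (cycle_graph m)" by simp
  qed
  ultimately show "S \<in> copies (cycle_graph m) G" by (simp add: copies_def)
qed

lemma finite_cycle_lists:
  assumes "finite_simple_graph G"
  shows "finite {xs. length xs = m \<and> cycle_list G xs}"
proof (rule finite_subset)
  show "{xs. length xs = m \<and> cycle_list G xs} \<subseteq> {xs. set xs \<subseteq> verts G \<and> length xs = m}"
    using cycle_list_verts[OF assms] by auto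
  show "finite {xs. set xs \<subseteq> verts G \<and> length xs = m}"
    using assms finite_lists_length_eq by (auto simp: finite_simple_graph_def)
qed

text \<open>A copy comes only from lists over its own \<open>m\<close> vertices, hence from at most
  \<open>m ^ m\<close> of them. The crude factor affects only the constants of the lower
  bounds.\<close>

lemma card_cycle_lists_le_copies:
  assumes "finite_simple_graph G" "m \<ge> 3"
  shows "card {xs. length xs = m \<and> cycle_list G xs} \<le> m ^ m * card (copies (cycle_graph m) G)"
proof (rule card_le_fibres(2)[where f = cycle_of])
  show "finite (copies (cycle_graph m) G)"
    unfolding copies_cycle_graph[OF assms] using finite_cycle_lists[OF assms(1)] by simp
  show "cycle_of ` {xs. length xs = m \<and> cycle_list G xs} \<subseteq> copies (cycle_graph m) G"
    unfolding copies_cycle_graph[OF assms] by simp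
  fix S assume "S \<in> copies (cycle_graph m) G"
  then obtain ys where ys: "length ys = m" "distinct ys" "S = cycle_of ys"
    unfolding copies_cycle_graph[OF assms] by (auto simp: cycle_list_def)
  have sub: "{b \<in> {xs. length xs = m \<and> cycle_list G xs}. cycle_of b = S} \<subseteq> {xs. set xs \<subseteq> set ys \<and> length xs = m}"
    using ys(3) by (auto simp: cycle_of_def)
  have fin: "finite {xs. set xs \<subseteq> set ys \<and> length xs = m}" by (simp add: finite_lists_length_eq)
  have "card {xs. set xs \<subseteq> set ys \<and> length xs = m} = m ^ m"
    using card_lists_length_eq[of "set ys" m] distinct_card[OF ys(2)] ys(1) by simp
  then show "finite {b \<in> {xs. length xs = m \<and> cycle_list G xs}. cycle_of b = S} \<and>
      card {b \<in> {xs. length xs = m \<and> cycle_list G xs}. cycle_of b = S} \<le> m ^ m"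
    using finite_subset[OF sub fin] card_mono[OF fin sub] by simp
qed

lemma rainbow_cycle_free_graph:
  fixes G :: "nat sgraph"
  assumes G: "finite_simple_graph G" and c: "proper_edge_colouring G c"
    and free: "rainbow_free (cycle_graph (2 * k)) G c" and k: "k \<ge> 2"
  shows "rainbow_cycle_free (verts G) (\<lambda>a b. {a, b} \<in> edges G) (\<lambda>a b. c {a, b}) k"
proof -
  let ?adj = "\<lambda>a b. {a, b} \<in> edges G" and ?col = "\<lambda>a b. c {a, b}"
  have cG: "coloured_graph (verts G) ?adj ?col"
  proof
    show "finite (verts G)" using G by (simp add: finite_simple_graph_def)
    show "a \<in> verts G" if "{a, b} \<in> edges G" for a b using that G by (auto simp: finite_simple_graph_def)
    show "{b, a} \<in> edges G" if "{a, b} \<in> edges G" for a b using that by (simp add: insert_commute)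
    show "{a, a} \<notin> edges G" for a using G by (force simp: finite_simple_graph_def)
    show "c {a, b} = c {b, a}" for a b by (simp add: insert_commute)
    show "b = b'" if "{a, b} \<in> edges G" "{a, b'} \<in> edges G" "c {a, b} = c {a, b'}" for a b b'
      using c that unfolding proper_edge_colouring_def by (metis Int_insert_left_if1 doubleton_eq_iff insertI1 insert_not_empty)
  qed
  interpret coloured_graph "verts G" ?adj ?col by (rule cG)
  show ?thesis
  proof
    show "k \<ge> 2" by (rule k)
    show "\<not> rcycle xs" if len: "length xs = 2 * k" for xs
    proof
      assume r: "rcycle xs"
      then have ne: "xs \<noteq> []" and d: "distinct xs" "distinct (cols xs)" and suc: "successively ?adj xs"
        and last: "?adj (last xs) (hd xs)" "?col (last xs) (hd xs) \<notin> set (cols xs)"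
        by (auto simp: rcycle_def rpath_def)
      have lh: "last xs = xs ! (2 * k - 1)" "hd xs = xs ! 0"
        using ne len by (auto simp: last_conv_nth hd_conv_nth)
      have lc: "length (cols xs) = 2 * k - 1" by (simp add: length_cols len)
      have ends: "i = 2 * k - 1 \<and> Suc i mod (2 * k) = 0" if "i < 2 * k" "\<not> Suc i < 2 * k" for i
      proof -
        have "Suc i = 2 * k" using that by linarith
        then show ?thesis by auto
      qed
      have adj: "{xs ! i, xs ! (Suc i mod (2 * k))} \<in> edges G" if "i < 2 * k" for i
        using suc[unfolded successively_conv_nth] last(1) ends[OF that] lh len by (cases "Suc i < 2 * k") auto
      then have "cycle_list G xs" using d len by (auto simp: cycle_list_def)
      then have "cycle_of xs \<in> copies (cycle_graph (2 * k)) G"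
        using copies_cycle_graph[OF G, of "2 * k"] k len by auto
      moreover have "rainbow c (cycle_of xs)"
        unfolding rainbow_def
      proof (rule inj_onI)
        define e where "e i = {xs ! i, xs ! (Suc i mod (2 * k))}" for i
        have ce: "c (e i) = (if Suc i < 2 * k then cols xs ! i else ?col (last xs) (hd xs))" if "i < 2 * k" for i
          using ends[OF that] lh len cols_nth[of i xs] by (auto simp: e_def)
        have inj: "i = j" if "i < 2 * k" "j < 2 * k" "c (e i) = c (e j)" for i j
          using that ce[OF that(1)] ce[OF that(2)] d(2) last(2) lc ends[of i] ends[of j]
            nth_eq_iff_index_eq[OF d(2), of i j] nth_mem[of i "cols xs"] nth_mem[of j "cols xs"]
          by (cases "Suc i < 2 * k"; cases "Suc j < 2 * k") auto
        fix e1 e2 assume "e1 \<in> edges (cycle_of xs)" "e2 \<in> edges (cycle_of xs)" "c e1 = c e2"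
        then obtain i j where "i < 2 * k" "j < 2 * k" "e1 = e i" "e2 = e j" "c (e i) = c (e j)"
          by (auto simp: cycle_of_def e_def len)
        then show "e1 = e2" using inj by blast
      qed
      ultimately show False using free by (auto simp: rainbow_free_def)
    qed
  qed
qed

lemma ex_rainbow_le:
  assumes "edges F \<noteq> {}"
    and "\<And>G (c :: nat set \<Rightarrow> nat). finite_simple_graph (G :: nat sgraph) \<Longrightarrow> card (verts G) = n \<Longrightarrow> proper_edge_colouring G c \<Longrightarrow>
      rainbow_free F G c \<Longrightarrow> card (copies H G) \<le> B"
  shows "ex_rainbow n H F \<le> B"
  unfolding ex_rainbow_def
proof (rule Max.boundedI[OF finite_copy_counts copy_counts_nonempty[OF assms(1)]])
  show "x \<le> B" if "x \<in> copy_counts n H F" for x using that assms(2) unfolding copy_counts_def by blast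
qed

lemma ex_rainbow_ge:
  fixes G :: "nat sgraph" and c :: "nat set \<Rightarrow> nat"
  assumes "finite_simple_graph G" "card (verts G) = n" "proper_edge_colouring G c" "rainbow_free F G c"
  shows "card (copies H G) \<le> ex_rainbow n H F"
  unfolding ex_rainbow_def
proof (rule Max_ge[OF finite_copy_counts])
  show "card (copies H G) \<in> copy_counts n H F" unfolding copy_counts_def using assms by blast
qed

lemma ex_rainbow_upper:
  assumes "k \<ge> 2"
  shows "\<exists>C. \<forall>n. ex_rainbow n (cycle_graph (2 * k)) (cycle_graph (2 * k)) \<le> C * n ^ max 2 (k - 1)"
proof -
  let ?H = "cycle_graph (2 * k)"
  \<comment> \<open>The constants of the locale depend on \<open>k\<close> alone, so one
    \<open>C\<close> serves all graphs and all \<open>n\<close>.\<close>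
  define C where "C = (if k = 2 then rainbow_cycle_free.K k * rainbow_cycle_free.K k
     else 2 * (2 * k + 1) ^ 3 * rainbow_cycle_free.C4 k)"
  have "card (copies ?H G) \<le> C * n ^ max 2 (k - 1)"
    if G: "finite_simple_graph G" "card (verts G) = n" "proper_edge_colouring G c" "rainbow_free ?H G c"
    for G :: "nat sgraph" and c :: "nat set \<Rightarrow> nat" and n
  proof -
    interpret rainbow_cycle_free "verts G" "\<lambda>a b. {a, b} \<in> edges G" "\<lambda>a b. c {a, b}" k
      by (rule rainbow_cycle_free_graph[OF G(1,3,4) assms])
    have eq: "{xs. length xs = 2 * k \<and> cycle_list G xs} = {xs. cyc xs}"
      by (auto simp: cyc_def cycle_list_def)
    have "card (copies ?H G) \<le> card {xs. cyc xs}"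
      using copies_cycle_graph[OF G(1), of "2 * k"] assms finite_cyc unfolding eq by (simp add: card_image_le)
    also have "\<dots> \<le> C * n ^ max 2 (k - 1)"
    proof (cases "k = 2")
      case True
      then show ?thesis using card_cyc_le_4 G(2) by (simp add: C_def power2_eq_square)
    next
      case False
      then show ?thesis using card_cyc_le G(2) assms by (simp add: C_def max_def)
    qed
    finally show ?thesis .
  qed
  moreover have "edges ?H \<noteq> {}" using cycle_graph_simple(2)[of "2 * k"] assms by simp
  ultimately have "ex_rainbow n ?H ?H \<le> C * n ^ max 2 (k - 1)" for n by (rule ex_rainbow_le[rotated])
  then show ?thesis by blast
qed

section \<open>The lower bound for longer cycles\<close>

lemma cycle_edges_distinct:
  assumes "distinct xs" "length xs = m" "m \<ge> 3" "i < m" "j < m" "i \<noteq> j"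
  shows "{xs ! i, xs ! (Suc i mod m)} \<noteq> {xs ! j, xs ! (Suc j mod m)}"
proof
  assume "{xs ! i, xs ! (Suc i mod m)} = {xs ! j, xs ! (Suc j mod m)}"
  moreover have "xs ! a = xs ! b \<longleftrightarrow> a = b" if "a < m" "b < m" for a b
    using that assms(1,2) nth_eq_iff_index_eq by blast
  ultimately have *: "i = Suc j mod m" "j = Suc i mod m"
    using assms(3-6) by (auto simp: doubleton_eq_iff)
  show False
  proof (cases "Suc j = m")
    case True
    then have "i = 0" using *(1) by simp
    then have "j = 1" using *(2) assms(3) by simp
    then show False using True assms(3) by simp
  next
    case False
    then have i: "i = Suc j" using *(1) assms(5) by simp
    have "Suc i \<noteq> m"
    proof
      assume "Suc i = m"
      then have "j = 0" using *(2) by simp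
      then show False using i \<open>Suc i = m\<close> assms(3) by simp
    qed
    then have "j = Suc i" using *(2) assms(4) by simp
    then show False using i by simp
  qed
qed

text \<open>Otherwise \<open>P\<close> would stay constant on the way from the successor of
  \<open>i\<close> round to \<open>i\<close>.\<close>

lemma cyclic_change_twice:
  fixes P :: "nat \<Rightarrow> bool"
  assumes "i < m" "P i \<noteq> P (Suc i mod m)"
  shows "\<exists>j<m. j \<noteq> i \<and> P j \<noteq> P (Suc j mod m)"
proof (rule ccontr)
  assume *: "\<not> ?thesis"
  have m: "m > 0" using assms(1) by simp
  have "P ((Suc i + j) mod m) = P (Suc i mod m)" if "j < m" for j
    using that
  proof (induction j)
    case (Suc j)
    have "(Suc i + j) mod m \<noteq> i"
    proof
      assume *: "(Suc i + j) mod m = i"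
      show False
      proof (cases "Suc i + j < m")
        case True
        then show False using * by simp
      next
        case False
        then have "(Suc i + j) mod m = Suc i + j - m"
          using assms(1) Suc.prems by (simp add: le_mod_geq)
        then show False using * False Suc.prems by simp
      qed
    qed
    moreover have "(Suc i + j) mod m < m" using m by simp
    ultimately have "P ((Suc i + j) mod m) = P (Suc ((Suc i + j) mod m) mod m)"
      using * by blast
    also have "Suc ((Suc i + j) mod m) mod m = (Suc i + Suc j) mod m" by (simp add: mod_simps)
    finally show ?case using Suc by simp
  qed simp
  from this[of "m - 1"] have "P ((Suc i + (m - 1)) mod m) = P (Suc i mod m)" using m by simp
  moreover have "Suc i + (m - 1) = i + m" using m by simp
  ultimately show False using assms by simp
qed

section \<open>Two hub graphs joined by two edges of one colour\<close>

locale hub_graph =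
  fixes k n :: nat
  assumes k: "k \<ge> 3" and n: "n \<ge> 3 * k"
begin

text \<open>Leaves are sorted by residue modulo \<open>k - 1\<close>: residue 0 belongs to the hubs
  0 and 1, the other \<open>k - 2\<close> residues to the hubs from 2 to \<open>k\<close>. Each of
  the \<open>k - 1\<close> leaf positions of the cycles below draws from its own residue class, so
  the choices are independent and the leaves automatically distinct.\<close>

definition leafA :: "nat \<Rightarrow> bool" where "leafA v \<longleftrightarrow> k < v \<and> (v - (k + 1)) mod (k - 1) = 0"
definition leafB :: "nat \<Rightarrow> bool" where "leafB v \<longleftrightarrow> k < v \<and> (v - (k + 1)) mod (k - 1) \<noteq> 0"

definition E :: "nat set set" where
  "E = {{a, v} | a v. a \<le> 1 \<and> leafA v \<and> v < n} \<union> {{b, v} | b v. 2 \<le> b \<and> b \<le> k \<and> leafB v \<and> v < n}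
     \<union> {{0, k}, {1, 2}}"

definition G :: "nat sgraph" where "G = ({..<n}, E)"

text \<open>\<open>set_encode\<close> gives every edge its own colour. The only coincidence is
  between the disjoint edges \<open>{1, 2}\<close> and \<open>{0, k}\<close>, so properness is
  kept.\<close>

definition colouring :: "nat set \<Rightarrow> nat" where
  "colouring e = (if e = {1, 2} then set_encode {0, k} else set_encode e)"

lemma simple: "finite_simple_graph G"
  unfolding finite_simple_graph_def G_def E_def using k n by (auto simp: leafA_def leafB_def card_insert_if)

lemma card_vertices: "card (verts G) = n" by (simp add: G_def)

lemma set_encode_eq: "finite A \<Longrightarrow> finite B \<Longrightarrow> set_encode A = set_encode B \<longleftrightarrow> A = B"
  by (metis set_encode_inverse)

lemma finite_edge: "e \<in> E \<Longrightarrow> finite e" by (auto simp: E_def)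

lemma proper: "proper_edge_colouring G colouring"
  unfolding proper_edge_colouring_def
proof (intro ballI impI)
  fix e e' assume e: "e \<in> edges G" "e' \<in> edges G" "e \<noteq> e' \<and> e \<inter> e' \<noteq> {}"
  have "{0, k} \<inter> {1, 2} = ({} :: nat set)" using k by auto
  then show "colouring e \<noteq> colouring e'"
    using e finite_edge[of e] finite_edge[of e'] by (auto simp: colouring_def set_encode_eq G_def)
qed

definition side :: "nat \<Rightarrow> bool" where "side v \<longleftrightarrow> v \<le> 1 \<or> leafA v"

lemma side_change: "{u, v} \<in> E \<Longrightarrow> side u \<noteq> side v \<Longrightarrow> {u, v} \<in> {{0, k}, {1, 2}}"
  using k by (auto simp: E_def side_def leafA_def leafB_def doubleton_eq_iff)

lemma hub_alternate: "{u, v} \<in> E \<Longrightarrow> side u = side v \<Longrightarrow> (u \<le> k) \<noteq> (v \<le> k)"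
  using k by (auto simp: E_def side_def leafA_def leafB_def doubleton_eq_iff)

text \<open>A cycle inside one side would alternate between hubs and leaves and need
  \<open>k\<close> hubs, but the sides have 2 and \<open>k - 1\<close>. A cycle that changes side
  does so at least twice, hence uses both joining edges, which have the same colour.\<close>

lemma not_rainbow:
  assumes "length xs = 2 * k" "cycle_list G xs"
  shows "\<not> inj_on colouring (edges (cycle_of xs))"
proof -
  let ?m = "2 * k"
  let ?e = "\<lambda>i. {xs ! i, xs ! (Suc i mod ?m)}"
  have d: "distinct xs" and e: "\<And>i. i < ?m \<Longrightarrow> ?e i \<in> E"
    using assms by (auto simp: cycle_list_def G_def)
  have "\<exists>i<?m. side (xs ! i) \<noteq> side (xs ! (Suc i mod ?m))"
  proof (rule ccontr)
    assume "\<not> ?thesis"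
    then have same: "side (xs ! i) = side (xs ! (Suc i mod ?m))" if "i < ?m" for i using that by blast
    have same0: "side (xs ! i) = side (xs ! 0)" if "i < ?m" for i
      using that
    proof (induction i)
      case (Suc i)
      then show ?case using same[of i] by simp
    qed simp
    have alt: "(xs ! Suc i \<le> k) = (\<not> xs ! i \<le> k)" if "Suc i < ?m" for i
      using hub_alternate[OF e[of i]] same[of i] that by auto
    define p where "p = (if xs ! 0 \<le> k then 0 else 1 :: nat)"
    have hub: "xs ! (2 * j + p) \<le> k" if "j < k" for j
      using that
    proof (induction j)
      case 0
      then show ?case using alt[of 0] k by (auto simp: p_def)
    next
      case (Suc j)
      have "Suc (Suc (2 * j + p)) < ?m" using Suc.prems by (auto simp: p_def)
      then show ?case using alt[of "2 * j + p"] alt[of "Suc (2 * j + p)"] Suc by simp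
    qed
    have inj: "inj_on (\<lambda>j. xs ! (2 * j + p)) {..<k}"
    proof (rule inj_onI)
      fix i j assume *: "i \<in> {..<k}" "j \<in> {..<k}" "xs ! (2 * i + p) = xs ! (2 * j + p)"
      then have "2 * i + p < ?m" "2 * j + p < ?m" by (auto simp: p_def)
      then have "2 * i + p = 2 * j + p" using * d assms(1) nth_eq_iff_index_eq by metis
      then show "i = j" by simp
    qed
    define Xs where "Xs = (if side (xs ! 0) then {0, 1} else {2..k})"
    have "(\<lambda>j. xs ! (2 * j + p)) ` {..<k} \<subseteq> Xs"
    proof
      fix v assume "v \<in> (\<lambda>j. xs ! (2 * j + p)) ` {..<k}"
      then obtain j where j: "j < k" "v = xs ! (2 * j + p)" by auto
      have "2 * j + p < ?m" using j by (auto simp: p_def)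
      then have "side v = side (xs ! 0)" "v \<le> k" using j(2) hub[OF j(1)] same0[of "2 * j + p"] by simp_all
      then show "v \<in> Xs" by (auto simp: Xs_def side_def leafA_def split: if_splits)
    qed
    then have "k \<le> card Xs" using card_inj_on_le[OF inj, of Xs] by (simp add: Xs_def)
    then show False using k by (auto simp: Xs_def split: if_splits)
  qed
  then obtain i where i: "i < ?m" "side (xs ! i) \<noteq> side (xs ! (Suc i mod ?m))" by blast
  then obtain j where j: "j < ?m" "j \<noteq> i" "side (xs ! j) \<noteq> side (xs ! (Suc j mod ?m))"
    using cyclic_change_twice[of i ?m "\<lambda>i. side (xs ! i)"] by blast
  have "?e i \<in> {{0, k}, {1, 2}}" "?e j \<in> {{0, k}, {1, 2}}"
    using side_change[OF e[OF i(1)] i(2)] side_change[OF e[OF j(1)] j(3)] by auto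
  moreover have ne: "?e i \<noteq> ?e j"
    using cycle_edges_distinct[OF d assms(1) _ i(1) j(1)] j(2) k by auto
  moreover have "colouring e = set_encode {0, k}" if "e \<in> {{0, k}, {1, 2}}" for e
    using that by (auto simp: colouring_def)
  ultimately have "colouring (?e i) = colouring (?e j)" by metis
  moreover have "?e i \<in> edges (cycle_of xs)" "?e j \<in> edges (cycle_of xs)"
    using i(1) j(1) assms(1) by (auto simp: cycle_of_def)
  ultimately show ?thesis using ne by (auto dest: inj_onD)
qed

lemma free: "rainbow_free (cycle_graph (2 * k)) G colouring"
proof -
  have "copies (cycle_graph (2 * k)) G = cycle_of ` {xs. length xs = 2 * k \<and> cycle_list G xs}"
    using copies_cycle_graph[OF simple, of "2 * k"] k by simp
  then show ?thesis unfolding rainbow_free_def rainbow_def using not_rainbow by auto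
qed

definition m where "m = (n - (k + 1)) div (k - 1)"

definition leaf :: "nat \<Rightarrow> nat \<Rightarrow> nat" where "leaf i j = k + 1 + (i + (k - 1) * j)"

lemma leaf_mod: "i < k - 1 \<Longrightarrow> (leaf i j - (k + 1)) mod (k - 1) = i"
  by (simp add: leaf_def)

lemma leaf_inj: "i < k - 1 \<Longrightarrow> i' < k - 1 \<Longrightarrow> leaf i j = leaf i' j' \<longleftrightarrow> i = i' \<and> j = j'"
proof -
  assume i: "i < k - 1" "i' < k - 1"
  have "i = i' \<and> j = j'" if eq: "leaf i j = leaf i' j'"
  proof -
    have "i = i'" using leaf_mod[OF i(1), of j] leaf_mod[OF i(2), of j'] eq by simp
    moreover from this have "(k - 1) * j = (k - 1) * j'" using eq by (simp add: leaf_def)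
    moreover have "k - 1 \<noteq> 0" using k by simp
    ultimately show ?thesis by (metis mult_left_cancel)
  qed
  then show ?thesis by auto
qed

lemma leaf_gt: "k < leaf i j" by (simp add: leaf_def)

lemma leaf_less:
  assumes "i < k - 1" "j < m" shows "leaf i j < n"
proof -
  have "i + (k - 1) * j < (k - 1) * Suc j" using assms(1) by simp
  also have "\<dots> \<le> (k - 1) * m" using assms(2) by (intro mult_le_mono2) auto
  also have "\<dots> \<le> n - (k + 1)" by (simp add: m_def)
  finally show ?thesis by (simp add: leaf_def)
qed

text \<open>The cycle reads 0, leaf, 1, 2, leaf, 3, leaf, and so on up to \<open>k\<close>: hubs
  from 2 on sit at odd positions, and \<open>w i\<close> selects the leaf of residue
  \<open>i\<close>. The joining edges start at positions 2 and \<open>2 * k - 1\<close>.\<close>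

definition vertex :: "(nat \<Rightarrow> nat) \<Rightarrow> nat \<Rightarrow> nat" where
  "vertex w p = (if p = 0 then 0 else if p = 2 then 1 else if odd p \<and> p \<noteq> 1 then (p + 1) div 2
     else if p = 1 then leaf 0 (w 0) else leaf (p div 2 - 1) (w (p div 2 - 1)))"

lemma vertex_cases:
  assumes "p < 2 * k"
  obtains "p = 0" "\<And>w. vertex w p = 0" | "p = 2" "\<And>w. vertex w p = 1"
  | h where "p = 2 * h - 1" "2 \<le> h" "h \<le> k" "\<And>w. vertex w p = h"
  | "p = 1" "\<And>w. vertex w p = leaf 0 (w 0)"
  | i where "p = 2 * i + 2" "1 \<le> i" "i < k - 1" "\<And>w. vertex w p = leaf i (w i)"
proof -
  consider "p = 0" | "p = 2" | "odd p" "p \<noteq> 1" | "p = 1" | "even p" "p \<noteq> 0" "p \<noteq> 2" by blast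
  then show thesis
  proof cases
    case 3
    then obtain h where "p = 2 * h + 1" by (elim oddE)
    then show thesis using 3 assms by (intro that(3)[of "h + 1"]) (auto simp: vertex_def)
  next
    case 5
    then obtain h where "p = 2 * h" by (elim evenE)
    then show thesis using 5 assms by (intro that(5)[of "h - 1"]) (auto simp: vertex_def)
  qed (use that in \<open>auto simp: vertex_def\<close>)
qed

text \<open>A common left inverse of all \<open>vertex w\<close>, from which the distinctness of the
  vertices on the cycle follows.\<close>

definition position :: "nat \<Rightarrow> nat" where
  "position v = (if v = 0 then 0 else if v = 1 then 2 else if v \<le> k then 2 * v - 1
     else if (v - (k + 1)) mod (k - 1) = 0 then 1 else 2 * ((v - (k + 1)) mod (k - 1)) + 2)"

lemma position_leaf: "i < k - 1 \<Longrightarrow> position (leaf i j) = (if i = 0 then 1 else 2 * i + 2)"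
  using leaf_mod[of i j] leaf_gt[of i j] k unfolding position_def by auto

lemma position_vertex:
  assumes "p < 2 * k" shows "position (vertex w p) = p"
  using assms
proof (cases p rule: vertex_cases)
  case 4
  then show ?thesis using position_leaf[of 0 "w 0"] k by simp
next
  case (5 i)
  then show ?thesis using position_leaf[of i "w i"] by simp
qed (use k in \<open>auto simp: position_def\<close>)

lemma vertex_inj: "p < 2 * k \<Longrightarrow> q < 2 * k \<Longrightarrow> vertex w p = vertex w q \<Longrightarrow> p = q"
  using position_vertex by metis

definition walk :: "(nat \<Rightarrow> nat) \<Rightarrow> nat list" where "walk w = map (vertex w) [0..<2 * k]"

lemma cycle_walk:
  assumes "w \<in> {..<k - 1} \<rightarrow> {..<m}"
  shows "cycle_list G (walk w)"
  unfolding cycle_list_def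
proof (intro conjI allI impI)
  show "distinct (walk w)" using vertex_inj by (auto simp: walk_def distinct_map inj_on_def)
  fix p assume "p < length (walk w)"
  then have p: "p < 2 * k" by (simp add: walk_def)
  have wm: "w i < m" if "i < k - 1" for i using assms that by auto
  have lA: "leafA (leaf 0 (w 0))" "leaf 0 (w 0) < n"
    using leaf_mod[of 0 "w 0"] leaf_gt[of 0 "w 0"] leaf_less[of 0 "w 0"] k wm[of 0] by (auto simp: leafA_def)
  have lB: "leafB (leaf i (w i))" "leaf i (w i) < n" if "1 \<le> i" "i < k - 1" for i
    using leaf_mod[of i "w i"] leaf_gt[of i "w i"] leaf_less[of i "w i"] wm[of i] that by (auto simp: leafB_def)
  have "{vertex w p, vertex w (Suc p mod (2 * k))} \<in> E"
    using p
  proof (cases p rule: vertex_cases)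
    case 1
    then have "{vertex w p, vertex w (Suc p mod (2 * k))} = {0, leaf 0 (w 0)}" using k by (simp add: vertex_def)
    then show ?thesis using lA unfolding E_def by blast
  next
    case 2
    then have "{vertex w p, vertex w (Suc p mod (2 * k))} = {1, 2}" using k by (simp add: vertex_def)
    then show ?thesis unfolding E_def by blast
  next
    case (3 h)
    show ?thesis
    proof (cases "h = k")
      case True
      then have "Suc p mod (2 * k) = 0" using 3 by auto
      then have "{vertex w p, vertex w (Suc p mod (2 * k))} = {0, k}" using 3 True by (auto simp: vertex_def)
      then show ?thesis unfolding E_def by blast
    next
      case False
      then have "Suc p mod (2 * k) = 2 * h" using 3 by auto
      then have "vertex w (Suc p mod (2 * k)) = leaf (h - 1) (w (h - 1))" using 3 by (auto simp: vertex_def)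
      then have eq: "{vertex w p, vertex w (Suc p mod (2 * k))} = {h, leaf (h - 1) (w (h - 1))}" using 3 by simp
      have "1 \<le> h - 1" "h - 1 < k - 1" using 3 False by auto
      then show ?thesis using 3 lB[of "h - 1"] unfolding eq E_def by blast
    qed
  next
    case 4
    then have "{vertex w p, vertex w (Suc p mod (2 * k))} = {1, leaf 0 (w 0)}" using k by (simp add: vertex_def insert_commute)
    then show ?thesis using lA unfolding E_def by blast
  next
    case (5 i)
    then have "Suc p mod (2 * k) = 2 * i + 3" by auto
    then have "vertex w (Suc p mod (2 * k)) = i + 2" by (simp add: vertex_def)
    then have "{vertex w p, vertex w (Suc p mod (2 * k))} = {i + 2, leaf i (w i)}" using 5 by (simp add: insert_commute)
    moreover have "2 \<le> i + 2" "i + 2 \<le> k" using 5 by auto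
    ultimately show ?thesis using lB[of i] 5 unfolding E_def by blast
  qed
  then show "{walk w ! p, walk w ! (Suc p mod length (walk w))} \<in> edges G"
    using p by (simp add: walk_def G_def)
qed

lemma walk_inj: "inj_on walk ({..<k - 1} \<rightarrow>\<^sub>E {..<m})"
proof (rule inj_onI)
  fix w w' assume w: "w \<in> {..<k - 1} \<rightarrow>\<^sub>E {..<m}" "w' \<in> {..<k - 1} \<rightarrow>\<^sub>E {..<m}" "walk w = walk w'"
  have v: "vertex w p = vertex w' p" if "p < 2 * k" for p
    using arg_cong[OF w(3), of "\<lambda>x. x ! p"] that by (simp add: walk_def)
  show "w = w'"
  proof (rule PiE_ext[OF w(1,2)])
    fix i assume "i \<in> {..<k - 1}"
    then have i: "i < k - 1" by simp
    show "w i = w' i"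
    proof (cases "i = 0")
      case True
      then show ?thesis using v[of 1] k leaf_inj[of 0 0 "w 0" "w' 0"] by (simp add: vertex_def)
    next
      case False
      then show ?thesis using v[of "2 * i + 2"] i leaf_inj[of i i "w i" "w' i"] by (simp add: vertex_def)
    qed
  qed
qed

text \<open>The assumption on \<open>n\<close> gives \<open>m\<close> at least 2, which absorbs the
  hubs and the rounding into the factor \<open>2 * k\<close>.\<close>

lemma n_le: "n \<le> 2 * k * m"
proof -
  have "n - (k + 1) < (k - 1) * Suc m"
    unfolding m_def mult_Suc_right using k by (intro dividend_less_times_div) simp
  moreover have "m \<ge> 2"
  proof -
    have "2 * (k - 1) \<le> n - (k + 1)" using n k by simp
    then show ?thesis unfolding m_def using k by (simp add: less_eq_div_iff_mult_less_eq)
  qed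
  then have "(k - 1) * m + (k + 1) * 2 \<le> (k - 1) * m + (k + 1) * m" by (intro add_left_mono mult_le_mono2)
  moreover have "(k - 1) + (k + 1) = 2 * k" using k by simp
  then have "(k - 1) * m + (k + 1) * m = 2 * k * m" by (metis add_mult_distrib)
  ultimately show ?thesis using k by simp
qed

lemma power_le_ex_rainbow:
  "n ^ (k - 1) \<le> (2 * k) ^ (k - 1) * (2 * k) ^ (2 * k) * ex_rainbow n (cycle_graph (2 * k)) (cycle_graph (2 * k))"
proof -
  have "m ^ (k - 1) = card ({..<k - 1} \<rightarrow>\<^sub>E {..<m})" by (simp add: card_PiE)
  also have "\<dots> \<le> card {xs. length xs = 2 * k \<and> cycle_list G xs}"
  proof (rule card_inj_on_le[OF walk_inj])
    show "walk ` ({..<k - 1} \<rightarrow>\<^sub>E {..<m}) \<subseteq> {xs. length xs = 2 * k \<and> cycle_list G xs}"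
      using cycle_walk by (auto simp: walk_def PiE_def)
    show "finite {xs. length xs = 2 * k \<and> cycle_list G xs}" by (rule finite_cycle_lists[OF simple])
  qed
  also have "\<dots> \<le> (2 * k) ^ (2 * k) * card (copies (cycle_graph (2 * k)) G)"
    using card_cycle_lists_le_copies[OF simple, of "2 * k"] k by simp
  also have "\<dots> \<le> (2 * k) ^ (2 * k) * ex_rainbow n (cycle_graph (2 * k)) (cycle_graph (2 * k))"
    by (intro mult_le_mono2 ex_rainbow_ge[OF simple card_vertices proper free])
  finally have A: "(2 * k) ^ (k - 1) * m ^ (k - 1) \<le> (2 * k) ^ (k - 1) * ((2 * k) ^ (2 * k) * ex_rainbow n (cycle_graph (2 * k)) (cycle_graph (2 * k)))"
    by (rule mult_le_mono2)
  have "n ^ (k - 1) \<le> (2 * k) ^ (k - 1) * m ^ (k - 1)"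
    using power_mono[OF n_le, of "k - 1"] by (simp add: power_mult_distrib)
  from order_trans[OF this A] show ?thesis by (simp only: mult.assoc)
qed

end

section \<open>The lower bound for four-cycles\<close>

text \<open>With q = \<open>2 ^ e\<close>, the polynomial X^q - X splits in the algebraic closure
  and has derivative \<open>- 1\<close>, since q vanishes in characteristic two. Its roots are
  therefore simple and there are q of them; they form the field with q elements.\<close>

lemma card_frobenius_fixed:
  assumes "e \<ge> 1"
  shows "finite {x :: bit alg_closure. x ^ (2 ^ e) = x}" "card {x :: bit alg_closure. x ^ (2 ^ e) = x} = 2 ^ e"
proof -
  let ?q = "2 ^ e :: nat"
  define p :: "bit alg_closure poly" where "p = monom 1 ?q - monom 1 1"
  have two: "(2 :: bit alg_closure) = 0"
    by (metis bit_2_eq_0 to_ac_0 to_ac_numeral)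
  have q: "?q \<ge> 2" using assms by (metis power_increasing power_one_right one_le_numeral)
  have "coeff p ?q = 1" using q by (simp add: p_def)
  then have p0: "p \<noteq> 0" by auto
  have "degree p \<le> ?q" unfolding p_def using q by (intro degree_diff_le) (auto simp: degree_monom_eq)
  moreover have "degree p \<ge> ?q" using \<open>coeff p ?q = 1\<close> by (intro le_degree) simp
  ultimately have deg: "degree p = ?q" by simp
  obtain A where A: "size A = degree p" "p = smult (lead_coeff p) (\<Prod>x\<in>#A. [:-x, 1:])"
    using alg_closed_imp_factorization[OF p0] by blast
  have "proots (\<Prod>x\<in>#B. [:-x, 1:]) = B" for B :: "bit alg_closure multiset"
  proof (induction B)
    case (add x B)
    have "(\<Prod>x\<in>#B. [:-x, 1:]) \<noteq> 0" by (auto simp: prod_mset_zero_iff)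
    then show ?case using add by (simp add: proots_mult del: mult_pCons_left)
  qed simp
  then have "proots p = A" using A(2) p0 by (metis leading_coeff_0_iff proots_smult)
  then have size: "size (proots p) = ?q" using A(1) deg by simp
  have "of_nat ?q = (0 :: bit alg_closure)" using two assms by (simp add: power_0_left)
  then have "pderiv p = - 1"
    unfolding p_def by (simp add: pderiv_diff pderiv_monom flip: one_pCons)
  then have simple_root: "order x p = 1" if "poly p x = 0" for x
  proof -
    have "order x p \<noteq> 0" using that p0 order_root by blast
    moreover have "\<not> order x p \<ge> 2"
    proof
      assume "order x p \<ge> 2"
      then have "[:-x, 1:] ^ 2 dvd p" using order_1[of x p] power_le_dvd by blast
      then obtain r where "p = [:-x, 1:] * ([:-x, 1:] * r)"
        by (elim dvdE) (simp only: power2_eq_square mult.assoc)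
      then have "poly (pderiv p) x = 0" by (simp only: pderiv_mult poly_add poly_mult) simp
      then show False using \<open>pderiv p = - 1\<close> by simp
    qed
    ultimately show ?thesis by linarith
  qed
  have "size (proots p) = card {x. poly p x = 0}"
    unfolding size_multiset_overloaded_eq using p0 simple_root by simp
  moreover have "{x. poly p x = 0} = {x. x ^ ?q = x}" by (simp add: p_def poly_monom)
  ultimately show "card {x :: bit alg_closure. x ^ (2 ^ e) = x} = 2 ^ e" using size by simp
  then show "finite {x :: bit alg_closure. x ^ (2 ^ e) = x}" by (metis card.infinite power_not_zero zero_neq_numeral)
qed

lemma add_frobenius_fixed:
  fixes x y :: "bit alg_closure"
  assumes "x ^ (2 ^ e) = x" "y ^ (2 ^ e) = y"
  shows "(x + y) ^ (2 ^ e) = x + y"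
proof -
  have "of_nat 2 = (0 :: bit)" by simp
  then have "CHAR(bit) dvd 2" using of_nat_eq_0_iff_char_dvd by blast
  moreover have "CHAR(bit) \<noteq> 1" using CHAR_not_1'[where ?'a = bit] by simp
  ultimately have "CHAR(bit) = 2" using two_is_prime_nat prime_nat_iff by blast
  then have "CHAR(bit alg_closure) = 2" by simp
  then show ?thesis using freshmans_dream'[where ?'a = "bit alg_closure", of "2 ^ e" e x y] assms by simp
qed

text \<open>In the application \<open>F\<close> is a finite field inside its algebraic closure, so
  no type of \<open>2 ^ e\<close> elements has to be built. The bounds on \<open>n\<close> make
  \<open>F \<times> F\<close> more than a quarter of the vertices; the remaining ones are
  isolated.\<close>

locale char_2_set =
  fixes F :: "'f :: field set" and n :: nat
  assumes fin: "finite F" and two: "(2 :: 'f) = 0" and zero: "0 \<in> F"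
    and add: "x \<in> F \<Longrightarrow> y \<in> F \<Longrightarrow> x + y \<in> F" and mult: "x \<in> F \<Longrightarrow> y \<in> F \<Longrightarrow> x * y \<in> F"
    and card_F: "card F \<ge> 4" "card F * card F \<le> n" "n < 4 * (card F * card F)"
begin

lemma double: "x + x = (0 :: 'f)"
  using two by (metis mult_2 mult_zero_left)

lemma double_left: "x + (x + y) = (y :: 'f)"
  using double by (metis add.assoc add_0)

lemma add_eq_0: "x + y = 0 \<longleftrightarrow> x = (y :: 'f)"
  using double double_left by (metis add_0_right)

lemma cube: "x \<in> F \<Longrightarrow> x ^ 3 \<in> F"
  using mult by (simp add: power3_eq_cube)

definition code :: "'f \<times> 'f \<Rightarrow> nat" where "code = to_nat_on (F \<times> F)"
definition decode :: "nat \<Rightarrow> 'f \<times> 'f" where "decode = from_nat_into (F \<times> F)"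

lemma decode_code: "p \<in> F \<times> F \<Longrightarrow> decode (code p) = p"
  unfolding code_def decode_def using fin by (intro from_nat_into_to_nat_on) (auto intro: countable_finite)

lemma code_less:
  assumes "p \<in> F \<times> F" shows "code p < n"
proof -
  have "code p \<in> {..<card (F \<times> F)}"
    unfolding code_def using bij_betw_apply[OF to_nat_on_finite assms] fin by simp
  then show ?thesis using card_F(2) by (simp add: card_cartesian_product)
qed

text \<open>The pairs \<open>(a, a ^ 3)\<close> are the columns of a parity check matrix of the
  double-error-correcting BCH code. In characteristic two each step is its own inverse, so the
  Cayley graph is undirected.\<close>

definition step :: "'f \<Rightarrow> 'f \<times> 'f \<Rightarrow> 'f \<times> 'f" where "step a p = (fst p + a, snd p + a ^ 3)"

lemma step_in: "a \<in> F \<Longrightarrow> p \<in> F \<times> F \<Longrightarrow> step a p \<in> F \<times> F"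
  using add cube by (auto simp: step_def)

definition G :: "nat sgraph" where
  "G = ({..<n}, {{code p, code (step a p)} | a p. a \<in> F \<and> a \<noteq> 0 \<and> p \<in> F \<times> F})"

text \<open>In characteristic two the first coordinates of the two ends sum to the direction
  \<open>a\<close> of the edge, so the colour can be read off the unordered edge.\<close>

definition colouring :: "nat set \<Rightarrow> nat" where
  "colouring e = to_nat_on F (\<Sum>v\<in>e. fst (decode v))"

lemma edge_iff: "{u, v} \<in> edges G \<longleftrightarrow>
    (\<exists>p a. p \<in> F \<times> F \<and> a \<in> F \<and> a \<noteq> 0 \<and> u = code p \<and> v = code (step a p))"
proof
  assume "{u, v} \<in> edges G"
  then obtain a p where ap: "a \<in> F" "a \<noteq> 0" "p \<in> F \<times> F" "{u, v} = {code p, code (step a p)}"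
    by (auto simp: G_def)
  have "step a (step a p) = p" by (simp add: step_def add.assoc double)
  then show "\<exists>p a. p \<in> F \<times> F \<and> a \<in> F \<and> a \<noteq> 0 \<and> u = code p \<and> v = code (step a p)"
    using ap step_in[OF ap(1,3)] by (auto simp: doubleton_eq_iff) (metis)+
qed (auto simp: G_def)

lemma code_step_neq: "p \<in> F \<times> F \<Longrightarrow> a \<in> F \<Longrightarrow> a \<noteq> 0 \<Longrightarrow> code p \<noteq> code (step a p)"
  using decode_code[of p] decode_code[of "step a p"] step_in[of a p] by (auto simp: step_def prod_eq_iff)

lemma simple: "finite_simple_graph G"
  unfolding finite_simple_graph_def
proof (intro conjI ballI)
  show "finite (verts G)" by (simp add: G_def)
  fix e assume "e \<in> edges G"
  then obtain a p where ap: "a \<in> F" "a \<noteq> 0" "p \<in> F \<times> F" "e = {code p, code (step a p)}"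
    by (auto simp: G_def)
  show "e \<subseteq> verts G" using ap code_less step_in[OF ap(1,3)] by (auto simp: G_def)
  show "card e = 2" using ap code_step_neq[OF ap(3,1,2)] by simp
qed

lemma colouring_edge:
  assumes "p \<in> F \<times> F" "a \<in> F" "a \<noteq> 0"
  shows "colouring {code p, code (step a p)} = to_nat_on F a"
proof -
  have "(\<Sum>v\<in>{code p, code (step a p)}. fst (decode v)) = fst (decode (code p)) + fst (decode (code (step a p)))"
    using code_step_neq[OF assms] by simp
  also have "\<dots> = fst p + fst (step a p)"
    unfolding decode_code[OF assms(1)] decode_code[OF step_in[OF assms(2,1)]] ..
  also have "\<dots> = a" by (simp add: step_def double_left)
  finally show ?thesis by (simp add: colouring_def)
qed

lemma to_nat_on_F: "a \<in> F \<Longrightarrow> b \<in> F \<Longrightarrow> to_nat_on F a = to_nat_on F b \<longleftrightarrow> a = b"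
  using fin by (simp add: countable_finite)

lemma proper: "proper_edge_colouring G colouring"
  unfolding proper_edge_colouring_def
proof (intro ballI impI notI)
  fix e e' assume e: "e \<in> edges G" "e' \<in> edges G" "e \<noteq> e' \<and> e \<inter> e' \<noteq> {}" "colouring e = colouring e'"
  then obtain s where s: "s \<in> e" "s \<in> e'" by auto
  have "card e = 2" "card e' = 2" using e simple by (auto simp: finite_simple_graph_def)
  then obtain t t' where t: "e = {s, t}" "e' = {s, t'}" using s by (auto simp: card_2_iff)
  obtain p a where p: "p \<in> F \<times> F" "a \<in> F" "a \<noteq> 0" "s = code p" "t = code (step a p)"
    using e(1) edge_iff t(1) by auto
  obtain p' a' where p': "p' \<in> F \<times> F" "a' \<in> F" "a' \<noteq> 0" "s = code p'" "t' = code (step a' p')"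
    using e(2) edge_iff t(2) by auto
  have "p = p'" using p p' decode_code by metis
  moreover have "a = a'"
    using e(4) colouring_edge[OF p(1-3)] colouring_edge[OF p'(1-3)] to_nat_on_F p p' t by simp
  ultimately show False using e(3) t p p' by simp
qed

text \<open>Here \<open>d = a + b + c\<close>, and as 3 = 1 in characteristic two the four cubes sum
  to \<open>(a + b) * (b + c) * (a + c)\<close>. This is the Sidon property of the set of pairs
  \<open>(a, a ^ 3)\<close>.\<close>

lemma sum_cubes:
  assumes "a + b + c + d = 0" "a ^ 3 + b ^ 3 + c ^ 3 + d ^ 3 = (0 :: 'f)"
  shows "a = b \<or> b = c \<or> a = c"
proof -
  have "d = a + b + c" using assms(1) add_eq_0[of "a + b + c" d] by simp
  then have "0 = a ^ 3 + b ^ 3 + c ^ 3 + (a + b + c) ^ 3" using assms(2) by simp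
  also have "\<dots> = 2 * (a ^ 3 + b ^ 3 + c ^ 3 + (a + b) * (b + c) * (a + c)) + (a + b) * (b + c) * (a + c)"
    by (simp add: power3_eq_cube algebra_simps)
  finally have "(a + b) * (b + c) * (a + c) = 0" using two by simp
  then show ?thesis by (auto simp: add_eq_0)
qed

text \<open>Around a 4-cycle the directions sum to zero in both coordinates, so by
  \<open>sum_cubes\<close> two of them coincide, and two different edges have the same
  colour.\<close>

lemma not_rainbow:
  assumes "length xs = 4" "cycle_list G xs"
  shows "\<not> inj_on colouring (edges (cycle_of xs))"
proof
  assume inj: "inj_on colouring (edges (cycle_of xs))"
  let ?e = "\<lambda>i. {xs ! i, xs ! (Suc i mod 4)}"
  have d: "distinct xs" and e: "\<And>i. i < 4 \<Longrightarrow> ?e i \<in> edges G" using assms by (auto simp: cycle_list_def)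
  have ex: "\<exists>p a. p \<in> F \<times> F \<and> a \<in> F \<and> a \<noteq> 0 \<and> xs ! i = code p \<and> xs ! (Suc i mod 4) = code (step a p)" if "i < 4" for i
    using e[OF that] edge_iff by blast
  define a where "a i = fst (decode (xs ! i)) + fst (decode (xs ! (Suc i mod 4)))" for i
  have a: "a i \<in> F" "a i \<noteq> 0" "decode (xs ! (Suc i mod 4)) = step (a i) (decode (xs ! i))" "colouring (?e i) = to_nat_on F (a i)"
    if i4: "i < 4" for i
  proof -
    obtain p b where p: "p \<in> F \<times> F" "b \<in> F" "b \<noteq> 0" "xs ! i = code p" "xs ! (Suc i mod 4) = code (step b p)"
      using ex[OF i4] by blast
    have "a i = fst p + fst (step b p)"
      unfolding a_def p(4,5) decode_code[OF p(1)] decode_code[OF step_in[OF p(2,1)]] ..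
    then have "a i = b" by (simp add: step_def double_left)
    then show "a i \<in> F" "a i \<noteq> 0" "decode (xs ! (Suc i mod 4)) = step (a i) (decode (xs ! i))" "colouring (?e i) = to_nat_on F (a i)"
      using p decode_code[OF p(1)] decode_code[OF step_in[OF p(2,1)]] colouring_edge[OF p(1-3)] by simp_all
  qed
  have m4: "Suc 0 mod 4 = 1" "Suc 1 mod 4 = 2" "Suc 2 mod 4 = 3" "Suc 3 mod 4 = 0" by simp_all
  have s: "decode (xs ! 1) = step (a 0) (decode (xs ! 0))" "decode (xs ! 2) = step (a 1) (decode (xs ! 1))"
    "decode (xs ! 3) = step (a 2) (decode (xs ! 2))" "decode (xs ! 0) = step (a 3) (decode (xs ! 3))"
    using a(3)[of 0] a(3)[of 1] a(3)[of 2] a(3)[of 3] unfolding m4 by simp_all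
  have "decode (xs ! 0) = step (a 3) (step (a 2) (step (a 1) (step (a 0) (decode (xs ! 0)))))"
    using s(4) unfolding s(3) s(2) s(1) .
  then have "a 0 + a 1 + a 2 + a 3 = 0" "a 0 ^ 3 + a 1 ^ 3 + a 2 ^ 3 + a 3 ^ 3 = 0"
    by (simp_all add: step_def prod_eq_iff add.assoc)
  then consider "a 0 = a 1" | "a 1 = a 2" | "a 0 = a 2" using sum_cubes by blast
  then obtain i j :: nat where ij: "i < 4" "j < 4" "i \<noteq> j" "a i = a j"
  proof cases
    case 1 then show ?thesis by (intro that[of 0 1]) auto
  next
    case 2 then show ?thesis by (intro that[of 1 2]) auto
  next
    case 3 then show ?thesis by (intro that[of 0 2]) auto
  qed
  have "colouring (?e i) = colouring (?e j)" using a(4) ij by simp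
  moreover have "?e i \<in> edges (cycle_of xs)" "?e j \<in> edges (cycle_of xs)"
    using ij assms(1) by (auto simp: cycle_of_def)
  ultimately have "?e i = ?e j" using inj by (auto dest: inj_onD)
  then show False using cycle_edges_distinct[OF d assms(1) _ ij(1,2,3)] by simp
qed

lemma free: "rainbow_free (cycle_graph 4) G colouring"
proof -
  have "copies (cycle_graph 4) G = cycle_of ` {xs. length xs = 4 \<and> cycle_list G xs}"
    using copies_cycle_graph[OF simple, of 4] by simp
  then show ?thesis unfolding rainbow_free_def rainbow_def using not_rainbow by auto
qed

text \<open>The parallelogram with base point \<open>p\<close> and directions \<open>a\<close>,
  \<open>b\<close>. The choices number about \<open>card F ^ 4\<close>, which is of order
  \<open>n ^ 2\<close>.\<close>

definition square :: "('f \<times> 'f) \<times> 'f \<times> 'f \<Rightarrow> nat list" where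
  "square = (\<lambda>(p, a, b). [code p, code (step a p), code (step b (step a p)), code (step b p)])"

definition params :: "(('f \<times> 'f) \<times> 'f \<times> 'f) set" where
  "params = (F \<times> F) \<times> (SIGMA a:F - {0}. F - {0, a})"

lemma square_cycle:
  assumes "x \<in> params" shows "cycle_list G (square x)"
proof -
  obtain p a b where x: "x = (p, a, b)" "p \<in> F \<times> F" "a \<in> F" "b \<in> F" "a \<noteq> 0" "b \<noteq> 0" "a \<noteq> b"
    using assms by (auto simp: params_def)
  have s: "step a p \<in> F \<times> F" "step b p \<in> F \<times> F" "step b (step a p) \<in> F \<times> F" using x step_in by auto
  have comm: "step b (step a p) = step a (step b p)" by (simp add: step_def add_ac)
  have "distinct [p, step a p, step b (step a p), step b p]"
    using x add_eq_0[of a b] by (auto simp: step_def prod_eq_iff add.assoc)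
  moreover have "inj_on code (F \<times> F)" by (rule inj_onI) (metis decode_code)
  then have "inj_on code (set [p, step a p, step b (step a p), step b p])"
    by (rule inj_on_subset) (use x s in auto)
  ultimately have "distinct (map code [p, step a p, step b (step a p), step b p])" by (simp only: distinct_map)
  then have d: "distinct (square x)" by (simp add: square_def x)
  have edge: "{code p, code (step a p)} \<in> edges G" if "p \<in> F \<times> F" "a \<in> F" "a \<noteq> 0" for p a
    using that edge_iff by blast
  have "{code p, code (step a p)} \<in> edges G" by (rule edge[OF x(2,3,5)])
  moreover have "{code (step a p), code (step b (step a p))} \<in> edges G" by (rule edge[OF s(1) x(4,6)])
  moreover have "{code (step b (step a p)), code (step b p)} \<in> edges G"
    using edge[OF s(2) x(3,5)] unfolding comm by (simp only: insert_commute)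
  moreover have "{code (step b p), code p} \<in> edges G"
    using edge[OF x(2) x(4,6)] by (simp only: insert_commute)
  ultimately have e: "{square x ! 0, square x ! 1} \<in> edges G" "{square x ! 1, square x ! 2} \<in> edges G"
    "{square x ! 2, square x ! 3} \<in> edges G" "{square x ! 3, square x ! 0} \<in> edges G"
    by (simp_all add: square_def x)
  have "{square x ! i, square x ! (Suc i mod 4)} \<in> edges G" if "i < 4" for i
  proof -
    have m: "Suc 0 mod 4 = 1" "Suc 1 mod 4 = 2" "Suc 2 mod 4 = 3" "Suc 3 mod 4 = 0" by simp_all
    consider "i = 0" | "i = 1" | "i = 2" | "i = 3" using \<open>i < 4\<close> by linarith
    then show ?thesis using e by cases (simp_all only: m)
  qed
  moreover have "length (square x) = 4" by (simp add: square_def x)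
  ultimately show ?thesis using d unfolding cycle_list_def by simp
qed

lemma square_inj: "inj_on square params"
proof (rule inj_onI)
  fix x y assume xy: "x \<in> params" "y \<in> params" "square x = square y"
  obtain p a b where x: "x = (p, a, b)" "p \<in> F \<times> F" "a \<in> F" "b \<in> F"
    using xy(1) by (auto simp: params_def)
  obtain p' a' b' where y: "y = (p', a', b')" "p' \<in> F \<times> F" "a' \<in> F" "b' \<in> F"
    using xy(2) by (auto simp: params_def)
  have "code p = code p'" "code (step a p) = code (step a' p')" "code (step b p) = code (step b' p')"
    using xy(3) by (auto simp: square_def x y)
  then have "p = p'" "step a p = step a' p'" "step b p = step b' p'"
    using decode_code x y step_in by metis+
  then show "x = y" by (simp add: x y step_def)
qed

text \<open>With q = \<open>card F\<close> this amounts to q^2 \<le> 4 (q - 1)(q - 2), which holds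
  from q = 4 on; hence the lower bound on \<open>card F\<close> in the locale.\<close>

lemma card_params: "(card F * card F) ^ 2 \<le> 4 * card params"
proof -
  have "card (F - {0, a}) = card F - 2" if "a \<in> F - {0}" for a
    using that zero fin by (subst card_Diff_subset) (auto simp: card_insert_if)
  then have "card (SIGMA a:F - {0}. F - {0, a}) = (card F - 1) * (card F - 2)"
    using fin zero by (subst card_SigmaI) auto
  then have "card params = (card F * card F) * ((card F - 1) * (card F - 2))"
    by (simp add: params_def card_cartesian_product)
  moreover obtain r where r: "card F = r + 4" using card_F(1) by (metis add.commute le_Suc_ex)
  then have "card F * card F \<le> 4 * ((card F - 1) * (card F - 2))" by (simp add: algebra_simps)
  ultimately show ?thesis by (simp add: power2_eq_square)
qed

text \<open>The constant is the product of 16, from \<open>n < 4 * (card F * card F)\<close>, of 4,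
  from \<open>card_params\<close>, and of \<open>4 ^ 4\<close> lists for each copy.\<close>

lemma square_le_ex_rainbow: "n ^ 2 \<le> 2 ^ 14 * ex_rainbow n (cycle_graph 4) (cycle_graph 4)"
proof -
  have "card params \<le> card {xs. length xs = 4 \<and> cycle_list G xs}"
  proof (rule card_inj_on_le[OF square_inj])
    show "square ` params \<subseteq> {xs. length xs = 4 \<and> cycle_list G xs}"
      using square_cycle by (auto simp: square_def)
    show "finite {xs. length xs = 4 \<and> cycle_list G xs}" by (rule finite_cycle_lists[OF simple])
  qed
  also have "\<dots> \<le> 4 ^ 4 * card (copies (cycle_graph 4) G)"
    using card_cycle_lists_le_copies[OF simple, of 4] by simp
  also have "\<dots> \<le> 4 ^ 4 * ex_rainbow n (cycle_graph 4) (cycle_graph 4)"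
    by (intro mult_le_mono2 ex_rainbow_ge[OF simple _ proper free]) (simp add: G_def)
  finally have "(card F * card F) ^ 2 \<le> 4 * (4 ^ 4 * ex_rainbow n (cycle_graph 4) (cycle_graph 4))"
    using card_params by linarith
  moreover have "n ^ 2 \<le> (4 * (card F * card F)) ^ 2" using card_F(3) by (intro power_mono) auto
  moreover have "(4 * (card F * card F)) ^ 2 = 16 * (card F * card F) ^ 2" by (simp add: power_mult_distrib)
  ultimately show ?thesis by simp
qed

end

lemma square_le_ex_rainbow_C4:
  assumes "n \<ge> 16"
  shows "n ^ 2 \<le> 2 ^ 14 * ex_rainbow n (cycle_graph 4) (cycle_graph 4)"
proof -
  \<comment> \<open>The largest power of four up to \<open>n\<close> becomes the number of vertices
    of the Cayley graph; the field has at least four elements because \<open>n\<close> is at least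
    16.\<close>
  obtain e where e: "4 ^ e \<le> n" "n < 4 ^ (e + 1)"
    using ex_power_ivl1[of 4 n] assms by auto
  have e2: "e \<ge> 2"
  proof (rule ccontr)
    assume "\<not> ?thesis"
    then have "(4 :: nat) ^ (e + 1) \<le> 4 ^ 2" by (intro power_increasing) auto
    then show False using e(2) assms by simp
  qed
  let ?F = "{x :: bit alg_closure. x ^ (2 ^ e) = x}"
  have F: "finite ?F" "card ?F = 2 ^ e" using card_frobenius_fixed[of e] e2 by auto
  have sq: "card ?F * card ?F = 4 ^ e" unfolding F(2) by (simp flip: power_mult_distrib)
  interpret char_2_set ?F n
  proof
    show "finite ?F" by (rule F)
    show "(2 :: bit alg_closure) = 0" by (metis bit_2_eq_0 to_ac_0 to_ac_numeral)
    show "0 \<in> ?F" by simp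
    show "x + y \<in> ?F" if "x \<in> ?F" "y \<in> ?F" for x y using that add_frobenius_fixed by simp
    show "x * y \<in> ?F" if "x \<in> ?F" "y \<in> ?F" for x y using that by (simp add: power_mult_distrib)
    show "4 \<le> card ?F" using power_increasing[OF e2, of "2 :: nat"] F(2) by simp
    show "card ?F * card ?F \<le> n" "n < 4 * (card ?F * card ?F)" unfolding sq using e by simp_all
  qed
  show ?thesis by (rule square_le_ex_rainbow)
qed

theorem theorem2p2:
  fixes k :: nat
  assumes "k \<ge> 2"
  shows "(k \<ge> 3 \<longrightarrow>
           (\<lambda>n. real (ex_rainbow n (cycle_graph (2 * k)) (cycle_graph (2 * k))))
             \<in> \<Theta>(\<lambda>n. real n ^ (k - 1))) \<and>
         (k = 2 \<longrightarrow>
           (\<lambda>n. real (ex_rainbow n (cycle_graph (2 * k)) (cycle_graph (2 * k))))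
             \<in> \<Theta>(\<lambda>n. real n ^ 2))"
proof -
  let ?f = "\<lambda>n. ex_rainbow n (cycle_graph (2 * k)) (cycle_graph (2 * k))"
  have theta: "(\<lambda>n. real (?f n)) \<in> \<Theta>(\<lambda>n. real n ^ j)"
    if upper: "\<And>n. ?f n \<le> C * n ^ j" and lower: "\<And>n. n \<ge> N \<Longrightarrow> n ^ j \<le> B * ?f n" for j C B N
  proof (rule bigthetaI)
    have "real (?f n) \<le> real C * real n ^ j" for n
      using upper[of n] by (metis of_nat_le_iff of_nat_mult of_nat_power)
    then show "(\<lambda>n. real (?f n)) \<in> O(\<lambda>n. real n ^ j)"
      by (intro bigoI[of _ "real C"]) auto
    have "real n ^ j \<le> real B * real (?f n)" if "n \<ge> N" for n
      using lower[OF that] by (metis of_nat_le_iff of_nat_mult of_nat_power)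
    then have "(\<lambda>n. real n ^ j) \<in> O(\<lambda>n. real (?f n))"
      by (intro bigoI[of _ "real B"] eventually_sequentiallyI[of N]) auto
    then show "(\<lambda>n. real (?f n)) \<in> \<Omega>(\<lambda>n. real n ^ j)" by (simp add: bigomega_iff_bigo)
  qed
  obtain C where C: "\<And>n. ?f n \<le> C * n ^ max 2 (k - 1)" using ex_rainbow_upper[OF assms] by blast
  show ?thesis
  proof (intro conjI impI)
    assume k: "k \<ge> 3"
    then have "max 2 (k - 1) = k - 1" by simp
    moreover have "n ^ (k - 1) \<le> (2 * k) ^ (k - 1) * (2 * k) ^ (2 * k) * ?f n" if "n \<ge> 3 * k" for n
    proof -
      interpret hub_graph k n using k that by unfold_locales
      show ?thesis by (rule power_le_ex_rainbow)
    qed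
    ultimately show "(\<lambda>n. real (?f n)) \<in> \<Theta>(\<lambda>n. real n ^ (k - 1))" using theta C by metis
  next
    assume k: "k = 2"
    then have "n ^ 2 \<le> 2 ^ 14 * ?f n" if "n \<ge> 16" for n
      using square_le_ex_rainbow_C4[OF that] by simp
    moreover have "max 2 (k - 1) = 2" using k by simp
    ultimately show "(\<lambda>n. real (?f n)) \<in> \<Theta>(\<lambda>n. real n ^ 2)" using theta C by metis
  qed
qed

end
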